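(* Let $X$ be a complex manifold, $D\subseteq X$ a smooth divisor with normal bundle $N_{D/X}$, and $(E,\nabla)$ a logarithmic connection on $X$ with poles along $D$. Let $(V,\delta)=(E,\nabla)_{|D}$ be its restriction to $D$, with the structure of $\mathrm{At}(N_{D/X})$-connection. Then the residue $\mathrm{res}_D\nabla\in\mathrm{End}_{\mathcal{O}_D}(E_{|D})$ coincides with $\delta_R$, the isotropy endomorphism of $\delta$.
   Context: All objects are holomorphic. $\Omega^1_X(\log D)$ is the sheaf of meromorphic $1$-forms $\eta$ such that $\eta$ and $d\eta$ have at most simple poles along $D$; in local coordinates with $D=\{x_1=0\}$ it has frame $dx_1/x_1,dx_2,\dots,dx_n$. Its dual $T_X(-\log D)$ is the sheaf of vector fields preserving the ideal of $D$, with frame $x_1\partial_{x_1},\partial_{x_2},\dots,\partial_{x_n}$. A logarithmic connection is a vector bundle $E$ on $X$ with a $\mathbb{C}$-linear map $\nabla:E\to E\otimes\Omega^1_X(\log D)$ satisfying $\nabla(fs)=f\nabla s+s\otimes df$; equivalently, $w\in T_X(-\log D)$ acts on $E$ by $\nabla_w$. Residue: the Poincaré residue $R_D:\Omega^1_X(\log D)\to\mathcal{O}_D$ is $\alpha^h+\alpha^0\frac{dx_1}{x_1}\mapsto\alpha^0_{|D}$ ($\alpha^h\in\Omega^1_X$, $\alpha^0\in\mathcal{O}_X$). The composition $E\xrightarrow{\nabla}E\otimes\Omega^1_X(\log D)\xrightarrow{R_D}E\otimes\mathcal{O}_D$ is $\mathcal{O}_X$-linear and vanishes on $E(-D)$,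 so it defines $\mathrm{res}_D\nabla\in\mathrm{End}_{\mathcal{O}_D}(E_{|D})$. Atiyah algebroid: for a line bundle $N$ on $D$, $\mathrm{At}(N)$ is the sheaf of $\mathbb{C}$-linear endomorphisms $\Delta$ of $N$ for which there is $\sigma_\Delta\in T_D$ with $\Delta(fs)=f\Delta s+\sigma_\Delta(f)s$ for $f\in\mathcal{O}_D$, $s\in N$; it is a Lie algebroid over $D$ with anchor $\Delta\mapsto\sigma_\Delta$ and commutator bracket. There is an exact sequence $0\to\mathcal{O}_D\xrightarrow{R}\mathrm{At}(N)\to T_D\to0$ with $R(f)=f\cdot\mathrm{id}_N$; let $R^*:\mathrm{At}(N)^*\to\mathcal{O}_D$ be the dual of $R$. An $\mathrm{At}(N)$-connection on a vector bundle $V$ on $D$ is a $\mathbb{C}$-linear map $\delta:V\to V\otimes\mathrm{At}(N)^*$ satisfying the Leibniz rule with respect to the anchor. Its isotropy endomorphism $\delta_R\in\mathrm{End}_{\mathcal{O}_D}(V)$ is the composition of $\delta$ with $R^*$, i.e. the action on $V$ of $R(1)$. Restriction: $T_X(-\log D)_{|D}$ is a Lie algebroid over $D$ (anchor and bracket induced from those of vector fields on $X$ tangent to $D$), and it is isomorphic as a Lie algebroid to $\mathrm{At}(N_{D/X})$; the isomorphism sends $\xi=w_{|D}$, $w\in T_X(-\log D)$, to the operator $\gamma\mapsto\pi([w,v]_{|D})$ on $N_{D/X}$, where $\pi:T_{X|D}\to N_{D/X}$ is the projection and $v\in T_X$ is any lift of $\gamma$, i.e. $\pi(v_{|D})=\gamma$.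 Through this isomorphism, the action $\delta_{w_{|D}}(e_{|D})=(\nabla_we)_{|D}$ for $w\in T_X(-\log D)$, $e\in E$, makes $V=E_{|D}$ an $\mathrm{At}(N_{D/X})$-connection.
   Formalization: The sign is corrected: the formal statement says the residue equals minus the isotropy endomorphism, since [x∂_x,∂_x] = −∂_x makes R(1) correspond to −x∂_x; for d + λ dx/x on C with D = {0}, the residue is λ but δ_R = −λ. *)

theory Defs
  imports "HOL-Analysis.Analysis" "HOL-Algebra.Module" "HOL-Algebra.AbelCoset"
begin

text \<open>
  Geometric objects are encoded as spaces with a sheaf of functions. A section over \<open>U\<close> is a total
  function of which only the values on \<open>U\<close> matter. A morphism of sheaves is an operator on total
  functions whose values on \<open>V\<close> depend only on the values on \<open>V\<close> of its argument, for arguments that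
  are sections over \<open>V\<close>; this builds in the compatibility with restriction maps.
\<close>

section \<open>Complex manifolds and smooth divisors\<close>

definition holomorphic_fun :: "(complex ^ 'n::finite \<Rightarrow> complex) \<Rightarrow> (complex ^ 'n) set \<Rightarrow> bool" where
  "holomorphic_fun f S \<longleftrightarrow>
     (\<forall>z\<in>S. \<exists>f'. (f has_derivative f') (at z) \<and> (\<forall>c v. f' (c *s v) = c * f' v))"

record 'a cspace =
  topo :: "'a topology"
  hol :: "'a set \<Rightarrow> ('a \<Rightarrow> complex) set"

definition function_sheaf :: "'a topology \<Rightarrow> ('a set \<Rightarrow> ('a \<Rightarrow> 'b) set) \<Rightarrow> bool" where
  "function_sheaf T F \<longleftrightarrow>
     (\<forall>U f g. openin T U \<and> f \<in> F U \<and> (\<forall>q\<in>U. f q = g q) \<longrightarrow> g \<in> F U) \<and>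
     (\<forall>U V f. openin T U \<and> openin T V \<and> V \<subseteq> U \<and> f \<in> F U \<longrightarrow> f \<in> F V) \<and>
     (\<forall>U f. openin T U \<and> (\<forall>p\<in>U. \<exists>V. openin T V \<and> p \<in> V \<and> V \<subseteq> U \<and> f \<in> F V) \<longrightarrow> f \<in> F U)"

definition chart :: "'a cspace \<Rightarrow> 'a set \<Rightarrow> ('a \<Rightarrow> complex ^ 'n::finite) \<Rightarrow> bool" where
  "chart X U \<phi> \<longleftrightarrow>
     openin (topo X) U \<and> open (\<phi> ` U) \<and>
     homeomorphic_map (subtopology (topo X) U) (top_of_set (\<phi> ` U)) \<phi> \<and>
     (\<forall>V f. openin (topo X) V \<and> V \<subseteq> U \<longrightarrow>
        (f \<in> hol X V \<longleftrightarrow> holomorphic_fun (f \<circ> inv_into U \<phi>) (\<phi> ` V)))"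

definition complex_manifold :: "'n::finite itself \<Rightarrow> 'a cspace \<Rightarrow> bool" where
  "complex_manifold n X \<longleftrightarrow>
     Hausdorff_space (topo X) \<and> second_countable (topo X) \<and>
     function_sheaf (topo X) (hol X) \<and>
     (\<forall>p\<in>topspace (topo X). \<exists>U (\<phi> :: 'a \<Rightarrow> complex ^ 'n). p \<in> U \<and> chart X U \<phi>)"

text \<open>A chart in which \<open>D\<close> is the vanishing locus of the coordinate with index \<open>k\<close>.\<close>

definition adapted_chart ::
    "'a cspace \<Rightarrow> 'a set \<Rightarrow> 'a set \<Rightarrow> ('a \<Rightarrow> complex ^ 'n::finite) \<Rightarrow> 'n \<Rightarrow> bool" where
  "adapted_chart X D U \<phi> k \<longleftrightarrow> chart X U \<phi> \<and> D \<inter> U = {q \<in> U. \<phi> q $ k = 0}"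

definition smooth_divisor :: "'n::finite itself \<Rightarrow> 'a cspace \<Rightarrow> 'a set \<Rightarrow> bool" where
  "smooth_divisor n X D \<longleftrightarrow>
     closedin (topo X) D \<and>
     (\<forall>p\<in>D. \<exists>U (\<phi> :: 'a \<Rightarrow> complex ^ 'n) k. p \<in> U \<and> adapted_chart X D U \<phi> k)"

text \<open>Sections over a subset: functions that are locally restrictions of sections over open sets of
  the ambient space.\<close>

definition restrict_sheaf ::
    "'a topology \<Rightarrow> ('a set \<Rightarrow> ('a \<Rightarrow> 'b) set) \<Rightarrow> 'a set \<Rightarrow> ('a \<Rightarrow> 'b) set" where
  "restrict_sheaf T F W =
     {f. \<forall>p\<in>W. \<exists>U g. openin T U \<and> p \<in> U \<and> g \<in> F U \<and> (\<forall>q\<in>U \<inter> W. f q = g q)}"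

definition subspace_of :: "'a cspace \<Rightarrow> 'a set \<Rightarrow> 'a cspace" where
  "subspace_of X D = \<lparr>topo = subtopology (topo X) D, hol = restrict_sheaf (topo X) (hol X)\<rparr>"

section \<open>Vector bundles\<close>

definition complex_field :: "complex ring" where
  "complex_field = \<lparr>carrier = UNIV, mult = (*), one = 1, zero = 0, add = (+)\<rparr>"

text \<open>A bundle consists of complex vector spaces indexed by the points of the base (their ring
  multiplication is a dummy, as usual for modules) and of the sheaf of its holomorphic sections.\<close>

record ('a, 'v) vbundle =
  fib :: "'a \<Rightarrow> (complex, 'v) module"
  sec :: "'a set \<Rightarrow> ('a \<Rightarrow> 'v) set"

definition vector_bundle :: "'a cspace \<Rightarrow> ('a, 'v) vbundle \<Rightarrow> bool" where
  "vector_bundle X E \<longleftrightarrow>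
     (\<forall>p\<in>topspace (topo X). module complex_field (fib E p)) \<and>
     (\<forall>U s p. openin (topo X) U \<and> s \<in> sec E U \<and> p \<in> U \<longrightarrow> s p \<in> carrier (fib E p)) \<and>
     function_sheaf (topo X) (sec E) \<and>
     (\<forall>p\<in>topspace (topo X). \<exists>U (r :: nat) e. openin (topo X) U \<and> p \<in> U \<and>
        (\<forall>i<r. e i \<in> sec E U) \<and>
        (\<forall>q\<in>U. bij_betw (\<lambda>c. \<Oplus>\<^bsub>fib E q\<^esub>i\<in>{..<r}. c i \<odot>\<^bsub>fib E q\<^esub> e i q)
                  ({..<r} \<rightarrow>\<^sub>E UNIV) (carrier (fib E q))) \<and>
        (\<forall>V s. openin (topo X) V \<and> V \<subseteq> U \<longrightarrow>
           (s \<in> sec E V \<longleftrightarrow>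
              (\<exists>f. (\<forall>i<r. f i \<in> hol X V) \<and>
                   (\<forall>q\<in>V. s q = (\<Oplus>\<^bsub>fib E q\<^esub>i\<in>{..<r}. f i q \<odot>\<^bsub>fib E q\<^esub> e i q))))))"

definition restrict_bundle :: "'a cspace \<Rightarrow> ('a, 'v) vbundle \<Rightarrow> ('a, 'v) vbundle" where
  "restrict_bundle X E = \<lparr>fib = fib E, sec = restrict_sheaf (topo X) (sec E)\<rparr>"

section \<open>Vector fields and differential forms\<close>

text \<open>Tangent vectors at \<open>p\<close> are the derivations at \<open>p\<close> of the stalk of the structure sheaf. They are
  represented by functionals on all functions, which are required to vanish on the functions that are
  not holomorphic near \<open>p\<close>, so that the representation is unique.\<close>

type_synonym 'a tvec = "('a \<Rightarrow> complex) \<Rightarrow> complex"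

definition hol_near :: "'a cspace \<Rightarrow> 'a \<Rightarrow> ('a \<Rightarrow> complex) \<Rightarrow> bool" where
  "hol_near X p f \<longleftrightarrow> (\<exists>U. openin (topo X) U \<and> p \<in> U \<and> f \<in> hol X U)"

definition derivation_at :: "'a cspace \<Rightarrow> 'a \<Rightarrow> 'a tvec \<Rightarrow> bool" where
  "derivation_at X p d \<longleftrightarrow>
     (\<forall>f. \<not> hol_near X p f \<longrightarrow> d f = 0) \<and>
     (\<forall>f g. hol_near X p f \<and> hol_near X p g \<longrightarrow>
        ((\<exists>U. openin (topo X) U \<and> p \<in> U \<and> (\<forall>q\<in>U. f q = g q)) \<longrightarrow> d f = d g) \<and>
        (\<forall>c. d (\<lambda>q. c * f q) = c * d f) \<and>
        d (\<lambda>q. f q + g q) = d f + d g \<and>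
        d (\<lambda>q. f q * g q) = f p * d g + g p * d f)"

definition tangent_space :: "'a cspace \<Rightarrow> 'a \<Rightarrow> (complex, 'a tvec) module" where
  "tangent_space X p =
     \<lparr>carrier = {d. derivation_at X p d}, mult = undefined, one = undefined,
      zero = (\<lambda>f. 0), add = (\<lambda>d d' f. d f + d' f), smult = (\<lambda>c d f. c * d f)\<rparr>"

definition vector_fields :: "'a cspace \<Rightarrow> 'a set \<Rightarrow> ('a \<Rightarrow> 'a tvec) set" where
  "vector_fields X U =
     {w. (\<forall>p\<in>U. w p \<in> carrier (tangent_space X p)) \<and>
         (\<forall>V f. openin (topo X) V \<and> V \<subseteq> U \<and> f \<in> hol X V \<longrightarrow> (\<lambda>p. w p f) \<in> hol X V)}"

definition lie_bracket ::
    "'a cspace \<Rightarrow> ('a \<Rightarrow> 'a tvec) \<Rightarrow> ('a \<Rightarrow> 'a tvec) \<Rightarrow> 'a \<Rightarrow> 'a tvec" where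
  "lie_bracket X w v p f =
     (if hol_near X p f then w p (\<lambda>q. v q f) - v p (\<lambda>q. w q f) else 0)"

definition one_forms :: "'a cspace \<Rightarrow> 'a set \<Rightarrow> ('a \<Rightarrow> 'a tvec \<Rightarrow> complex) set" where
  "one_forms X U =
     {\<alpha>. (\<forall>p\<in>U. \<forall>d\<in>carrier (tangent_space X p). \<forall>d'\<in>carrier (tangent_space X p). \<forall>c.
             \<alpha> p (d \<oplus>\<^bsub>tangent_space X p\<^esub> d') = \<alpha> p d + \<alpha> p d' \<and>
             \<alpha> p (c \<odot>\<^bsub>tangent_space X p\<^esub> d) = c * \<alpha> p d) \<and>
         (\<forall>V v. openin (topo X) V \<and> V \<subseteq> U \<and> v \<in> vector_fields X V \<longrightarrow>
             (\<lambda>p. \<alpha> p (v p)) \<in> hol X V)}"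

definition two_forms :: "'a cspace \<Rightarrow> 'a set \<Rightarrow> ('a \<Rightarrow> 'a tvec \<Rightarrow> 'a tvec \<Rightarrow> complex) set" where
  "two_forms X U =
     {\<beta>. (\<forall>p\<in>U. \<forall>d\<in>carrier (tangent_space X p). \<forall>d'\<in>carrier (tangent_space X p).
             \<forall>d''\<in>carrier (tangent_space X p). \<forall>c.
             \<beta> p (d \<oplus>\<^bsub>tangent_space X p\<^esub> d') d'' = \<beta> p d d'' + \<beta> p d' d'' \<and>
             \<beta> p (c \<odot>\<^bsub>tangent_space X p\<^esub> d) d' = c * \<beta> p d d' \<and>
             \<beta> p d d' = - \<beta> p d' d) \<and>
         (\<forall>V v w. openin (topo X) V \<and> V \<subseteq> U \<and> v \<in> vector_fields X V \<and> w \<in> vector_fields X V \<longrightarrow>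
             (\<lambda>p. \<beta> p (v p) (w p)) \<in> hol X V)}"

text \<open>The value of the exterior derivative of \<open>\<alpha>\<close> on two vector fields.\<close>

definition ext_deriv ::
    "'a cspace \<Rightarrow> ('a \<Rightarrow> 'a tvec \<Rightarrow> complex) \<Rightarrow> ('a \<Rightarrow> 'a tvec) \<Rightarrow> ('a \<Rightarrow> 'a tvec) \<Rightarrow> 'a \<Rightarrow> complex" where
  "ext_deriv X \<alpha> v w p =
     v p (\<lambda>q. \<alpha> q (w q)) - w p (\<lambda>q. \<alpha> q (v q)) - \<alpha> p (lie_bracket X v w p)"

section \<open>Logarithmic vector fields and logarithmic forms\<close>

definition divisor_ideal :: "'a cspace \<Rightarrow> 'a set \<Rightarrow> 'a set \<Rightarrow> ('a \<Rightarrow> complex) set" where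
  "divisor_ideal X D U = {f \<in> hol X U. \<forall>q\<in>D \<inter> U. f q = 0}"

definition log_vector_fields :: "'a cspace \<Rightarrow> 'a set \<Rightarrow> 'a set \<Rightarrow> ('a \<Rightarrow> 'a tvec) set" where
  "log_vector_fields X D U =
     {w \<in> vector_fields X U. \<forall>V f. openin (topo X) V \<and> V \<subseteq> U \<and> f \<in> divisor_ideal X D V \<longrightarrow>
        (\<lambda>p. w p f) \<in> divisor_ideal X D V}"

text \<open>Forms with poles along \<open>D\<close> are forms on the complement of \<open>D\<close>. The pole is at most simple if the
  products with local sections of the ideal of \<open>D\<close> extend holomorphically across \<open>D\<close>; this is required
  of the form and of its exterior derivative.\<close>

definition log_forms :: "'a cspace \<Rightarrow> 'a set \<Rightarrow> 'a set \<Rightarrow> ('a \<Rightarrow> 'a tvec \<Rightarrow> complex) set" where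
  "log_forms X D U =
     {\<alpha> \<in> one_forms X (U - D). \<forall>V f. openin (topo X) V \<and> V \<subseteq> U \<and> f \<in> divisor_ideal X D V \<longrightarrow>
        (\<exists>\<beta>\<in>one_forms X V. \<forall>p\<in>V - D. \<forall>d\<in>carrier (tangent_space X p). \<beta> p d = f p * \<alpha> p d) \<and>
        (\<exists>\<beta>\<in>two_forms X V. \<forall>V' v w. openin (topo X) V' \<and> V' \<subseteq> V - D \<and>
            v \<in> vector_fields X V' \<and> w \<in> vector_fields X V' \<longrightarrow>
            (\<forall>p\<in>V'. \<beta> p (v p) (w p) = f p * ext_deriv X \<alpha> v w p))}"

text \<open>The Poincare residue at \<open>p\<close> of \<open>\<alpha>\<^sup>h + \<alpha>\<^sup>0 dx\<^sub>1 / x\<^sub>1\<close>, where \<open>x\<^sub>1\<close> is the coordinate with index \<open>k\<close> of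
  an adapted chart; \<open>dx\<^sub>1\<close> applied to a tangent vector \<open>d\<close> is \<open>d x\<^sub>1\<close>.\<close>

definition poincare_residue ::
    "'n::finite itself \<Rightarrow> 'a cspace \<Rightarrow> 'a set \<Rightarrow> ('a \<Rightarrow> 'a tvec \<Rightarrow> complex) \<Rightarrow> 'a \<Rightarrow> complex" where
  "poincare_residue n X D \<alpha> p =
     (THE c. \<exists>U (\<phi> :: 'a \<Rightarrow> complex ^ 'n) k \<alpha>\<^sub>h \<alpha>\<^sub>0.
        p \<in> U \<and> adapted_chart X D U \<phi> k \<and> \<alpha>\<^sub>h \<in> one_forms X U \<and> \<alpha>\<^sub>0 \<in> hol X U \<and>
        (\<forall>q\<in>U - D. \<forall>d\<in>carrier (tangent_space X q).
           \<alpha> q d = \<alpha>\<^sub>h q d + \<alpha>\<^sub>0 q * (d (\<lambda>y. \<phi> y $ k) / \<phi> q $ k)) \<and>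
        c = \<alpha>\<^sub>0 p)"

section \<open>Logarithmic connections and their residues\<close>

text \<open>Sections of \<open>E\<close> tensored with the logarithmic forms: as these sheaves are locally free, such a
  section is determined by the bundle-valued form that it induces on the complement of \<open>D\<close>, and it is
  locally a finite sum of tensors \<open>s\<^sub>j \<otimes> \<alpha>\<^sub>j\<close>.\<close>

definition is_tensor_sum ::
    "'a cspace \<Rightarrow> 'a set \<Rightarrow> ('a, 'v) vbundle \<Rightarrow> 'a set \<Rightarrow> ('a \<Rightarrow> 'a tvec \<Rightarrow> 'v) \<Rightarrow>
     nat \<Rightarrow> (nat \<Rightarrow> 'a \<Rightarrow> 'v) \<Rightarrow> (nat \<Rightarrow> 'a \<Rightarrow> 'a tvec \<Rightarrow> complex) \<Rightarrow> bool" where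
  "is_tensor_sum X D E U \<omega> m s \<alpha> \<longleftrightarrow>
     (\<forall>j<m. s j \<in> sec E U \<and> \<alpha> j \<in> log_forms X D U) \<and>
     (\<forall>q\<in>U - D. \<forall>d\<in>carrier (tangent_space X q).
        \<omega> q d = (\<Oplus>\<^bsub>fib E q\<^esub>j\<in>{..<m}. \<alpha> j q d \<odot>\<^bsub>fib E q\<^esub> s j q))"

definition bundle_log_forms ::
    "'a cspace \<Rightarrow> 'a set \<Rightarrow> ('a, 'v) vbundle \<Rightarrow> 'a set \<Rightarrow> ('a \<Rightarrow> 'a tvec \<Rightarrow> 'v) set" where
  "bundle_log_forms X D E U =
     {\<omega>. \<forall>p\<in>U. \<exists>V m s \<alpha>. openin (topo X) V \<and> p \<in> V \<and> V \<subseteq> U \<and> is_tensor_sum X D E V \<omega> m s \<alpha>}"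

definition log_connection ::
    "'a cspace \<Rightarrow> 'a set \<Rightarrow> ('a, 'v) vbundle \<Rightarrow> (('a \<Rightarrow> 'v) \<Rightarrow> 'a \<Rightarrow> 'a tvec \<Rightarrow> 'v) \<Rightarrow> bool" where
  "log_connection X D E nabla \<longleftrightarrow>
     (\<forall>U s. openin (topo X) U \<and> s \<in> sec E U \<longrightarrow> nabla s \<in> bundle_log_forms X D E U) \<and>
     (\<forall>U s t f c. openin (topo X) U \<and> s \<in> sec E U \<and> t \<in> sec E U \<and> f \<in> hol X U \<longrightarrow>
        (\<forall>q\<in>U - D. \<forall>d\<in>carrier (tangent_space X q).
           ((\<forall>y\<in>U. s y = t y) \<longrightarrow> nabla s q d = nabla t q d) \<and>
           nabla (\<lambda>y. s y \<oplus>\<^bsub>fib E y\<^esub> t y) q d = nabla s q d \<oplus>\<^bsub>fib E q\<^esub> nabla t q d \<and>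
           nabla (\<lambda>y. c \<odot>\<^bsub>fib E y\<^esub> s y) q d = c \<odot>\<^bsub>fib E q\<^esub> nabla s q d \<and>
           nabla (\<lambda>y. f y \<odot>\<^bsub>fib E y\<^esub> s y) q d =
             f q \<odot>\<^bsub>fib E q\<^esub> nabla s q d \<oplus>\<^bsub>fib E q\<^esub> d f \<odot>\<^bsub>fib E q\<^esub> s q))"

text \<open>The section \<open>\<nabla>\<^sub>w e\<close>: the holomorphic extension across \<open>D\<close> of the contraction of \<open>\<nabla> e\<close> with the
  logarithmic vector field \<open>w\<close>.\<close>

definition covariant_deriv ::
    "'a cspace \<Rightarrow> 'a set \<Rightarrow> ('a, 'v) vbundle \<Rightarrow> (('a \<Rightarrow> 'v) \<Rightarrow> 'a \<Rightarrow> 'a tvec \<Rightarrow> 'v) \<Rightarrow>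
     ('a \<Rightarrow> 'a tvec) \<Rightarrow> ('a \<Rightarrow> 'v) \<Rightarrow> 'a \<Rightarrow> 'v" where
  "covariant_deriv X D E nabla w e p =
     (THE z. \<exists>U t. openin (topo X) U \<and> p \<in> U \<and> t \<in> sec E U \<and>
        (\<forall>q\<in>U - D. t q = nabla e q (w q)) \<and> z = t p)"

text \<open>The map \<open>id \<otimes> R\<^sub>D\<close> from bundle-valued logarithmic forms to the restriction of the bundle.\<close>

definition bundle_residue ::
    "'n::finite itself \<Rightarrow> 'a cspace \<Rightarrow> 'a set \<Rightarrow> ('a, 'v) vbundle \<Rightarrow>
     ('a \<Rightarrow> 'a tvec \<Rightarrow> 'v) \<Rightarrow> 'a \<Rightarrow> 'v" where
  "bundle_residue n X D E \<omega> p =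
     (THE z. \<exists>U m s \<alpha>. openin (topo X) U \<and> p \<in> U \<and> is_tensor_sum X D E U \<omega> m s \<alpha> \<and>
        z = (\<Oplus>\<^bsub>fib E p\<^esub>j\<in>{..<m}. poincare_residue n X D (\<alpha> j) p \<odot>\<^bsub>fib E p\<^esub> s j p))"

text \<open>The residue endomorphism, acting on sections \<open>s\<close> of the restriction of \<open>E\<close> to \<open>D\<close> through local
  extensions \<open>e\<close> of \<open>s\<close> to sections of \<open>E\<close>.\<close>

definition residue_endo ::
    "'n::finite itself \<Rightarrow> 'a cspace \<Rightarrow> 'a set \<Rightarrow> ('a, 'v) vbundle \<Rightarrow>
     (('a \<Rightarrow> 'v) \<Rightarrow> 'a \<Rightarrow> 'a tvec \<Rightarrow> 'v) \<Rightarrow> ('a \<Rightarrow> 'v) \<Rightarrow> 'a \<Rightarrow> 'v" where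
  "residue_endo n X D E nabla s p =
     (THE z. \<exists>U e. openin (topo X) U \<and> p \<in> U \<and> e \<in> sec E U \<and> (\<forall>q\<in>U \<inter> D. s q = e q) \<and>
        z = bundle_residue n X D E (nabla e) p)"

section \<open>The normal bundle and its Atiyah algebroid\<close>

definition quotient_module :: "(complex, 'v) module \<Rightarrow> 'v set \<Rightarrow> (complex, 'v set) module" where
  "quotient_module M H =
     \<lparr>carrier = a_rcosets\<^bsub>M\<^esub> H, mult = undefined, one = undefined, zero = H, add = set_add M,
      smult = (\<lambda>c A. H <+>\<^bsub>M\<^esub> (\<lambda>x. c \<odot>\<^bsub>M\<^esub> x) ` A)\<rparr>"

text \<open>The image of the tangent space of \<open>D\<close> in that of \<open>X\<close>: a derivation of functions on \<open>D\<close> is applied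
  to functions on \<open>X\<close> by restricting them to \<open>D\<close>.\<close>

definition tangent_to :: "'a cspace \<Rightarrow> 'a set \<Rightarrow> 'a \<Rightarrow> 'a tvec set" where
  "tangent_to X D p =
     (\<lambda>d f. if hol_near X p f then d f else 0) ` carrier (tangent_space (subspace_of X D) p)"

definition normal_proj :: "'a cspace \<Rightarrow> 'a set \<Rightarrow> 'a \<Rightarrow> 'a tvec \<Rightarrow> 'a tvec set" where
  "normal_proj X D p d = tangent_to X D p +>\<^bsub>tangent_space X p\<^esub> d"

definition normal_bundle :: "'a cspace \<Rightarrow> 'a set \<Rightarrow> ('a, 'a tvec set) vbundle" where
  "normal_bundle X D =
     \<lparr>fib = (\<lambda>p. quotient_module (tangent_space X p) (tangent_to X D p)),
      sec = restrict_sheaf (topo X)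
              (\<lambda>U. (\<lambda>v q. normal_proj X D q (v q)) ` vector_fields X U)\<rparr>"

text \<open>Here \<open>Y\<close> is the base of the bundle \<open>N\<close>.\<close>

definition atiyah ::
    "'a cspace \<Rightarrow> ('a, 'b) vbundle \<Rightarrow> 'a set \<Rightarrow> (('a \<Rightarrow> 'b) \<Rightarrow> 'a \<Rightarrow> 'b) set" where
  "atiyah Y N W =
     {\<Delta>. (\<forall>V \<gamma>. openin (topo Y) V \<and> V \<subseteq> W \<and> \<gamma> \<in> sec N V \<longrightarrow> \<Delta> \<gamma> \<in> sec N V) \<and>
         (\<exists>\<sigma>\<in>vector_fields Y W. \<forall>V \<gamma> \<eta> f c.
            openin (topo Y) V \<and> V \<subseteq> W \<and> \<gamma> \<in> sec N V \<and> \<eta> \<in> sec N V \<and> f \<in> hol Y V \<longrightarrow>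
            (\<forall>p\<in>V.
               ((\<forall>q\<in>V. \<gamma> q = \<eta> q) \<longrightarrow> \<Delta> \<gamma> p = \<Delta> \<eta> p) \<and>
               \<Delta> (\<lambda>q. \<gamma> q \<oplus>\<^bsub>fib N q\<^esub> \<eta> q) p = \<Delta> \<gamma> p \<oplus>\<^bsub>fib N p\<^esub> \<Delta> \<eta> p \<and>
               \<Delta> (\<lambda>q. c \<odot>\<^bsub>fib N q\<^esub> \<gamma> q) p = c \<odot>\<^bsub>fib N p\<^esub> \<Delta> \<gamma> p \<and>
               \<Delta> (\<lambda>q. f q \<odot>\<^bsub>fib N q\<^esub> \<gamma> q) p =
                 f p \<odot>\<^bsub>fib N p\<^esub> \<Delta> \<gamma> p \<oplus>\<^bsub>fib N p\<^esub> \<sigma> p f \<odot>\<^bsub>fib N p\<^esub> \<gamma> p))}"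

text \<open>Equality of two sections of the Atiyah algebroid over \<open>W\<close>.\<close>

definition atiyah_eq ::
    "'a cspace \<Rightarrow> ('a, 'b) vbundle \<Rightarrow> 'a set \<Rightarrow>
     (('a \<Rightarrow> 'b) \<Rightarrow> 'a \<Rightarrow> 'b) \<Rightarrow> (('a \<Rightarrow> 'b) \<Rightarrow> 'a \<Rightarrow> 'b) \<Rightarrow> bool" where
  "atiyah_eq Y N W \<Delta> \<Delta>' \<longleftrightarrow>
     (\<forall>V \<gamma>. openin (topo Y) V \<and> V \<subseteq> W \<and> \<gamma> \<in> sec N V \<longrightarrow> (\<forall>p\<in>V. \<Delta> \<gamma> p = \<Delta>' \<gamma> p))"

definition atiyah_R :: "('a, 'b) vbundle \<Rightarrow> ('a \<Rightarrow> complex) \<Rightarrow> ('a \<Rightarrow> 'b) \<Rightarrow> 'a \<Rightarrow> 'b" where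
  "atiyah_R N f \<gamma> p = f p \<odot>\<^bsub>fib N p\<^esub> \<gamma> p"

text \<open>The operator on the normal bundle defined by a logarithmic vector field \<open>w\<close>; it sends \<open>\<gamma>\<close> to
  the class of \<open>[w, v]\<close> for any local vector field \<open>v\<close> lifting \<open>\<gamma>\<close>.\<close>

definition atiyah_of_log ::
    "'a cspace \<Rightarrow> 'a set \<Rightarrow> ('a \<Rightarrow> 'a tvec) \<Rightarrow> ('a \<Rightarrow> 'a tvec set) \<Rightarrow> 'a \<Rightarrow> 'a tvec set" where
  "atiyah_of_log X D w \<gamma> p =
     (THE z. \<exists>U v. openin (topo X) U \<and> p \<in> U \<and> v \<in> vector_fields X U \<and>
        (\<forall>q\<in>U \<inter> D. normal_proj X D q (v q) = \<gamma> q) \<and>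
        z = normal_proj X D p (lie_bracket X w v p))"

section \<open>The restricted connection and its isotropy\<close>

text \<open>The restriction of \<open>(E, \<nabla>)\<close> to \<open>D\<close>, as an action of sections \<open>\<Delta>\<close> of the Atiyah algebroid of the
  normal bundle on sections \<open>s\<close> of the restriction of \<open>E\<close>: locally \<open>\<Delta>\<close> corresponds to the restriction
  of some logarithmic vector field \<open>w\<close>, \<open>s\<close> is the restriction of some section \<open>e\<close> of \<open>E\<close>, and the
  result is the restriction of \<open>\<nabla>\<^sub>w e\<close>.\<close>

definition restricted_connection ::
    "'a cspace \<Rightarrow> 'a set \<Rightarrow> ('a, 'v) vbundle \<Rightarrow> (('a \<Rightarrow> 'v) \<Rightarrow> 'a \<Rightarrow> 'a tvec \<Rightarrow> 'v) \<Rightarrow>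
     (('a \<Rightarrow> 'a tvec set) \<Rightarrow> 'a \<Rightarrow> 'a tvec set) \<Rightarrow> ('a \<Rightarrow> 'v) \<Rightarrow> 'a \<Rightarrow> 'v" where
  "restricted_connection X D E nabla \<Delta> s p =
     (THE z. \<exists>U w e. openin (topo X) U \<and> p \<in> U \<and>
        w \<in> log_vector_fields X D U \<and> e \<in> sec E U \<and>
        \<Delta> \<in> atiyah (subspace_of X D) (normal_bundle X D) (U \<inter> D) \<and>
        atiyah_eq (subspace_of X D) (normal_bundle X D) (U \<inter> D) \<Delta> (atiyah_of_log X D w) \<and>
        (\<forall>q\<in>U \<inter> D. s q = e q) \<and>
        z = covariant_deriv X D E nabla w e p)"

text \<open>The isotropy endomorphism of a connection \<open>\<delta>\<close> along the Atiyah algebroid of \<open>N\<close>: the action of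
  \<open>R(1)\<close>, the identity of \<open>N\<close>. Sign pitfall for the normal bundle of \<open>D = {x\<^sub>1 = 0}\<close>: the generator of
  the normal bundle is the class of \<open>\<partial>\<^sub>1\<close>, and \<open>[x\<^sub>1 \<partial>\<^sub>1, \<partial>\<^sub>1] = - \<partial>\<^sub>1\<close>, so \<open>R(1)\<close> corresponds to the
  restriction of \<open>- x\<^sub>1 \<partial>\<^sub>1\<close>, whereas the residue is the action of \<open>x\<^sub>1 \<partial>\<^sub>1\<close>.\<close>

definition isotropy ::
    "('a, 'b) vbundle \<Rightarrow> ((('a \<Rightarrow> 'b) \<Rightarrow> 'a \<Rightarrow> 'b) \<Rightarrow> ('a \<Rightarrow> 'v) \<Rightarrow> 'a \<Rightarrow> 'v) \<Rightarrow>
     ('a \<Rightarrow> 'v) \<Rightarrow> 'a \<Rightarrow> 'v" where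
  "isotropy N \<delta> s = \<delta> (atiyah_R N (\<lambda>_. 1)) s"

end

theory Submission
  imports Defs "HOL-Complex_Analysis.Cauchy_Integral_Formula"
begin

text \<open>
  In a frame of \<open>E\<close> near a point of \<open>D = {x = 0}\<close>, the coefficients of \<open>\<nabla> e\<close> are \<open>H\<^sub>i + G\<^sub>i dx / x\<close> with
  \<open>H\<^sub>i\<close> and \<open>G\<^sub>i\<close> holomorphic, and the residue of \<open>\<nabla> e\<close> has coefficients \<open>G\<^sub>i\<close> on \<open>D\<close>. If \<open>w\<close> is a logarithmic vector
  field with \<open>w x = a x\<close>, then \<open>\<nabla>\<^sub>w e\<close> has coefficients \<open>H\<^sub>i w + a G\<^sub>i\<close>. Assume that \<open>[w, v] \<equiv> v\<close> modulo
  the vectors tangent to \<open>D\<close> for all \<open>v\<close>. Taking \<open>v = \<partial>\<^sub>x\<close> gives \<open>a = - 1\<close> on \<open>D\<close>, and \<open>v = x\<^sub>j \<partial>\<^sub>x\<close>, for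
  every coordinate \<open>x\<^sub>j\<close>, then gives \<open>w = 0\<close> along \<open>D\<close>, so that \<open>\<nabla>\<^sub>w e\<close> has coefficients \<open>- G\<^sub>i\<close> there.
\<close>

section \<open>Holomorphic functions of several variables\<close>

text \<open>The operators in the statement are definite descriptions: each value is read off from
  some chart, lift, extension or tensor representation. Most of the proof is therefore existence and
  independence of choices. Two facts settle the latter. Holomorphic functions that agree off
  \<open>D\<close> agree on \<open>D\<close>, since a point of \<open>D\<close> can be left along
  the transverse coordinate; this fixes polar parts and extensions across \<open>D\<close>. And a
  function vanishing on \<open>D\<close> is locally a multiple of the equation x of
  \<open>D\<close>, so a derivation killing x sees only restrictions to \<open>D\<close>, and a
  class in the normal bundle is determined by the value of a representative on x. The second fact is
  Hadamard's lemma. It needs holomorphic partial derivatives, while \<open>holomorphic_fun\<close>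
  demands only complex differentiability at each point; they come from Cauchy's formula on
  coordinate lines and differentiation under the integral. The minus sign in the conclusion is that
  of [x \<partial>, \<partial>] = - \<partial>: the identity of the normal bundle is induced by - x
  \<partial>, whereas the residue is the action of x \<partial>.\<close>

definition partial :: "'n::finite \<Rightarrow> (complex ^ 'n \<Rightarrow> complex) \<Rightarrow> complex ^ 'n \<Rightarrow> complex" where
  "partial j f z = frechet_derivative f (at z) (axis j 1)"

lemma holomorphic_fun_subset: "holomorphic_fun f S \<Longrightarrow> T \<subseteq> S \<Longrightarrow> holomorphic_fun f T"
  unfolding holomorphic_fun_def by blast

lemma complex_linear_expansion:
  fixes f' :: "complex ^ 'n::finite \<Rightarrow> complex"
  assumes "linear f'" and "\<And>c v. f' (c *s v) = c * f' v"
  shows "f' v = (\<Sum>j\<in>UNIV. v $ j * f' (axis j 1))"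
proof -
  have "v = (\<Sum>j\<in>UNIV. v $ j *s axis j 1)"
    by (simp add: basis_expansion)
  then have "f' v = f' (\<Sum>j\<in>UNIV. v $ j *s axis j 1)"
    by simp
  also have "\<dots> = (\<Sum>j\<in>UNIV. f' (v $ j *s axis j 1))"
    using assms(1) by (rule linear_sum)
  finally show ?thesis by (simp add: assms(2))
qed

lemma holomorphic_fun_has_derivative:
  assumes "holomorphic_fun f S" "z \<in> S"
  shows "(f has_derivative (\<lambda>v. \<Sum>j\<in>UNIV. v $ j * partial j f z)) (at z)"
proof -
  obtain f' where f': "(f has_derivative f') (at z)" "\<And>c v. f' (c *s v) = c * f' v"
    using assms unfolding holomorphic_fun_def by blast
  have "frechet_derivative f (at z) = f'"
    using f'(1) frechet_derivative_at by metis
  then have "f' v = (\<Sum>j\<in>UNIV. v $ j * partial j f z)" for v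
    unfolding partial_def by (simp only: complex_linear_expansion[OF has_derivative_linear[OF f'(1)] f'(2), symmetric])
  then have "f' = (\<lambda>v. \<Sum>j\<in>UNIV. v $ j * partial j f z)" by (rule ext)
  with f'(1) show ?thesis by simp
qed

lemma holomorphic_funI:
  fixes f :: "complex ^ 'n::finite \<Rightarrow> complex"
  assumes "\<And>z. z \<in> S \<Longrightarrow> (f has_derivative (\<lambda>v. \<Sum>j\<in>UNIV. v $ j * g j z)) (at z)"
  shows "holomorphic_fun f S"
  unfolding holomorphic_fun_def
proof
  fix z assume "z \<in> S"
  then show "\<exists>f'. (f has_derivative f') (at z) \<and> (\<forall>c v. f' (c *s v) = c * f' v)"
    using assms by (intro exI[of _ "\<lambda>v. \<Sum>j\<in>UNIV. v $ j * g j z"])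
      (simp add: sum_distrib_left mult.assoc)
qed

lemma partial_eqI:
  assumes "(f has_derivative (\<lambda>v. \<Sum>i\<in>UNIV. v $ i * g i)) (at z)"
  shows "partial j f z = g j"
proof -
  have "frechet_derivative f (at z) = (\<lambda>v. \<Sum>i\<in>UNIV. v $ i * g i)"
    using frechet_derivative_at[OF assms] by simp
  then have "partial j f z = (\<Sum>i\<in>UNIV. axis j 1 $ i * g i)"
    unfolding partial_def by simp
  also have "\<dots> = (\<Sum>i\<in>UNIV. if i = j then g i else 0)"
    by (intro sum.cong) (auto simp: axis_def)
  finally show ?thesis by simp
qed

lemma holomorphic_fun_continuous_on: "holomorphic_fun f S \<Longrightarrow> continuous_on S f"
  by (intro continuous_at_imp_continuous_on ballI has_derivative_continuous[OF holomorphic_fun_has_derivative])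

lemma holomorphic_fun_const: "holomorphic_fun (\<lambda>_. c) S"
  unfolding holomorphic_fun_def by (intro ballI exI[of _ "\<lambda>_. 0"]) auto

lemma has_derivative_coordinate:
  "((\<lambda>z. z $ i) has_derivative (\<lambda>v. \<Sum>j\<in>UNIV. v $ j * (if j = i then 1 else 0))) (at (z :: complex ^ 'n::finite))"
proof -
  have "bounded_linear (\<lambda>v :: complex ^ 'n. v $ i)" by (rule bounded_linear_vec_nth)
  then have "((\<lambda>v :: complex ^ 'n. v $ i) has_derivative (\<lambda>v. v $ i)) (at z)"
    by (rule bounded_linear_imp_has_derivative)
  moreover have "(\<lambda>v :: complex ^ 'n. v $ i) = (\<lambda>v. \<Sum>j\<in>UNIV. v $ j * (if j = i then 1 else 0))"
    by (rule ext) (simp add: if_distrib[of "\<lambda>x. _ * x"] cong: if_cong)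
  ultimately show ?thesis by simp
qed

lemma holomorphic_fun_coordinate: "holomorphic_fun (\<lambda>z. z $ i) S"
  by (rule holomorphic_funI) (rule has_derivative_coordinate)

lemma partial_coordinate: "partial j (\<lambda>z. z $ i) z = (if j = i then 1 else 0)"
  by (rule partial_eqI[OF has_derivative_coordinate])

lemma has_derivative_add_partial:
  assumes "holomorphic_fun f S" "holomorphic_fun g S" "z \<in> S"
  shows "((\<lambda>y. f y + g y) has_derivative
          (\<lambda>v. \<Sum>j\<in>UNIV. v $ j * (partial j f z + partial j g z))) (at z)"
  using has_derivative_add[OF holomorphic_fun_has_derivative holomorphic_fun_has_derivative] assms
  by (simp add: distrib_left sum.distrib)

lemma has_derivative_mult_partial:
  fixes f g :: "complex ^ 'n::finite \<Rightarrow> complex"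
  assumes "holomorphic_fun f S" "holomorphic_fun g S" "z \<in> S"
  shows "((\<lambda>y. f y * g y) has_derivative
          (\<lambda>v. \<Sum>j\<in>UNIV. v $ j * (f z * partial j g z + g z * partial j f z))) (at z)"
proof -
  note has_derivative_mult[OF holomorphic_fun_has_derivative holomorphic_fun_has_derivative,
      OF assms(1,3) assms(2,3)]
  moreover have "(\<lambda>v :: complex ^ 'n. f z * (\<Sum>j\<in>UNIV. v $ j * partial j g z) + (\<Sum>j\<in>UNIV. v $ j * partial j f z) * g z)
      = (\<lambda>v. \<Sum>j\<in>UNIV. v $ j * (f z * partial j g z + g z * partial j f z))"
    by (rule ext) (simp add: distrib_left sum.distrib sum_distrib_left sum_distrib_right mult_ac)
  ultimately show ?thesis by simp
qed

lemma holomorphic_fun_add: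
  "holomorphic_fun f S \<Longrightarrow> holomorphic_fun g S \<Longrightarrow> holomorphic_fun (\<lambda>z. f z + g z) S"
  by (rule holomorphic_funI) (rule has_derivative_add_partial)

lemma holomorphic_fun_mult:
  "holomorphic_fun f S \<Longrightarrow> holomorphic_fun g S \<Longrightarrow> holomorphic_fun (\<lambda>z. f z * g z) S"
  by (rule holomorphic_funI) (rule has_derivative_mult_partial)

lemma partial_add:
  "holomorphic_fun f S \<Longrightarrow> holomorphic_fun g S \<Longrightarrow> z \<in> S \<Longrightarrow>
     partial j (\<lambda>y. f y + g y) z = partial j f z + partial j g z"
  by (rule partial_eqI[OF has_derivative_add_partial])

lemma partial_mult:
  "holomorphic_fun f S \<Longrightarrow> holomorphic_fun g S \<Longrightarrow> z \<in> S \<Longrightarrow>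
     partial j (\<lambda>y. f y * g y) z = f z * partial j g z + g z * partial j f z"
  by (rule partial_eqI[OF has_derivative_mult_partial])

lemma partial_const: "partial j (\<lambda>_. c) z = 0"
  by (rule partial_eqI[where g="\<lambda>_. 0"]) simp

lemma transform_derivative:
  assumes "open S" "z \<in> S" "\<And>y. y \<in> S \<Longrightarrow> f y = g y"
  shows "(f has_derivative f') (at z) \<longleftrightarrow> (g has_derivative f') (at z)"
  using has_derivative_transform_within_open[of f f' z UNIV S g]
    has_derivative_transform_within_open[of g f' z UNIV S f] assms by auto

text \<open>\<open>frechet_derivative\<close> chooses from the predicate of being a derivative, and
  this predicate depends only on the germ; the two choices agree even where no derivative
  exists.\<close>

lemma partial_cong:
  assumes "open S" "z \<in> S" "\<And>y. y \<in> S \<Longrightarrow> f y = g y"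
  shows "partial j f z = partial j g z"
  using transform_derivative[OF assms] unfolding partial_def frechet_derivative_def by (simp only:)

lemma holomorphic_fun_cong:
  assumes "open S" "\<And>y. y \<in> S \<Longrightarrow> f y = g y"
  shows "holomorphic_fun f S \<longleftrightarrow> holomorphic_fun g S"
  using transform_derivative[OF assms(1) _ assms(2)] unfolding holomorphic_fun_def by simp

section \<open>Cauchy's formula along coordinate lines\<close>

lemma norm_axis_eq: "norm (axis j u :: complex ^ 'n::finite) = norm u"
proof -
  have "(\<Sum>i\<in>UNIV. (norm (axis j u $ i))\<^sup>2) = (\<Sum>i\<in>UNIV. if i = j then (norm u)\<^sup>2 else 0)"
    by (intro sum.cong) (auto simp: axis_def)
  then show ?thesis by (simp add: norm_vec_def L2_set_def)
qed

lemma bounded_linear_axis: "bounded_linear (axis j :: complex \<Rightarrow> complex ^ 'n::finite)"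
  unfolding linear_conv_bounded_linear[symmetric] by (rule linearI) (auto simp: axis_def vec_eq_iff)

text \<open>On a complex line in direction \<open>axis j\<close> the partial derivative becomes an
  ordinary complex derivative, so that one-variable Cauchy theory applies.\<close>

lemma partial_line_derivative:
  fixes f :: "complex ^ 'n::finite \<Rightarrow> complex"
  assumes "holomorphic_fun f S" "z + axis j w \<in> S"
  shows "((\<lambda>u. f (z + axis j u)) has_field_derivative partial j f (z + axis j w)) (at w)"
proof -
  have "((\<lambda>u. z + axis j u) has_derivative axis j) (at w)"
    using bounded_linear_imp_has_derivative[OF bounded_linear_axis] by (auto intro!: derivative_eq_intros)
  from diff_chain_at[OF this holomorphic_fun_has_derivative[OF assms]]
  have "((\<lambda>u. f (z + axis j u)) has_derivative
      (\<lambda>v. \<Sum>i\<in>UNIV. axis j v $ i * partial i f (z + axis j w))) (at w)"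
    by (simp add: o_def)
  moreover have "(\<Sum>i\<in>UNIV. axis j v $ i * partial i f (z + axis j w)) = partial j f (z + axis j w) * v" for v
    by (simp add: axis_def if_distrib[of "\<lambda>x. x * _"] cong: if_cong)
  ultimately show ?thesis
    by (simp add: has_field_derivative_def)
qed


text \<open>Cauchy's formula for the first derivative at 0 of the restriction to a coordinate line.
  The circle c satisfies c' = 2 pi i c, so the kernel c' / (2 pi i c^2) collapses to 1 / c. In this
  form \<open>z\<close> enters only through the values of \<open>f\<close>.\<close>

lemma partial_circle_integral:
  assumes f: "holomorphic_fun f S" and r: "0 < r" "cball z r \<subseteq> S"
  shows "((\<lambda>t. f (z + axis j (of_real r * exp (2 * of_real pi * \<i> * of_real t))) /
                (of_real r * exp (2 * of_real pi * \<i> * of_real t)))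
           has_integral partial j f z) {0..1}"
proof -
  define g where "g u = f (z + axis j u)" for u
  define c where "c t = of_real r * exp (2 * of_real pi * \<i> * of_real t)" for t :: real
  have mem: "z + axis j u \<in> S" if "norm u \<le> r" for u
    using r(2) that by (auto simp: dist_norm norm_axis_eq subset_iff)
  have der: "(g has_field_derivative partial j f (z + axis j u)) (at u)" if "norm u \<le> r" for u
    unfolding g_def by (rule partial_line_derivative[OF f mem[OF that]])
  have "continuous_on (cball 0 r) g"
    by (intro continuous_at_imp_continuous_on ballI DERIV_isCont[OF der]) simp
  moreover have "g holomorphic_on ball 0 r"
    unfolding holomorphic_on_def field_differentiable_def
    by (intro ballI exI, rule has_field_derivative_at_within, rule der) simp
  ultimately have "((\<lambda>u. g u / (u - 0) ^ Suc 1) has_contour_integral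
      (2 * pi * \<i> / fact 1 * (deriv ^^ 1) g 0)) (circlepath 0 r)"
    by (rule Cauchy_has_contour_integral_higher_derivative_circlepath) (use r in simp)
  moreover have "deriv g 0 = partial j f z"
    using DERIV_imp_deriv[OF der[of 0]] r by (simp add: axis_def zero_vec_def[symmetric])
  ultimately have "((\<lambda>t. g (circlepath 0 r t) / (circlepath 0 r t) ^ 2 *
      vector_derivative (circlepath 0 r) (at t within {0..1})) has_integral
      (2 * pi * \<i> * partial j f z)) {0..1}"
    by (simp add: has_contour_integral_def numeral_2_eq_2)
  then have "((\<lambda>t. g (circlepath 0 r t) / (circlepath 0 r t) ^ 2 *
      vector_derivative (circlepath 0 r) (at t within {0..1}) / (2 * pi * \<i>)) has_integral
      (2 * pi * \<i> * partial j f z / (2 * pi * \<i>))) {0..1}"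
    by (rule has_integral_divide)
  then have "((\<lambda>t. g (circlepath 0 r t) / (circlepath 0 r t) ^ 2 *
      vector_derivative (circlepath 0 r) (at t within {0..1}) / (2 * pi * \<i>)) has_integral
      partial j f z) {0..1}"
    by simp
  then have "((\<lambda>t. g (c t) / c t) has_integral partial j f z) {0..1}"
  proof (rule has_integral_eq[rotated])
    fix t :: real assume t: "t \<in> {0..1}"
    have "circlepath 0 r t = c t"
      by (simp add: circlepath c_def)
    moreover have "vector_derivative (circlepath 0 r) (at t within {0..1}) = 2 * pi * \<i> * c t"
      using t by (simp add: vector_derivative_circlepath01 c_def)
    moreover have "c t \<noteq> 0" using r by (simp add: c_def)
    ultimately show "g (circlepath 0 r t) / (circlepath 0 r t) ^ 2 *
      vector_derivative (circlepath 0 r) (at t within {0..1}) / (2 * pi * \<i>) = g (c t) / c t"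
      by (simp add: power2_eq_square)
  qed
  then show ?thesis unfolding g_def c_def .
qed

text \<open>The integral formula expresses the partial derivative through values of \<open>f\<close>
  on circles of a radius that is fixed near \<open>z0\<close>, and a parameter integral of a
  continuous function is continuous.\<close>

lemma continuous_on_partial:
  assumes f: "holomorphic_fun f S" and "open S"
  shows "continuous_on S (partial j f)"
proof (intro continuous_at_imp_continuous_on ballI)
  fix z0 assume "z0 \<in> S"
  then obtain r0 where r0: "0 < r0" "cball z0 r0 \<subseteq> S"
    using \<open>open S\<close> open_contains_cball by blast
  \<comment> \<open>Half of \<open>r0\<close>, so that closed balls of radius \<open>r\<close> about
    all points of \<open>ball z0 r\<close> stay inside \<open>cball z0 r0\<close>.\<close>
  define r where "r = r0 / 2"
  define c where "c t = of_real r * exp (2 * of_real pi * \<i> * of_real t)" for t :: real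
  have r: "0 < r" using r0 by (simp add: r_def)
  have norm_c: "norm (c t) = r" for t
    using r by (simp add: c_def norm_mult)
  have sub: "cball z r \<subseteq> S" if "z \<in> ball z0 r" for z
  proof
    fix y assume "y \<in> cball z r"
    then have "dist z0 y \<le> r0"
      using that dist_triangle[of z0 y z] by (simp add: r_def)
    then show "y \<in> S" using r0 by auto
  qed
  have mem: "z + axis j (c t) \<in> S" if "z \<in> ball z0 r" for z t
    using sub[OF that] by (auto simp: dist_norm norm_axis_eq norm_c subset_iff)
  have "continuous_on (ball z0 r \<times> cbox 0 1) (\<lambda>(z, t). f (z + axis j (c t)) / c t)"
  proof -
    have "continuous_on (ball z0 r \<times> cbox 0 1) (\<lambda>x. f (fst x + axis j (c (snd x))))"
      by (rule continuous_on_compose2[OF holomorphic_fun_continuous_on[OF f]])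
        (auto simp: mem[simplified] c_def intro!: continuous_intros bounded_linear.continuous_on[OF bounded_linear_axis]
          mem[unfolded c_def])
    moreover have "continuous_on (ball z0 r \<times> cbox 0 1) (\<lambda>x. c (snd x))"
      unfolding c_def by (intro continuous_intros)
    moreover have "c t \<noteq> 0" for t using norm_c[of t] r by auto
    ultimately show ?thesis
      unfolding split_beta by (intro continuous_on_divide) auto
  qed
  then have "continuous_on (ball z0 r) (\<lambda>z. integral (cbox 0 1) (\<lambda>t. f (z + axis j (c t)) / c t))"
    by (rule integral_continuous_on_param)
  moreover have "partial j f z = integral (cbox 0 1) (\<lambda>t. f (z + axis j (c t)) / c t)"
    if "z \<in> ball z0 r" for z
    using partial_circle_integral[OF f r sub[OF that], of j] unfolding c_def
    by (simp add: integral_unique)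
  ultimately have "continuous_on (ball z0 r) (partial j f)"
    by (simp cong: continuous_on_cong_simp)
  then show "continuous (at z0) (partial j f)"
    using r by (simp add: continuous_on_eq_continuous_at)
qed

text \<open>The arguments of \<open>f\<close> are affine in each coordinate of \<open>z\<close>,
  which covers both uses: circles about \<open>z\<close> in Cauchy's formula (all slopes 1) and
  segments ending at \<open>z\<close> in Hadamard's lemma (slope \<open>t\<close> or 1).\<close>

lemma holomorphic_fun_integral:
  fixes f :: "complex ^ 'n::finite \<Rightarrow> complex" and \<beta> \<mu> :: "real \<Rightarrow> complex ^ 'n"
  assumes f: "holomorphic_fun f S" and "open S" and B: "open B" "convex B"
    and cont: "continuous_on {0..1} \<beta>" "continuous_on {0..1} \<mu>" "continuous_on {0..1} c"
    and mem: "\<And>z t. z \<in> B \<Longrightarrow> t \<in> {0..1} \<Longrightarrow> (\<chi> i. \<beta> t $ i + \<mu> t $ i * z $ i) \<in> S"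
  shows "holomorphic_fun (\<lambda>z. integral {0..1} (\<lambda>t. c t * f (\<chi> i. \<beta> t $ i + \<mu> t $ i * z $ i))) B"
proof -
  define h where "h z t = (\<chi> i. \<beta> t $ i + \<mu> t $ i * z $ i)" for z t
  \<comment> \<open>The derivative in \<open>z\<close> of the integrand. It is wrapped in
    \<open>Blinfun\<close> below because the rule for differentiating under the integral integrates
    derivatives as bounded linear maps.\<close>
  define D where "D z t v = c t * (\<Sum>j\<in>UNIV. (\<mu> t $ j * v $ j) * partial j f (h z t))" for z t v
  have lin: "bounded_linear (D z t)" for z t
    unfolding linear_conv_bounded_linear[symmetric] D_def
    by (rule linearI) (simp_all add: algebra_simps sum.distrib flip: scaleR_sum_right)
  have D: "blinfun_apply (Blinfun (D z t)) = D z t" for z t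
    by (rule bounded_linear_Blinfun_apply[OF lin])
  have conth: "continuous_on (B \<times> {0..1}) (\<lambda>x. h (fst x) (snd x))"
    unfolding h_def
    by (intro continuous_intros continuous_on_compose2[OF cont(1)] continuous_on_compose2[OF cont(2)]) auto
  have contc: "continuous_on (B \<times> {0..1}) (\<lambda>x. c (snd x))"
    by (intro continuous_intros continuous_on_compose2[OF cont(3)]) auto
  have cont\<mu>: "continuous_on (B \<times> {0..1}) (\<lambda>x. \<mu> (snd x) $ j)" for j
    by (intro continuous_intros continuous_on_compose2[OF cont(2)]) auto
  have contp: "continuous_on (B \<times> {0..1}) (\<lambda>x. partial j f (h (fst x) (snd x)))" for j
    by (rule continuous_on_compose2[OF continuous_on_partial[OF f \<open>open S\<close>] conth])
      (auto simp: h_def mem)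
  have contf: "continuous_on (B \<times> {0..1}) (\<lambda>x. c (snd x) * f (h (fst x) (snd x)))"
    by (intro continuous_intros contc continuous_on_compose2[OF holomorphic_fun_continuous_on[OF f] conth])
      (auto simp: h_def mem)
  have contD: "continuous_on (B \<times> cbox 0 1) (\<lambda>(z, t). Blinfun (D z t))"
    unfolding split_beta
    by (rule continuous_on_blinfun_componentwise)
      (auto simp: D D_def intro!: continuous_intros contc cont\<mu> contp)
  have der: "((\<lambda>z. c t * f (h z t)) has_derivative D z t) (at z within B)"
    if z: "z \<in> B" and t: "t \<in> cbox 0 1" for z t
  proof -
    have lin1: "bounded_linear (\<lambda>v. \<chi> i. \<mu> t $ i * v $ i)"
      unfolding linear_conv_bounded_linear[symmetric]
      by (rule linearI) (auto simp: vec_eq_iff algebra_simps)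
    have "h y t = \<beta> t + (\<chi> i. \<mu> t $ i * y $ i)" for y
      by (simp add: h_def vec_eq_iff)
    then have "((\<lambda>y. h y t) has_derivative (\<lambda>v. \<chi> i. \<mu> t $ i * v $ i)) (at z)"
      using has_derivative_add[OF has_derivative_const[of "\<beta> t"] bounded_linear_imp_has_derivative[OF lin1]]
      by simp
    from diff_chain_at[OF this holomorphic_fun_has_derivative[OF f]]
    have "((\<lambda>y. f (h y t)) has_derivative
        (\<lambda>v. \<Sum>j\<in>UNIV. (\<mu> t $ j * v $ j) * partial j f (h z t))) (at z)"
      using mem[OF z] t by (simp add: o_def h_def)
    then have "((\<lambda>y. c t * f (h y t)) has_derivative D z t) (at z)"
      unfolding D_def by (rule has_derivative_mult_right)
    then show ?thesis by (rule has_derivative_at_withinI)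
  qed
  have intf: "(\<lambda>t. c t * f (h z t)) integrable_on cbox 0 1" if "z \<in> B" for z
    by (rule integrable_continuous, rule continuous_on_compose2[OF contf, where f="\<lambda>t. (z, t)", simplified])
      (use that in \<open>auto intro!: continuous_intros\<close>)
  have intD: "(\<lambda>t. Blinfun (D z t)) integrable_on cbox 0 1" if "z \<in> B" for z
    by (rule integrable_continuous, rule continuous_on_compose2[OF contD, where f="\<lambda>t. (z, t)", simplified])
      (use that in \<open>auto intro!: continuous_intros\<close>)
  show ?thesis
    unfolding holomorphic_fun_def
  proof (intro ballI exI conjI allI)
    fix z assume z: "z \<in> B"
    have "((\<lambda>z. integral (cbox 0 1) (\<lambda>t. c t * f (h z t))) has_derivative
        integral (cbox 0 1) (\<lambda>t. Blinfun (D z t))) (at z within B)"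
      by (rule leibniz_rule) (use der D intf contD z B in auto)
    then show "((\<lambda>z. integral {0..1} (\<lambda>t. c t * f (\<chi> i. \<beta> t $ i + \<mu> t $ i * z $ i))) has_derivative
        integral (cbox 0 1) (\<lambda>t. Blinfun (D z t))) (at z)"
      using B z by (simp add: h_def at_within_open[of z B])
    \<comment> \<open>Complex linearity holds for every \<open>t\<close>, and evaluating a bounded
      linear map at a vector commutes with the integral.\<close>
    fix a v
    have "D z t (a *s v) = a * D z t v" for t
      by (simp add: D_def sum_distrib_left mult_ac)
    moreover have "blinfun_apply (integral (cbox 0 1) (\<lambda>t. Blinfun (D z t))) y =
        integral (cbox 0 1) (\<lambda>t. D z t y)" for y
      by (subst blinfun_apply_integral[OF intD[OF z]]) (simp only: D)
    ultimately show "integral (cbox 0 1) (\<lambda>t. Blinfun (D z t)) (a *s v) =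
        a * integral (cbox 0 1) (\<lambda>t. Blinfun (D z t)) v"
      by simp
  qed
qed

text \<open>Cauchy's formula is a parameter integral with offset \<open>axis j (c t)\<close>, slopes
  1 and weight 1 / c(t), hence holomorphic in \<open>z\<close>.\<close>

lemma holomorphic_fun_partial:
  assumes f: "holomorphic_fun f S" and "open S"
  shows "holomorphic_fun (partial j f) S"
proof -
  have "\<exists>B. open B \<and> z0 \<in> B \<and> holomorphic_fun (partial j f) B" if z0: "z0 \<in> S" for z0
  proof -
    obtain r0 where r0: "0 < r0" "cball z0 r0 \<subseteq> S"
      using \<open>open S\<close> open_contains_cball z0 by blast
    define r where "r = r0 / 2"
    define c where "c t = of_real r * exp (2 * of_real pi * \<i> * of_real t)" for t :: real
    have r: "0 < r" using r0 by (simp add: r_def)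
    have norm_c: "norm (c t) = r" for t
      using r by (simp add: c_def norm_mult)
    have c0: "c t \<noteq> 0" for t using norm_c[of t] r by auto
    have contc: "continuous_on A c" for A
      unfolding c_def by (intro continuous_intros)
    have sub: "cball z r \<subseteq> S" if "z \<in> ball z0 r" for z
    proof
      fix y assume "y \<in> cball z r"
      then have "dist z0 y \<le> r0"
        using that dist_triangle[of z0 y z] by (simp add: r_def)
      then show "y \<in> S" using r0 by auto
    qed
    have mem: "z + axis j (c t) \<in> S" if "z \<in> ball z0 r" for z t
      using sub[OF that] by (auto simp: dist_norm norm_axis_eq norm_c subset_iff)
    have eq: "(\<chi> i. axis j (c t) $ i + 1 $ i * z $ i) = z + axis j (c t)" for z t
      by (simp add: vec_eq_iff)
    have "holomorphic_fun (\<lambda>z. integral {0..1} (\<lambda>t. inverse (c t) *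
        f (\<chi> i. axis j (c t) $ i + 1 $ i * z $ i))) (ball z0 r)"
    proof (rule holomorphic_fun_integral[OF f \<open>open S\<close>])
      fix z and t :: real assume "z \<in> ball z0 r"
      then show "(\<chi> i. axis j (c t) $ i + 1 $ i * z $ i) \<in> S"
        unfolding eq by (rule mem)
    qed (auto simp: c0 intro!: continuous_intros contc bounded_linear.continuous_on[OF bounded_linear_axis])
    moreover have "integral {0..1} (\<lambda>t. inverse (c t) *
        f (\<chi> i. axis j (c t) $ i + 1 $ i * z $ i)) = partial j f z" if "z \<in> ball z0 r" for z
    proof -
      have "((\<lambda>t. f (z + axis j (c t)) / c t) has_integral partial j f z) {0..1}"
        using partial_circle_integral[OF f r sub[OF that], of j] unfolding c_def .
      then show ?thesis unfolding eq
        by (simp add: integral_unique divide_inverse mult.commute)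
    qed
    ultimately have "holomorphic_fun (partial j f) (ball z0 r)"
      by (subst (asm) holomorphic_fun_cong[OF open_ball, where g="partial j f"]) simp_all
    then show ?thesis using r by (intro exI[of _ "ball z0 r"]) auto
  qed
  then show ?thesis
    unfolding holomorphic_fun_def by blast
qed

text \<open>Integration along the segments from \<open>z\<close> with its coordinates in \<open>J\<close> replaced by those of \<open>c\<close>
  to \<open>z\<close>.\<close>

lemma hadamard_factorization:
  fixes c :: "complex ^ 'n::finite"
  assumes f: "holomorphic_fun f (ball c r)"
  shows "\<exists>g. (\<forall>j. holomorphic_fun (g j) (ball c r)) \<and>
    (\<forall>z\<in>ball c r. f z = f (\<chi> i. if i \<in> J then c $ i else z $ i) + (\<Sum>j\<in>J. (z $ j - c $ j) * g j z)) \<and>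
    (\<forall>j. \<forall>z\<in>ball c r. (\<forall>i\<in>J. z $ i = c $ i) \<longrightarrow> g j z = partial j f z)"
proof -
  define \<beta> :: "real \<Rightarrow> complex ^ 'n" where "\<beta> t = (\<chi> i. if i \<in> J then of_real (1 - t) * c $ i else 0)" for t
  define \<mu> :: "real \<Rightarrow> complex ^ 'n" where "\<mu> t = (\<chi> i. if i \<in> J then of_real t else 1)" for t
  define h where "h t z = (\<chi> i. \<beta> t $ i + \<mu> t $ i * z $ i)" for t z
  define g where "g j z = integral {0..1} (\<lambda>t. 1 * partial j f (\<chi> i. \<beta> t $ i + \<mu> t $ i * z $ i))" for j z
  have h_nth: "h t z $ i = (if i \<in> J then c $ i + of_real t * (z $ i - c $ i) else z $ i)" for t z i
    by (simp add: h_def \<beta>_def \<mu>_def algebra_simps)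
  have mem: "h t z \<in> ball c r" if "z \<in> ball c r" "t \<in> {0..1}" for t z
  proof -
    \<comment> \<open>Each coordinate of \<open>h t z - c\<close> is that of \<open>z - c\<close> or
      its multiple by \<open>t\<close>, so the segment does not leave the ball.\<close>
    have "norm ((h t z - c) $ i) \<le> norm ((z - c) $ i)" for i
      using that(2) by (simp add: h_nth norm_mult mult_left_le_one_le)
    then have "norm (h t z - c) \<le> norm (z - c)"
      by (rule norm_le_componentwise_cart)
    then show ?thesis using that(1) by (simp add: dist_norm norm_minus_commute)
  qed
  have "holomorphic_fun (g j) (ball c r)" for j
    unfolding g_def
  proof (rule holomorphic_fun_integral[OF holomorphic_fun_partial[OF f]])
    have "continuous_on {0..1} (\<lambda>t. if i \<in> J then of_real (1 - t) * c $ i else 0)" for i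
      by (cases "i \<in> J") (auto intro!: continuous_intros)
    then show "continuous_on {0..1} \<beta>"
      unfolding \<beta>_def by (rule continuous_on_vec_lambda)
    have "continuous_on {0..1} (\<lambda>t. if i \<in> J then of_real t else 1 :: complex)" for i
      by (cases "i \<in> J") (auto intro!: continuous_intros)
    then show "continuous_on {0..1} \<mu>"
      unfolding \<mu>_def by (rule continuous_on_vec_lambda)
  qed (use mem in \<open>auto simp: h_def\<close>)
  moreover have "f z = f (\<chi> i. if i \<in> J then c $ i else z $ i) + (\<Sum>j\<in>J. (z $ j - c $ j) * g j z)"
    if z: "z \<in> ball c r" for z
  proof -
    have der: "((\<lambda>t. f (h t z)) has_vector_derivative (\<Sum>j\<in>J. (z $ j - c $ j) * partial j f (h t z)))
        (at t within {0..1})" if t: "t \<in> {0..1}" for t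
    proof -
      \<comment> \<open>The velocity of the segment, zero outside \<open>J\<close>; the sum over all
        coordinates in the chain rule thus shrinks to \<open>J\<close>.\<close>
      define u where "u = (\<chi> i. if i \<in> J then z $ i - c $ i else 0)"
      have hs: "(\<lambda>s. h s z) = (\<lambda>s. h 0 z + s *\<^sub>R u)"
        unfolding fun_eq_iff vec_eq_iff by (simp add: h_nth u_def) (simp add: scaleR_conv_of_real)
      have "((\<lambda>s. h s z) has_vector_derivative u) (at t)"
        by (subst hs) (auto intro!: derivative_eq_intros)
      then have "((\<lambda>s. h s z) has_derivative (\<lambda>x. x *\<^sub>R u)) (at t)"
        by (simp add: has_vector_derivative_def)
      from diff_chain_at[OF this holomorphic_fun_has_derivative[OF f mem[OF z t]]]
      have "((\<lambda>s. f (h s z)) has_derivative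
          (\<lambda>x. \<Sum>j\<in>UNIV. (x *\<^sub>R u) $ j * partial j f (h t z))) (at t)"
        by (simp add: o_def)
      moreover have "(\<Sum>j\<in>UNIV. (x *\<^sub>R u) $ j * partial j f (h t z)) =
          x *\<^sub>R (\<Sum>j\<in>J. (z $ j - c $ j) * partial j f (h t z))" for x
      proof -
        have "(\<Sum>j\<in>J. (x *\<^sub>R u) $ j * partial j f (h t z)) =
            (\<Sum>j\<in>UNIV. (x *\<^sub>R u) $ j * partial j f (h t z))"
          by (rule sum.mono_neutral_left) (auto simp: u_def)
        moreover have "(\<Sum>j\<in>J. (x *\<^sub>R u) $ j * partial j f (h t z)) =
            x *\<^sub>R (\<Sum>j\<in>J. (z $ j - c $ j) * partial j f (h t z))"
          unfolding scaleR_sum_right by (rule sum.cong) (auto simp: u_def)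
        ultimately show ?thesis by simp
      qed
      ultimately have "((\<lambda>s. f (h s z)) has_vector_derivative
          (\<Sum>j\<in>J. (z $ j - c $ j) * partial j f (h t z))) (at t)"
        by (simp add: has_vector_derivative_def)
      then show ?thesis by (rule has_vector_derivative_at_within)
    qed
    have "((\<lambda>t. \<Sum>j\<in>J. (z $ j - c $ j) * partial j f (h t z)) has_integral
        (f (h 1 z) - f (h 0 z))) {0..1}"
      by (rule fundamental_theorem_of_calculus) (use der in auto)
    moreover have "((\<lambda>t. \<Sum>j\<in>J. (z $ j - c $ j) * partial j f (h t z)) has_integral
        (\<Sum>j\<in>J. (z $ j - c $ j) * g j z)) {0..1}"
    proof (intro has_integral_sum has_integral_mult_right)
      fix j
      have "continuous_on {0..1} (\<lambda>t. h t z $ i)" for i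
        unfolding h_nth by (cases "i \<in> J") (auto intro!: continuous_intros)
      then have "continuous_on {0..1} (\<lambda>t. \<chi> i. h t z $ i)"
        by (rule continuous_on_vec_lambda)
      then have "continuous_on {0..1} (\<lambda>t. h t z)"
        by (simp only: vec_nth_inverse)
      then have "continuous_on {0..1} (\<lambda>t. partial j f (h t z))"
        by (rule continuous_on_compose2[OF continuous_on_partial[OF f open_ball]]) (use mem z in auto)
      then show "((\<lambda>t. partial j f (h t z)) has_integral g j z) {0..1}"
        unfolding g_def h_def[symmetric] by (simp add: integrable_integral integrable_continuous_real)
    qed simp
    ultimately have "f (h 1 z) - f (h 0 z) = (\<Sum>j\<in>J. (z $ j - c $ j) * g j z)"
      by (rule has_integral_unique)
    moreover have "h 1 z = z" "h 0 z = (\<chi> i. if i \<in> J then c $ i else z $ i)"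
      by (simp_all add: vec_eq_iff h_nth)
    ultimately show ?thesis by (simp add: diff_eq_eq add.commute)
  qed
  moreover have "g j z = partial j f z"
    if "z \<in> ball c r" "\<And>i. i \<in> J \<Longrightarrow> z $ i = c $ i" for j z
  proof -
    \<comment> \<open>When \<open>z\<close> and \<open>c\<close> agree on \<open>J\<close> the
      segment is a point, and the integral over the unit interval equals its constant
      integrand.\<close>
    have "h t z = z" for t by (simp add: vec_eq_iff h_nth that(2))
    then show ?thesis unfolding g_def h_def[symmetric] by simp
  qed
  ultimately show ?thesis by (intro exI[of _ g] conjI allI ballI impI) simp_all
qed

section \<open>Derivations on a complex manifold\<close>

locale cmanifold =
  fixes X :: "'a cspace" and n :: "'n::finite itself"
  assumes manifold: "complex_manifold n X"
begin

section \<open>Operations on holomorphic functions and their germs\<close>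

lemma hol_sheaf: "function_sheaf (topo X) (hol X)"
  using manifold unfolding complex_manifold_def by blast

lemma hol_cong: "openin (topo X) U \<Longrightarrow> f \<in> hol X U \<Longrightarrow> (\<And>q. q \<in> U \<Longrightarrow> f q = g q) \<Longrightarrow> g \<in> hol X U"
  using hol_sheaf[unfolded function_sheaf_def, THEN conjunct1, rule_format, of U f g] by blast

lemma hol_subset: "f \<in> hol X U \<Longrightarrow> openin (topo X) U \<Longrightarrow> openin (topo X) V \<Longrightarrow> V \<subseteq> U \<Longrightarrow> f \<in> hol X V"
  using hol_sheaf[unfolded function_sheaf_def, THEN conjunct2, THEN conjunct1, rule_format, of U V f]
  by blast

lemma hol_local:
  "openin (topo X) U \<Longrightarrow> (\<And>p. p \<in> U \<Longrightarrow> \<exists>V. openin (topo X) V \<and> p \<in> V \<and> V \<subseteq> U \<and> f \<in> hol X V)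
    \<Longrightarrow> f \<in> hol X U"
  using hol_sheaf[unfolded function_sheaf_def, THEN conjunct2, THEN conjunct2, rule_format, of U f]
  by blast

lemma chart_exists:
  assumes "p \<in> topspace (topo X)"
  obtains U and \<phi> :: "'a \<Rightarrow> complex ^ 'n" where "p \<in> U" "chart X U \<phi>"
  using manifold assms unfolding complex_manifold_def by blast

lemma chart_hol_iff:
  "chart X U \<phi> \<Longrightarrow> openin (topo X) V \<Longrightarrow> V \<subseteq> U \<Longrightarrow>
    f \<in> hol X V \<longleftrightarrow> holomorphic_fun (f \<circ> inv_into U \<phi>) (\<phi> ` V)"
  unfolding chart_def by blast

lemma hol_chartsI:
  assumes U: "openin (topo X) U"
    and hol: "\<And>V W (\<phi> :: 'a \<Rightarrow> complex ^ 'n). chart X V \<phi> \<Longrightarrow> openin (topo X) W \<Longrightarrow> W \<subseteq> V \<Longrightarrow> W \<subseteq> U \<Longrightarrow>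
      holomorphic_fun (f \<circ> inv_into V \<phi>) (\<phi> ` W)"
  shows "f \<in> hol X U"
proof (rule hol_local[OF U])
  fix p assume p: "p \<in> U"
  then have "p \<in> topspace (topo X)" using openin_subset[OF U] by blast
  then obtain V and \<phi> :: "'a \<Rightarrow> complex ^ 'n" where V: "p \<in> V" "chart X V \<phi>"
    by (rule chart_exists)
  then have W: "openin (topo X) (V \<inter> U)"
    using U unfolding chart_def by blast
  have "f \<in> hol X (V \<inter> U)"
    using chart_hol_iff[OF V(2) W] hol[OF V(2) W] by simp
  then show "\<exists>W. openin (topo X) W \<and> p \<in> W \<and> W \<subseteq> U \<and> f \<in> hol X W"
    using W V(1) p by blast
qed

lemma hol_const: "openin (topo X) U \<Longrightarrow> (\<lambda>_. c) \<in> hol X U"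
  by (rule hol_chartsI) (simp_all add: comp_def holomorphic_fun_const)

lemma hol_add:
  assumes U: "openin (topo X) U" and fg: "f \<in> hol X U" "g \<in> hol X U"
  shows "(\<lambda>q. f q + g q) \<in> hol X U"
proof (rule hol_chartsI[OF U])
  fix V W and \<phi> :: "'a \<Rightarrow> complex ^ 'n"
  assume *: "chart X V \<phi>" "openin (topo X) W" "W \<subseteq> V" "W \<subseteq> U"
  show "holomorphic_fun ((\<lambda>q. f q + g q) \<circ> inv_into V \<phi>) (\<phi> ` W)"
    using chart_hol_iff[OF *(1-3)] hol_subset[OF _ U *(2,4)] fg holomorphic_fun_add
    by (fastforce simp: comp_def)
qed

lemma hol_mult:
  assumes U: "openin (topo X) U" and fg: "f \<in> hol X U" "g \<in> hol X U"
  shows "(\<lambda>q. f q * g q) \<in> hol X U"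
proof (rule hol_chartsI[OF U])
  fix V W and \<phi> :: "'a \<Rightarrow> complex ^ 'n"
  assume *: "chart X V \<phi>" "openin (topo X) W" "W \<subseteq> V" "W \<subseteq> U"
  show "holomorphic_fun ((\<lambda>q. f q * g q) \<circ> inv_into V \<phi>) (\<phi> ` W)"
    using chart_hol_iff[OF *(1-3)] hol_subset[OF _ U *(2,4)] fg holomorphic_fun_mult
    by (fastforce simp: comp_def)
qed

lemma hol_cmult: "openin (topo X) U \<Longrightarrow> f \<in> hol X U \<Longrightarrow> (\<lambda>q. c * f q) \<in> hol X U"
  using hol_mult[OF _ hol_const] by blast

lemma hol_diff:
  "openin (topo X) U \<Longrightarrow> f \<in> hol X U \<Longrightarrow> g \<in> hol X U \<Longrightarrow> (\<lambda>q. f q - g q) \<in> hol X U"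
  using hol_add[of U f "\<lambda>q. - 1 * g q"] hol_cmult[of U g "- 1"] by simp

lemma hol_sum:
  "openin (topo X) U \<Longrightarrow> (\<And>j. j \<in> J \<Longrightarrow> f j \<in> hol X U) \<Longrightarrow> (\<lambda>q. \<Sum>j\<in>J. f j q) \<in> hol X U"
  by (induction J rule: infinite_finite_induct) (simp_all add: hol_const hol_add)

lemma hol_nearI: "openin (topo X) U \<Longrightarrow> p \<in> U \<Longrightarrow> f \<in> hol X U \<Longrightarrow> hol_near X p f"
  unfolding hol_near_def by blast

lemma hol_nearE:
  assumes "hol_near X p f" "openin (topo X) V" "p \<in> V"
  obtains U where "openin (topo X) U" "p \<in> U" "U \<subseteq> V" "f \<in> hol X U"
proof -
  obtain U where U: "openin (topo X) U" "p \<in> U" "f \<in> hol X U"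
    using assms(1) unfolding hol_near_def by blast
  show thesis
    by (rule that[of "U \<inter> V"]) (use U assms in \<open>auto intro: hol_subset[OF U(3)]\<close>)
qed

lemma hol_near2:
  assumes "hol_near X p f" "hol_near X p g"
  obtains U where "openin (topo X) U" "p \<in> U" "f \<in> hol X U" "g \<in> hol X U"
proof -
  obtain V where V: "openin (topo X) V" "p \<in> V" "g \<in> hol X V"
    using assms(2) unfolding hol_near_def by blast
  obtain U where U: "openin (topo X) U" "p \<in> U" "U \<subseteq> V" "f \<in> hol X U"
    by (rule hol_nearE[OF assms(1) V(1,2)])
  show thesis
    by (rule that[OF U(1,2,4)]) (rule hol_subset[OF V(3,1) U(1,3)])
qed

lemma hol_near_cong:
  assumes "hol_near X p f" "openin (topo X) U" "p \<in> U" "\<And>q. q \<in> U \<Longrightarrow> f q = g q"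
  shows "hol_near X p g"
proof -
  obtain V where V: "openin (topo X) V" "p \<in> V" "V \<subseteq> U" "f \<in> hol X V"
    by (rule hol_nearE[OF assms(1-3)])
  have "g \<in> hol X V"
    by (rule hol_cong[OF V(1,4)]) (use V assms in auto)
  then show ?thesis by (rule hol_nearI[OF V(1,2)])
qed

lemma hol_near_const: "p \<in> topspace (topo X) \<Longrightarrow> hol_near X p (\<lambda>_. c)"
  using hol_const[OF openin_topspace] hol_nearI[OF openin_topspace] by blast

lemma hol_near_add: "hol_near X p f \<Longrightarrow> hol_near X p g \<Longrightarrow> hol_near X p (\<lambda>q. f q + g q)"
  by (erule (1) hol_near2) (blast intro: hol_nearI hol_add)

lemma hol_near_mult: "hol_near X p f \<Longrightarrow> hol_near X p g \<Longrightarrow> hol_near X p (\<lambda>q. f q * g q)"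
  by (erule (1) hol_near2) (blast intro: hol_nearI hol_mult)

lemma hol_near_diff: "hol_near X p f \<Longrightarrow> hol_near X p g \<Longrightarrow> hol_near X p (\<lambda>q. f q - g q)"
  by (erule (1) hol_near2) (blast intro: hol_nearI hol_diff)

lemma hol_near_cmult: "hol_near X p f \<Longrightarrow> hol_near X p (\<lambda>q. c * f q)"
  unfolding hol_near_def using hol_cmult by blast

section \<open>Calculus of derivations at a point\<close>

lemma derivation_zero_off: "derivation_at X p d \<Longrightarrow> \<not> hol_near X p f \<Longrightarrow> d f = 0"
  unfolding derivation_at_def by (drule conjunct1) (erule allE, erule mp)

lemma derivation_rules:
  assumes "derivation_at X p d" "hol_near X p f" "hol_near X p g"
  shows "(\<exists>U. openin (topo X) U \<and> p \<in> U \<and> (\<forall>q\<in>U. f q = g q)) \<longrightarrow> d f = d g"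
    and "\<forall>c. d (\<lambda>q. c * f q) = c * d f"
    and "d (\<lambda>q. f q + g q) = d f + d g"
    and "d (\<lambda>q. f q * g q) = f p * d g + g p * d f"
  using assms(1)[unfolded derivation_at_def, THEN conjunct2, rule_format, OF conjI[OF assms(2,3)]]
  by simp_all

lemma derivation_cong:
  assumes "derivation_at X p d" "hol_near X p f" "openin (topo X) U" "p \<in> U"
    "\<And>q. q \<in> U \<Longrightarrow> f q = g q"
  shows "d f = d g"
  by (rule derivation_rules(1)[OF assms(1,2) hol_near_cong[OF assms(2-5)], rule_format])
    (use assms in auto)

lemma derivation_cmult: "derivation_at X p d \<Longrightarrow> hol_near X p f \<Longrightarrow> d (\<lambda>q. c * f q) = c * d f"
  by (simp add: derivation_rules(2)[rule_format])

lemmas derivation_add = derivation_rules(3)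

lemmas derivation_mult = derivation_rules(4)

lemma derivation_const:
  assumes "derivation_at X p d" "p \<in> topspace (topo X)"
  shows "d (\<lambda>_. c) = 0"
proof -
  have "d (\<lambda>_. 1) = 0"
    using derivation_mult[OF assms(1) hol_near_const hol_near_const, of 1 1] assms(2) by simp
  then show ?thesis
    using derivation_cmult[OF assms(1) hol_near_const[OF assms(2)], of c 1] by simp
qed

lemma derivation_diff:
  "derivation_at X p d \<Longrightarrow> hol_near X p f \<Longrightarrow> hol_near X p g \<Longrightarrow> d (\<lambda>q. f q - g q) = d f - d g"
  using derivation_add[of p d f "\<lambda>q. - 1 * g q"] derivation_cmult[of p d g "- 1"]
    hol_near_cmult[of p g "- 1"] by simp

lemma hol_near_sum:
  "p \<in> topspace (topo X) \<Longrightarrow> (\<And>j. j \<in> J \<Longrightarrow> hol_near X p (f j)) \<Longrightarrow> hol_near X p (\<lambda>q. \<Sum>j\<in>J. f j q)"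
  by (induction J rule: infinite_finite_induct) (simp_all add: hol_near_const hol_near_add)

lemma derivation_sum:
  assumes "derivation_at X p d" "p \<in> topspace (topo X)" "\<And>j. j \<in> J \<Longrightarrow> hol_near X p (f j)"
  shows "d (\<lambda>q. \<Sum>j\<in>J. f j q) = (\<Sum>j\<in>J. d (f j))"
  using assms(3)
proof (induction J rule: infinite_finite_induct)
  case (insert j J)
  then have "d (\<lambda>q. f j q + (\<Sum>j\<in>J. f j q)) = d (f j) + d (\<lambda>q. \<Sum>j\<in>J. f j q)"
    by (intro derivation_add[OF assms(1)] hol_near_sum[OF assms(2)]) auto
  with insert show ?case by simp
qed (simp_all add: derivation_const[OF assms(1,2)])

lemma tangent_carrier: "d \<in> carrier (tangent_space X p) \<longleftrightarrow> derivation_at X p d"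
  by (simp add: tangent_space_def)

lemma tangent_add: "d \<oplus>\<^bsub>tangent_space X p\<^esub> d' = (\<lambda>f. d f + d' f)"
  by (simp add: tangent_space_def)

lemma tangent_smult: "c \<odot>\<^bsub>tangent_space X p\<^esub> d = (\<lambda>f. c * d f)"
  by (simp add: tangent_space_def)

lemma derivation_at_zero: "derivation_at X p (\<lambda>_. 0)"
  unfolding derivation_at_def by simp

lemma derivation_at_add:
  assumes "derivation_at X p d" "derivation_at X p d'"
  shows "derivation_at X p (\<lambda>f. d f + d' f)"
  unfolding derivation_at_def
proof (intro conjI allI impI; (elim conjE)?)
  fix f g assume fg: "hol_near X p f" "hol_near X p g"
  note rules = derivation_rules[OF assms(1) fg] derivation_rules[OF assms(2) fg]
  show "d f + d' f = d g + d' g" if "\<exists>U. openin (topo X) U \<and> p \<in> U \<and> (\<forall>q\<in>U. f q = g q)"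
    using rules(1,5) that by simp
  show "d (\<lambda>q. c * f q) + d' (\<lambda>q. c * f q) = c * (d f + d' f)" for c
    using rules(2,6) by (simp add: algebra_simps)
  show "d (\<lambda>q. f q + g q) + d' (\<lambda>q. f q + g q) = d f + d' f + (d g + d' g)"
    using rules(3,7) by simp
  show "d (\<lambda>q. f q * g q) + d' (\<lambda>q. f q * g q) = f p * (d g + d' g) + g p * (d f + d' f)"
    using rules(4,8) by (simp add: algebra_simps)
qed (simp add: derivation_zero_off[OF assms(1)] derivation_zero_off[OF assms(2)])

lemma derivation_at_smult:
  assumes "derivation_at X p d"
  shows "derivation_at X p (\<lambda>f. c * d f)"
  unfolding derivation_at_def
proof (intro conjI allI impI; (elim conjE)?)
  fix f g assume fg: "hol_near X p f" "hol_near X p g"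
  note rules = derivation_rules[OF assms(1) fg]
  show "c * d f = c * d g" if "\<exists>U. openin (topo X) U \<and> p \<in> U \<and> (\<forall>q\<in>U. f q = g q)"
    using rules(1) that by simp
  show "c * d (\<lambda>q. a * f q) = a * (c * d f)" for a
    using rules(2) by simp
  show "c * d (\<lambda>q. f q + g q) = c * d f + c * d g"
    using rules(3) by (simp add: algebra_simps)
  show "c * d (\<lambda>q. f q * g q) = f p * (c * d g) + g p * (c * d f)"
    using rules(4) by (simp add: algebra_simps)
qed (simp add: derivation_zero_off[OF assms])

section \<open>Vector fields and their bracket\<close>

lemma vector_field_derivation: "w \<in> vector_fields X U \<Longrightarrow> p \<in> U \<Longrightarrow> derivation_at X p (w p)"
  unfolding vector_fields_def tangent_carrier by blast

lemma vector_field_hol: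
  "w \<in> vector_fields X U \<Longrightarrow> openin (topo X) V \<Longrightarrow> V \<subseteq> U \<Longrightarrow> f \<in> hol X V \<Longrightarrow> (\<lambda>p. w p f) \<in> hol X V"
  unfolding vector_fields_def by blast

lemma vector_fields_subset: "w \<in> vector_fields X U \<Longrightarrow> V \<subseteq> U \<Longrightarrow> w \<in> vector_fields X V"
  unfolding vector_fields_def by auto

lemma vector_field_hol_near:
  assumes "w \<in> vector_fields X U" "openin (topo X) U" "p \<in> U" "hol_near X p f"
  shows "hol_near X p (\<lambda>q. w q f)"
proof -
  obtain V where "openin (topo X) V" "p \<in> V" "V \<subseteq> U" "f \<in> hol X V"
    by (rule hol_nearE[OF assms(4,2,3)])
  then show ?thesis using vector_field_hol[OF assms(1)] hol_nearI by blast
qed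

lemma vector_field_smult:
  assumes "w \<in> vector_fields X U" "openin (topo X) U" "f \<in> hol X U"
  shows "(\<lambda>q g. f q * w q g) \<in> vector_fields X U"
  using assms hol_mult[OF _ hol_subset[OF assms(3,2)]] derivation_at_smult
  unfolding vector_fields_def tangent_carrier by auto

lemma lie_bracket_eq: "hol_near X p f \<Longrightarrow> lie_bracket X w v p f = w p (\<lambda>q. v q f) - v p (\<lambda>q. w q f)"
  unfolding lie_bracket_def by simp

text \<open>In the product rule the mixed terms w(f) v(g) + w(g) v(f) are symmetric in
  \<open>w\<close> and \<open>v\<close> and cancel. The remaining care is that the rules for the
  inner field hold only at points near \<open>p\<close>, so the outer derivation is moved along
  equalities of germs.\<close>

lemma derivation_lie_bracket:
  assumes w: "w \<in> vector_fields X U" and v: "v \<in> vector_fields X U"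
    and U: "openin (topo X) U" and p: "p \<in> U"
  shows "derivation_at X p (lie_bracket X w v p)"
proof -
  have pt: "p \<in> topspace (topo X)" using U p openin_subset by blast
  note dw = vector_field_derivation[OF w] and dv = vector_field_derivation[OF v]
  note nw = vector_field_hol_near[OF w U p] and nv = vector_field_hol_near[OF v U p]
  \<comment> \<open>\<open>derivation_cong\<close> read backwards: holomorphy is asked of the
    simplified function \<open>h\<close>, not of the iterated expression \<open>h'\<close>.\<close>
  have cong: "d h' = d h"
    if "derivation_at X p d" "hol_near X p h" "openin (topo X) V" "p \<in> V" "\<And>q. q \<in> V \<Longrightarrow> h' q = h q"
    for d :: "'a tvec" and h h' V
    using derivation_cong[OF that(1-4), of h'] that(5) by simp
  show ?thesis
    unfolding derivation_at_def
  proof (intro conjI allI impI; (elim conjE)?)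
    fix f assume "\<not> hol_near X p f"
    then show "lie_bracket X w v p f = 0" by (simp add: lie_bracket_def)
  next
    fix f g assume f: "hol_near X p f" and g: "hol_near X p g"
    obtain V0 where V0: "openin (topo X) V0" "p \<in> V0" "f \<in> hol X V0" "g \<in> hol X V0"
      by (rule hol_near2[OF f g])
    define V where "V = V0 \<inter> U"
    have V: "openin (topo X) V" "p \<in> V" "V \<subseteq> U" using V0 U p by (auto simp: V_def)
    have near: "hol_near X q f" "hol_near X q g" if "q \<in> V" for q
      using V0 that by (auto simp: V_def intro: hol_nearI)
    {
      assume "\<exists>U. openin (topo X) U \<and> p \<in> U \<and> (\<forall>q\<in>U. f q = g q)"
      then obtain W where W: "openin (topo X) W" "p \<in> W" "\<And>q. q \<in> W \<Longrightarrow> f q = g q" by blast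
      have VW: "openin (topo X) (V \<inter> W)" "p \<in> V \<inter> W" using V W by auto
      have "v q f = v q g" "w q f = w q g" if "q \<in> V \<inter> W" for q
        using derivation_cong[OF dv[of q] near(1)[of q] W(1), of g]
          derivation_cong[OF dw[of q] near(1)[of q] W(1), of g] W(3) V(3) that by auto
      then have "w p (\<lambda>q. v q f) = w p (\<lambda>q. v q g)" "v p (\<lambda>q. w q f) = v p (\<lambda>q. w q g)"
        by (intro derivation_cong[OF dw[OF p] nv[OF f] VW] derivation_cong[OF dv[OF p] nw[OF f] VW]; simp)+
      then show "lie_bracket X w v p f = lie_bracket X w v p g"
        by (simp add: lie_bracket_eq f g)
    }
    show "lie_bracket X w v p (\<lambda>q. c * f q) = c * lie_bracket X w v p f" for c
    proof -
      have "w p (\<lambda>q. v q (\<lambda>q. c * f q)) = w p (\<lambda>q. c * v q f)"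
        by (rule cong[OF dw[OF p] hol_near_cmult[OF nv[OF f]] V(1,2)])
          (rule derivation_cmult[OF dv near(1)]; use V in auto)
      moreover have "v p (\<lambda>q. w q (\<lambda>q. c * f q)) = v p (\<lambda>q. c * w q f)"
        by (rule cong[OF dv[OF p] hol_near_cmult[OF nw[OF f]] V(1,2)])
          (rule derivation_cmult[OF dw near(1)]; use V in auto)
      ultimately show ?thesis
        by (simp add: lie_bracket_eq f hol_near_cmult derivation_cmult[OF dw[OF p] nv[OF f]]
            derivation_cmult[OF dv[OF p] nw[OF f]] algebra_simps)
    qed
    show "lie_bracket X w v p (\<lambda>q. f q + g q) = lie_bracket X w v p f + lie_bracket X w v p g"
    proof -
      have "w p (\<lambda>q. v q (\<lambda>q. f q + g q)) = w p (\<lambda>q. v q f + v q g)"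
        by (rule cong[OF dw[OF p] hol_near_add[OF nv[OF f] nv[OF g]] V(1,2)])
          (rule derivation_add[OF dv near]; use V in auto)
      moreover have "v p (\<lambda>q. w q (\<lambda>q. f q + g q)) = v p (\<lambda>q. w q f + w q g)"
        by (rule cong[OF dv[OF p] hol_near_add[OF nw[OF f] nw[OF g]] V(1,2)])
          (rule derivation_add[OF dw near]; use V in auto)
      ultimately show ?thesis
        by (simp add: lie_bracket_eq f g hol_near_add derivation_add[OF dw[OF p] nv[OF f] nv[OF g]]
            derivation_add[OF dv[OF p] nw[OF f] nw[OF g]])
    qed
    show "lie_bracket X w v p (\<lambda>q. f q * g q) = f p * lie_bracket X w v p g + g p * lie_bracket X w v p f"
    proof -
      have "w p (\<lambda>q. v q (\<lambda>q. f q * g q)) = w p (\<lambda>q. f q * v q g + g q * v q f)"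
        by (rule cong[OF dw[OF p] hol_near_add[OF hol_near_mult[OF f nv[OF g]] hol_near_mult[OF g nv[OF f]]] V(1,2)])
          (rule derivation_mult[OF dv near]; use V in auto)
      moreover have "v p (\<lambda>q. w q (\<lambda>q. f q * g q)) = v p (\<lambda>q. f q * w q g + g q * w q f)"
        by (rule cong[OF dv[OF p] hol_near_add[OF hol_near_mult[OF f nw[OF g]] hol_near_mult[OF g nw[OF f]]] V(1,2)])
          (rule derivation_mult[OF dw near]; use V in auto)
      ultimately show ?thesis
        by (simp add: lie_bracket_eq f g hol_near_mult nv nw
            derivation_add[OF dw[OF p] hol_near_mult[OF f nv[OF g]] hol_near_mult[OF g nv[OF f]]]
            derivation_add[OF dv[OF p] hol_near_mult[OF f nw[OF g]] hol_near_mult[OF g nw[OF f]]]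
            derivation_mult[OF dw[OF p]] derivation_mult[OF dv[OF p]] algebra_simps)
    qed
  qed
qed

end

section \<open>Charts and coordinate vector fields\<close>

locale mchart = cmanifold X n for X :: "'a cspace" and n :: "'n::finite itself" +
  fixes U :: "'a set" and \<phi> :: "'a \<Rightarrow> complex ^ 'n"
  assumes chart: "chart X U \<phi>"
begin

lemma U_open: "openin (topo X) U"
  using chart unfolding chart_def by blast

lemma U_topspace: "q \<in> U \<Longrightarrow> q \<in> topspace (topo X)"
  using openin_subset[OF U_open] by blast

lemma homeo: "homeomorphic_map (subtopology (topo X) U) (top_of_set (\<phi> ` U)) \<phi>"
  using chart unfolding chart_def by blast

lemma inj_chart: "inj_on \<phi> U"
  using homeomorphic_imp_injective_map[OF homeo] openin_subset[OF U_open]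
  by (simp add: inf.absorb2)

lemma inv_chart: "q \<in> U \<Longrightarrow> inv_into U \<phi> (\<phi> q) = q"
  by (rule inv_into_f_f[OF inj_chart])

lemma open_image:
  assumes "openin (topo X) V" "V \<subseteq> U"
  shows "open (\<phi> ` V)"
proof -
  have "openin (subtopology (topo X) U) V"
    using assms U_open openin_open_subtopology by blast
  then have "openin (top_of_set (\<phi> ` U)) (\<phi> ` V)"
    using homeomorphic_imp_open_map[OF homeo] unfolding open_map_def by blast
  moreover have "open (\<phi> ` U)" using chart unfolding chart_def by blast
  ultimately show ?thesis using openin_open_trans by blast
qed

lemma open_preimage:
  assumes "open S"
  shows "openin (topo X) {q \<in> U. \<phi> q \<in> S}"
proof -
  have "openin (subtopology (topo X) U) {q \<in> topspace (subtopology (topo X) U). \<phi> q \<in> \<phi> ` U \<inter> S}"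
    using homeomorphic_imp_continuous_map[OF homeo] openin_open_Int[OF assms]
    by (rule openin_continuous_map_preimage)
  moreover have "{q \<in> topspace (subtopology (topo X) U). \<phi> q \<in> \<phi> ` U \<inter> S} = {q \<in> U. \<phi> q \<in> S}"
    using openin_subset[OF U_open] by auto
  ultimately show ?thesis using openin_open_subtopology[OF U_open] by metis
qed

lemma hol_iff:
  "openin (topo X) V \<Longrightarrow> V \<subseteq> U \<Longrightarrow> f \<in> hol X V \<longleftrightarrow> holomorphic_fun (f \<circ> inv_into U \<phi>) (\<phi> ` V)"
  by (rule chart_hol_iff[OF chart])

lemma hol_pullback:
  assumes "openin (topo X) V" "V \<subseteq> U" "holomorphic_fun g (\<phi> ` V)"
  shows "(\<lambda>q. g (\<phi> q)) \<in> hol X V"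
proof -
  have "((\<lambda>q. g (\<phi> q)) \<circ> inv_into U \<phi>) y = g y" if "y \<in> \<phi> ` V" for y
    using that assms(2) inv_chart by (auto simp: subset_iff)
  then have "holomorphic_fun ((\<lambda>q. g (\<phi> q)) \<circ> inv_into U \<phi>) (\<phi> ` V)"
    using holomorphic_fun_cong[OF open_image[OF assms(1,2)]] assms(3) by blast
  then show ?thesis using hol_iff assms by blast
qed

text \<open>Allows shrinking to domains of frames and of local decompositions.
  \<open>inv_into V \<phi>\<close> and \<open>inv_into U \<phi>\<close> need agree only on the image
  of \<open>V\<close>, so holomorphy is transferred over open images.\<close>

lemma restrict_chart:
  assumes V: "openin (topo X) V" "V \<subseteq> U"
  shows "chart X V \<phi>"
  unfolding chart_def
proof (intro conjI allI impI; (elim conjE)?)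
  show "homeomorphic_map (subtopology (topo X) V) (top_of_set (\<phi> ` V)) \<phi>"
  proof -
    have "homeomorphic_map (subtopology (subtopology (topo X) U) V)
        (subtopology (top_of_set (\<phi> ` U)) (\<phi> ` V)) \<phi>"
      by (rule homeomorphic_map_subtopologies[OF homeo]) (use V openin_subset[OF V(1)] in auto)
    then show ?thesis
      using V by (simp add: subtopology_subtopology inf.absorb2 image_mono)
  qed
next
  fix W f assume W: "openin (topo X) W" "W \<subseteq> V"
  have "holomorphic_fun (f \<circ> inv_into V \<phi>) (\<phi> ` W) \<longleftrightarrow> holomorphic_fun (f \<circ> inv_into U \<phi>) (\<phi> ` W)"
  proof (rule holomorphic_fun_cong)
    show "open (\<phi> ` W)" using open_image W V by blast
    fix y assume "y \<in> \<phi> ` W"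
    then obtain q where "q \<in> W" "y = \<phi> q" by blast
    then show "(f \<circ> inv_into V \<phi>) y = (f \<circ> inv_into U \<phi>) y"
      using W V inv_into_f_f[OF inj_on_subset[OF inj_chart V(2)]] inv_chart
      by (auto simp: subset_iff)
  qed
  then show "f \<in> hol X W \<longleftrightarrow> holomorphic_fun (f \<circ> inv_into V \<phi>) (\<phi> ` W)"
    using hol_iff W V by blast
qed (use V open_image in auto)

definition coord :: "'n \<Rightarrow> 'a \<Rightarrow> complex" where
  "coord j q = \<phi> q $ j"

text \<open>The value 0 on functions that are not holomorphic near \<open>q\<close> is the
  normalization demanded by \<open>derivation_at\<close>.\<close>

definition coord_field :: "'n \<Rightarrow> 'a \<Rightarrow> 'a tvec" where
  "coord_field j q f = (if hol_near X q f then partial j (f \<circ> inv_into U \<phi>) (\<phi> q) else 0)"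

lemma coord_hol: "openin (topo X) V \<Longrightarrow> V \<subseteq> U \<Longrightarrow> coord j \<in> hol X V"
  using hol_pullback[OF _ _ holomorphic_fun_coordinate] unfolding coord_def by blast

lemma coord_near: "q \<in> U \<Longrightarrow> hol_near X q (coord j)"
  using coord_hol[OF U_open] hol_nearI[OF U_open] by blast

lemma chart_hol_near:
  assumes "hol_near X q f" "q \<in> U"
  obtains V where "openin (topo X) V" "q \<in> V" "V \<subseteq> U" "f \<in> hol X V" "open (\<phi> ` V)"
    "holomorphic_fun (f \<circ> inv_into U \<phi>) (\<phi> ` V)"
proof -
  obtain V where V: "openin (topo X) V" "q \<in> V" "V \<subseteq> U" "f \<in> hol X V"
    by (rule hol_nearE[OF assms(1) U_open assms(2)])
  then show thesis using that open_image hol_iff by blast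
qed

lemma coord_field_derivation:
  assumes q: "q \<in> U"
  shows "derivation_at X q (coord_field j q)"
  unfolding derivation_at_def
proof (intro conjI allI impI; (elim conjE)?)
  fix f assume "\<not> hol_near X q f"
  then show "coord_field j q f = 0" by (simp add: coord_field_def)
next
  fix f g assume fg: "hol_near X q f" "hol_near X q g"
  obtain V0 where V0: "openin (topo X) V0" "q \<in> V0" "f \<in> hol X V0" "g \<in> hol X V0"
    by (rule hol_near2[OF fg])
  define V where "V = V0 \<inter> U"
  have V: "openin (topo X) V" "q \<in> V" "V \<subseteq> U" using V0 U_open q by (auto simp: V_def)
  then have "f \<in> hol X V" "g \<in> hol X V"
    using V0 hol_subset unfolding V_def by blast+
  then have hf: "holomorphic_fun (f \<circ> inv_into U \<phi>) (\<phi> ` V)"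
    and hg: "holomorphic_fun (g \<circ> inv_into U \<phi>) (\<phi> ` V)"
    using hol_iff V by blast+
  have inV: "\<phi> q \<in> \<phi> ` V" using V by blast
  show "coord_field j q (\<lambda>q. f q + g q) = coord_field j q f + coord_field j q g"
    using partial_add[OF hf hg inV] fg hol_near_add
    unfolding coord_field_def by (simp add: comp_def)
  show "coord_field j q (\<lambda>q. f q * g q) = f q * coord_field j q g + g q * coord_field j q f"
    using partial_mult[OF hf hg inV] fg hol_near_mult inv_chart[OF q]
    unfolding coord_field_def by (simp add: comp_def)
  show "coord_field j q (\<lambda>q. c * f q) = c * coord_field j q f" for c
    using partial_mult[OF holomorphic_fun_const hf inV] fg hol_near_cmult
    unfolding coord_field_def by (simp add: comp_def partial_const)
  assume "\<exists>U. openin (topo X) U \<and> q \<in> U \<and> (\<forall>q\<in>U. f q = g q)"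
  then obtain W where W: "openin (topo X) W" "q \<in> W" "\<And>q. q \<in> W \<Longrightarrow> f q = g q" by blast
  have "partial j (f \<circ> inv_into U \<phi>) (\<phi> q) = partial j (g \<circ> inv_into U \<phi>) (\<phi> q)"
  proof (rule partial_cong)
    show "open (\<phi> ` (V \<inter> W))" using V W open_image by (metis openin_Int le_infI1)
    show "\<phi> q \<in> \<phi> ` (V \<inter> W)" using V W by blast
    fix y assume "y \<in> \<phi> ` (V \<inter> W)"
    then show "(f \<circ> inv_into U \<phi>) y = (g \<circ> inv_into U \<phi>) y"
      using V W inv_chart by (auto simp: subset_iff)
  qed
  then show "coord_field j q f = coord_field j q g"
    using fg by (simp add: coord_field_def)
qed

lemma coord_field_vector_field: "coord_field j \<in> vector_fields X U"
  unfolding vector_fields_def tangent_carrier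
proof (intro CollectI conjI ballI allI impI coord_field_derivation; (elim conjE)?)
  fix V f assume V: "openin (topo X) V" "V \<subseteq> U" "f \<in> hol X V"
  have "(\<lambda>q. partial j (f \<circ> inv_into U \<phi>) (\<phi> q)) \<in> hol X V"
    using hol_pullback[OF V(1,2) holomorphic_fun_partial] hol_iff[OF V(1,2)] open_image[OF V(1,2)] V(3)
    by blast
  then show "(\<lambda>p. coord_field j p f) \<in> hol X V"
    by (rule hol_cong[OF V(1)]) (use V hol_nearI in \<open>auto simp: coord_field_def\<close>)
qed

lemma coord_field_coord:
  assumes "q \<in> U"
  shows "coord_field j q (coord i) = (if j = i then 1 else 0)"
proof -
  have "partial j (coord i \<circ> inv_into U \<phi>) (\<phi> q) = partial j (\<lambda>z. z $ i) (\<phi> q)"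
    by (rule partial_cong[OF open_image[OF U_open order.refl]])
      (use assms inv_chart in \<open>auto simp: coord_def\<close>)
  then show ?thesis
    using coord_near[OF assms] by (simp add: coord_field_def partial_coordinate)
qed

text \<open>Hadamard's lemma centred at \<open>\<phi> q\<close> gives f = f(q) + sum of (x_j -
  x_j(q)) G_j. A derivation kills the constant, and by the product rule each summand contributes
  d(x_j) G_j(q), where G_j(q) is the partial derivative of \<open>f\<close>.\<close>

lemma derivation_expansion:
  assumes d: "derivation_at X q d" and q: "q \<in> U" and f: "hol_near X q f"
  shows "d f = (\<Sum>j\<in>UNIV. d (coord j) * coord_field j q f)"
proof -
  obtain V where V: "openin (topo X) V" "q \<in> V" "V \<subseteq> U" "f \<in> hol X V" "open (\<phi> ` V)"
    "holomorphic_fun (f \<circ> inv_into U \<phi>) (\<phi> ` V)"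
    by (rule chart_hol_near[OF f q])
  define c where "c = \<phi> q"
  obtain r where r: "0 < r" "ball c r \<subseteq> \<phi> ` V"
    using V(2,5) open_contains_ball unfolding c_def by blast
  obtain g where g0: "\<forall>j. holomorphic_fun (g j) (ball c r)"
    "\<forall>z\<in>ball c r. (f \<circ> inv_into U \<phi>) z =
      (f \<circ> inv_into U \<phi>) (\<chi> i. if i \<in> UNIV then c $ i else z $ i) + (\<Sum>j\<in>UNIV. (z $ j - c $ j) * g j z)"
    "\<forall>j. \<forall>z\<in>ball c r. (\<forall>i\<in>UNIV. z $ i = c $ i) \<longrightarrow> g j z = partial j (f \<circ> inv_into U \<phi>) z"
    \<comment> \<open>With all coordinates replaced, the leading term is the constant
      \<open>f q\<close>.\<close>
    using hadamard_factorization[OF holomorphic_fun_subset[OF V(6) r(2)], of UNIV] by (elim exE conjE)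
  note g = g0[rule_format]
  define B where "B = {p \<in> U. \<phi> p \<in> ball c r}"
  have B: "openin (topo X) B" "q \<in> B" "B \<subseteq> U"
    unfolding B_def using open_preimage[OF open_ball] q r by (auto simp: c_def)
  have qt: "q \<in> topspace (topo X)" using U_topspace[OF q] .
  define G where "G j p = g j (\<phi> p)" for j p
  have G: "hol_near X q (G j)" for j
    unfolding G_def
    by (rule hol_nearI[OF B(1,2)], rule hol_pullback[OF B(1,3)], rule holomorphic_fun_subset[OF g(1)])
      (auto simp: B_def)
  have xc: "hol_near X q (\<lambda>p. coord j p - c $ j)" for j
    by (intro hol_near_diff coord_near[OF q] hol_near_const[OF qt])
  have "d f = d (\<lambda>p. f q + (\<Sum>j\<in>UNIV. (coord j p - c $ j) * G j p))"
  proof (rule derivation_cong[OF d f B(1,2)])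
    fix p assume p: "p \<in> B"
    have "(\<chi> i. if i \<in> UNIV then c $ i else \<phi> p $ i) = \<phi> q" by (simp add: c_def vec_eq_iff)
    then show "f p = f q + (\<Sum>j\<in>UNIV. (coord j p - c $ j) * G j p)"
      using g(2)[of "\<phi> p"] p q by (simp add: B_def inv_chart coord_def G_def)
  qed
  also have "\<dots> = d (\<lambda>p. f q) + d (\<lambda>p. \<Sum>j\<in>UNIV. (coord j p - c $ j) * G j p)"
    by (intro derivation_add[OF d] hol_near_const[OF qt] hol_near_sum[OF qt] hol_near_mult xc G)
  also have "\<dots> = (\<Sum>j\<in>UNIV. d (\<lambda>p. (coord j p - c $ j) * G j p))"
    by (simp only: derivation_const[OF d qt] add_0_left,
        intro derivation_sum[OF d qt] hol_near_mult xc G)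
  also have "\<dots> = (\<Sum>j\<in>UNIV. d (coord j) * coord_field j q f)"
  proof (rule sum.cong[OF refl])
    fix j
    have "d (\<lambda>p. (coord j p - c $ j) * G j p) = (coord j q - c $ j) * d (G j) + G j q * d (\<lambda>p. coord j p - c $ j)"
      by (rule derivation_mult[OF d xc G])
    also have "coord j q - c $ j = 0" by (simp add: coord_def c_def)
    also have "d (\<lambda>p. coord j p - c $ j) = d (coord j)"
      by (subst derivation_diff[OF d coord_near[OF q] hol_near_const[OF qt]])
        (simp add: derivation_const[OF d qt])
    also have "G j q = coord_field j q f"
      using g(3)[of c j] r f by (simp add: G_def coord_field_def c_def)
    finally show "d (\<lambda>p. (coord j p - c $ j) * G j p) = d (coord j) * coord_field j q f"
      by (simp add: mult.commute)
  qed
  finally show ?thesis .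
qed

text \<open>Derivations at a point have as many degrees of freedom as there are coordinates. This
  later turns vanishing of a field on every coordinate into vanishing of the field at the
  point.\<close>

lemma derivation_eqI:
  assumes "derivation_at X q d" "derivation_at X q d'" "q \<in> U" "\<And>j. d (coord j) = d' (coord j)"
  shows "d = d'"
proof
  fix f show "d f = d' f"
    using derivation_expansion[OF assms(1,3), of f] derivation_expansion[OF assms(2,3), of f]
      assms(4) derivation_zero_off[OF assms(1)] derivation_zero_off[OF assms(2)]
    by (cases "hol_near X q f") simp_all
qed

text \<open>The bracket is a derivation, so testing it on the coordinates suffices; there the inner
  derivative is a constant 0 or 1 and the outer one kills it.\<close>

lemma coord_fields_commute:
  assumes "q \<in> U"
  shows "lie_bracket X (coord_field i) (coord_field j) q = (\<lambda>_. 0)"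
proof (rule derivation_eqI[OF derivation_lie_bracket derivation_at_zero])
  have "coord_field i' q (\<lambda>p. coord_field j' p (coord l)) = 0" for i' j' l
  proof -
    have "coord_field i' q (\<lambda>p. if j' = l then 1 else 0) = 0"
      by (rule derivation_const[OF coord_field_derivation[OF assms] U_topspace[OF assms]])
    moreover have "coord_field i' q (\<lambda>p. if j' = l then 1 else 0)
        = coord_field i' q (\<lambda>p. coord_field j' p (coord l))"
      by (rule derivation_cong[OF coord_field_derivation[OF assms] hol_near_const[OF U_topspace[OF assms]] U_open assms])
        (simp add: coord_field_coord)
    ultimately show ?thesis by simp
  qed
  then show "lie_bracket X (coord_field i) (coord_field j) q (coord l) = 0" for l
    by (simp add: lie_bracket_eq coord_near assms)
qed (use assms U_open coord_field_vector_field in auto)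

end

section \<open>Vectors tangent and normal to the divisor\<close>

context cmanifold
begin

section \<open>Holomorphic one-forms\<close>

lemma carrier_tangent: "carrier (tangent_space X p) = {d. derivation_at X p d}"
  by (simp add: tangent_space_def)

lemma one_forms_iff:
  "\<alpha> \<in> one_forms X U \<longleftrightarrow>
    (\<forall>q\<in>U. \<forall>d d' c. derivation_at X q d \<longrightarrow> derivation_at X q d' \<longrightarrow>
      \<alpha> q (\<lambda>f. d f + d' f) = \<alpha> q d + \<alpha> q d' \<and> \<alpha> q (\<lambda>f. c * d f) = c * \<alpha> q d) \<and>
    (\<forall>V v. openin (topo X) V \<longrightarrow> V \<subseteq> U \<longrightarrow> v \<in> vector_fields X V \<longrightarrow> (\<lambda>p. \<alpha> p (v p)) \<in> hol X V)"
  unfolding one_forms_def carrier_tangent tangent_add tangent_smult by auto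

lemma one_form_add:
  "\<alpha> \<in> one_forms X U \<Longrightarrow> q \<in> U \<Longrightarrow> derivation_at X q d \<Longrightarrow> derivation_at X q d' \<Longrightarrow>
    \<alpha> q (\<lambda>f. d f + d' f) = \<alpha> q d + \<alpha> q d'"
  unfolding one_forms_iff by simp

lemma one_form_smult:
  "\<alpha> \<in> one_forms X U \<Longrightarrow> q \<in> U \<Longrightarrow> derivation_at X q d \<Longrightarrow> \<alpha> q (\<lambda>f. c * d f) = c * \<alpha> q d"
  unfolding one_forms_iff by blast

lemma one_form_zero: "\<alpha> \<in> one_forms X U \<Longrightarrow> q \<in> U \<Longrightarrow> \<alpha> q (\<lambda>_. 0) = 0"
  using one_form_smult[of \<alpha> U q "\<lambda>_. 0" 0] derivation_at_zero by simp

lemma one_form_hol: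
  "\<alpha> \<in> one_forms X U \<Longrightarrow> openin (topo X) V \<Longrightarrow> V \<subseteq> U \<Longrightarrow> v \<in> vector_fields X V \<Longrightarrow>
    (\<lambda>p. \<alpha> p (v p)) \<in> hol X V"
  unfolding one_forms_iff by blast

lemma one_formsI:
  assumes "\<And>q d d'. q \<in> U \<Longrightarrow> derivation_at X q d \<Longrightarrow> derivation_at X q d' \<Longrightarrow>
      \<alpha> q (\<lambda>f. d f + d' f) = \<alpha> q d + \<alpha> q d'"
    and "\<And>q d c. q \<in> U \<Longrightarrow> derivation_at X q d \<Longrightarrow> \<alpha> q (\<lambda>f. c * d f) = c * \<alpha> q d"
    and "\<And>V v. openin (topo X) V \<Longrightarrow> V \<subseteq> U \<Longrightarrow> v \<in> vector_fields X V \<Longrightarrow> (\<lambda>p. \<alpha> p (v p)) \<in> hol X V"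
  shows "\<alpha> \<in> one_forms X U"
  using assms unfolding one_forms_iff by simp

lemma one_forms_subset: "\<alpha> \<in> one_forms X U \<Longrightarrow> V \<subseteq> U \<Longrightarrow> \<alpha> \<in> one_forms X V"
  unfolding one_forms_iff by (meson order_trans subsetD)

lemma one_forms_add:
  assumes "\<alpha> \<in> one_forms X U" "\<beta> \<in> one_forms X U"
  shows "(\<lambda>q d. \<alpha> q d + \<beta> q d) \<in> one_forms X U"
  by (rule one_formsI)
    (simp_all add: one_form_add[OF assms(1)] one_form_add[OF assms(2)] one_form_smult[OF assms(1)]
      one_form_smult[OF assms(2)] distrib_left hol_add one_form_hol[OF assms(1)] one_form_hol[OF assms(2)])

lemma one_forms_scale:
  assumes "\<alpha> \<in> one_forms X U" "f \<in> hol X U" "openin (topo X) U"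
  shows "(\<lambda>q d. f q * \<alpha> q d) \<in> one_forms X U"
  by (rule one_formsI)
    (simp_all add: one_form_add[OF assms(1)] one_form_smult[OF assms(1)]
      distrib_left hol_mult one_form_hol[OF assms(1)] hol_subset[OF assms(2,3)])

lemma one_forms_const_zero: "(\<lambda>q d. 0) \<in> one_forms X U"
  by (rule one_formsI) (simp_all add: hol_const)

lemma one_forms_sum:
  "(\<And>j. j \<in> J \<Longrightarrow> \<alpha> j \<in> one_forms X U) \<Longrightarrow> (\<lambda>q d. \<Sum>j\<in>J. \<alpha> j q d) \<in> one_forms X U"
  by (induction J rule: infinite_finite_induct) (simp_all add: one_forms_const_zero one_forms_add)

lemma differential_one_form:
  "f \<in> hol X U \<Longrightarrow> openin (topo X) U \<Longrightarrow> (\<lambda>q d. d f) \<in> one_forms X U"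
  by (rule one_formsI) (simp_all add: vector_field_hol hol_subset)

lemma derivation_at_sum:
  "(\<And>j. j \<in> J \<Longrightarrow> derivation_at X q (d j)) \<Longrightarrow> derivation_at X q (\<lambda>f. \<Sum>j\<in>J. c j * d j f)"
  by (induction J rule: infinite_finite_induct)
    (simp_all add: derivation_at_zero derivation_at_add derivation_at_smult)

lemma one_form_sum:
  assumes "\<alpha> \<in> one_forms X U" "q \<in> U" "\<And>j. j \<in> J \<Longrightarrow> derivation_at X q (d j)"
  shows "\<alpha> q (\<lambda>f. \<Sum>j\<in>J. c j * d j f) = (\<Sum>j\<in>J. c j * \<alpha> q (d j))"
  using assms(3)
proof (induction J rule: infinite_finite_induct)
  case (insert j J)
  then have "\<alpha> q (\<lambda>f. c j * d j f + (\<Sum>j\<in>J. c j * d j f)) =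
      \<alpha> q (\<lambda>f. c j * d j f) + \<alpha> q (\<lambda>f. \<Sum>j\<in>J. c j * d j f)"
    by (intro one_form_add[OF assms(1,2)] derivation_at_smult derivation_at_sum) auto
  with insert show ?case by (simp add: one_form_smult[OF assms(1,2)])
qed (simp_all add: one_form_zero[OF assms(1,2)])

text \<open>A section of the restricted sheaf is only locally a restriction; near \<open>p\<close>
  one extension remains after intersecting with the open set of \<open>X\<close> that cuts out its
  domain.\<close>

lemma hol_near_subspace:
  assumes "p \<in> D"
  shows "hol_near (subspace_of X D) p f \<longleftrightarrow>
    (\<exists>U g. openin (topo X) U \<and> p \<in> U \<and> g \<in> hol X U \<and> (\<forall>q\<in>U \<inter> D. f q = g q))"
proof
  assume "hol_near (subspace_of X D) p f"
  then obtain V where V: "openin (subtopology (topo X) D) V" "p \<in> V" "f \<in> restrict_sheaf (topo X) (hol X) V"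
    unfolding hol_near_def subspace_of_def by auto
  obtain O' where O': "openin (topo X) O'" "V = O' \<inter> D"
    using V(1) openin_subtopology by metis
  obtain U g where U: "openin (topo X) U" "p \<in> U" "g \<in> hol X U" "\<forall>q\<in>U \<inter> V. f q = g q"
    using V unfolding restrict_sheaf_def by blast
  show "\<exists>U g. openin (topo X) U \<and> p \<in> U \<and> g \<in> hol X U \<and> (\<forall>q\<in>U \<inter> D. f q = g q)"
    using U O' V by (intro exI[of _ "U \<inter> O'"] exI[of _ g]) (auto intro: hol_subset)
next
  assume "\<exists>U g. openin (topo X) U \<and> p \<in> U \<and> g \<in> hol X U \<and> (\<forall>q\<in>U \<inter> D. f q = g q)"
  then obtain U g where U: "openin (topo X) U" "p \<in> U" "g \<in> hol X U" "\<forall>q\<in>U \<inter> D. f q = g q" by blast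
  have "f \<in> restrict_sheaf (topo X) (hol X) (U \<inter> D)"
    unfolding restrict_sheaf_def using U by auto
  moreover have "openin (subtopology (topo X) D) (U \<inter> D)"
    using U(1) openin_subtopology by blast
  ultimately show "hol_near (subspace_of X D) p f"
    unfolding hol_near_def subspace_of_def using U assms by auto
qed

end

section \<open>Functions and tangent vectors near a smooth divisor\<close>

locale divisor_chart = mchart X n U \<phi>
  for X :: "'a cspace" and n :: "'n::finite itself" and U :: "'a set" and \<phi> :: "'a \<Rightarrow> complex ^ 'n" +
  fixes D :: "'a set" and k :: 'n
  assumes D_chart: "D \<inter> U = {q \<in> U. \<phi> q $ k = 0}"
    and D_closed: "closedin (topo X) D"
begin

lemma on_D: "q \<in> U \<Longrightarrow> q \<in> D \<longleftrightarrow> coord k q = 0"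
  using D_chart by (auto simp: coord_def)

lemma open_minus_D: "openin (topo X) V \<Longrightarrow> openin (topo X) (V - D)"
  using D_closed by (rule openin_diff[rotated])

lemma adapted_chart_subset:
  "openin (topo X) V \<Longrightarrow> V \<subseteq> U \<Longrightarrow> adapted_chart X D V \<phi> k"
  using restrict_chart D_chart unfolding adapted_chart_def by blast

text \<open>\<open>D\<close> has empty interior. A difference that is nonzero at \<open>q\<close> is
  nonzero on a ball about \<open>\<phi> q\<close>, and a small step in the direction of coordinate
  \<open>k\<close> stays in the ball and leaves \<open>D\<close>. All uniqueness of extensions
  across \<open>D\<close> rests on this.\<close>

lemma hol_eq_at_D:
  assumes V: "openin (topo X) V" "q \<in> V" "q \<in> U"
    and fg: "f \<in> hol X V" "g \<in> hol X V" "\<And>y. y \<in> V - D \<Longrightarrow> f y = g y"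
  shows "f q = g q"
proof (rule ccontr)
  assume neq: "f q \<noteq> g q"
  define W where "W = V \<inter> U"
  have W: "openin (topo X) W" "W \<subseteq> U" "q \<in> W" using V U_open by (auto simp: W_def)
  have opn: "open (\<phi> ` W)" using open_image W by blast
  define h where "h = (\<lambda>y. f y - g y) \<circ> inv_into U \<phi>"
  have "(\<lambda>y. f y - g y) \<in> hol X W"
    using hol_diff[OF V(1) fg(1,2)] hol_subset[OF _ V(1) W(1)] by (auto simp: W_def)
  then have "continuous_on (\<phi> ` W) h"
    using hol_iff[OF W(1,2)] holomorphic_fun_continuous_on unfolding h_def by blast
  then have "open (\<phi> ` W \<inter> h -` (- {0}))"
    using opn by (intro continuous_open_preimage) auto
  moreover have "\<phi> q \<in> \<phi> ` W \<inter> h -` (- {0})"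
    using W neq inv_chart by (auto simp: h_def)
  ultimately obtain r where r: "0 < r" "ball (\<phi> q) r \<subseteq> \<phi> ` W \<inter> h -` (- {0})"
    using open_contains_ball by blast
  define z where "z = \<phi> q + axis k (of_real (r / 2))"
  have "z \<in> ball (\<phi> q) r"
    using r by (simp add: z_def dist_norm norm_axis_eq)
  then obtain y where y: "y \<in> W" "z = \<phi> y" "h z \<noteq> 0" using r by blast
  have "q \<in> D" using neq fg(3) V by blast
  then have "coord k y = of_real (r / 2)"
    using y(2) on_D[of q] V by (simp add: coord_def z_def axis_def flip: y(2))
  then have "y \<notin> D" using on_D[of y] W y r by auto
  then have "h z = 0" using fg(3) y W inv_chart by (auto simp: h_def W_def)
  then show False using y by simp
qed

text \<open>Hadamard's lemma with only coordinate \<open>k\<close> replaced: the leading term is the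
  value of \<open>f\<close> at a point of \<open>D\<close>, so it vanishes and the equation of
  \<open>D\<close> factors out.\<close>

lemma divide_by_coord:
  assumes q: "q \<in> U" "q \<in> D" and V: "openin (topo X) V" "q \<in> V" and f: "f \<in> hol X V"
    and vanish: "\<And>y. y \<in> V \<inter> D \<Longrightarrow> f y = 0"
  obtains B a where "openin (topo X) B" "q \<in> B" "B \<subseteq> V" "B \<subseteq> U" "a \<in> hol X B"
    "\<forall>y\<in>B. f y = coord k y * a y"
proof -
  define W where "W = V \<inter> U"
  have W: "openin (topo X) W" "W \<subseteq> U" "q \<in> W" using V U_open q by (auto simp: W_def)
  have hf: "holomorphic_fun (f \<circ> inv_into U \<phi>) (\<phi> ` W)"
    using hol_iff[OF W(1,2)] hol_subset[OF f V(1) W(1)] by (auto simp: W_def)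
  define c where "c = \<phi> q"
  have ck: "c $ k = 0" using on_D q by (simp add: c_def coord_def)
  obtain r where r: "0 < r" "ball c r \<subseteq> \<phi> ` W"
    using W open_image[OF W(1,2)] open_contains_ball unfolding c_def by blast
  obtain g where g0: "\<forall>j. holomorphic_fun (g j) (ball c r)"
    "\<forall>z\<in>ball c r. (f \<circ> inv_into U \<phi>) z =
      (f \<circ> inv_into U \<phi>) (\<chi> i. if i \<in> {k} then c $ i else z $ i) + (\<Sum>j\<in>{k}. (z $ j - c $ j) * g j z)"
    using hadamard_factorization[OF holomorphic_fun_subset[OF hf r(2)], of "{k}"] by (elim exE conjE)
  note g = g0[rule_format]
  define B where "B = {p \<in> U. \<phi> p \<in> ball c r}"
  have BW: "B \<subseteq> W"
  proof
    fix y assume y: "y \<in> B"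
    then obtain y' where "y' \<in> W" "\<phi> y = \<phi> y'" using r unfolding B_def by blast
    then show "y \<in> W" using y W inj_onD[OF inj_chart] unfolding B_def by blast
  qed
  have B: "openin (topo X) B" "q \<in> B"
    unfolding B_def using open_preimage[OF open_ball] q r by (auto simp: c_def)
  show thesis
  proof
    show "(\<lambda>y. g k (\<phi> y)) \<in> hol X B"
      by (rule hol_pullback[OF B(1)], use BW W in blast, rule holomorphic_fun_subset[OF g(1)])
        (auto simp: B_def)
    show "\<forall>y\<in>B. f y = coord k y * g k (\<phi> y)"
    proof
      fix y assume y: "y \<in> B"
      define z where "z = \<phi> y"
      \<comment> \<open>The projection of \<open>z\<close> to the hyperplane of \<open>D\<close>. It
        is no farther from \<open>c\<close> than \<open>z\<close>, so it still belongs to the chart,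
        where \<open>f\<close> is known to vanish on \<open>D\<close>.\<close>
      define z' where "z' = (\<chi> i. if i \<in> {k} then c $ i else z $ i)"
      have z: "z \<in> ball c r" using y by (simp add: B_def z_def)
      have "norm ((z' - c) $ i) \<le> norm ((z - c) $ i)" for i
        by (simp add: z'_def)
      then have "norm (z' - c) \<le> norm (z - c)"
        by (rule norm_le_componentwise_cart)
      then have "z' \<in> ball c r" using z by (simp add: dist_norm norm_minus_commute)
      then obtain y' where y': "y' \<in> W" "z' = \<phi> y'" using r by blast
      have "\<phi> y' $ k = 0" using ck unfolding y'(2)[symmetric] by (simp add: z'_def)
      then have "y' \<in> D" using on_D[of y'] y' W by (auto simp: coord_def)
      then have "f y' = 0" using vanish y' by (auto simp: W_def)
      then have "(f \<circ> inv_into U \<phi>) z' = 0" using y' W inv_chart by (auto simp: subset_iff)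
      then show "f y = coord k y * g k (\<phi> y)"
        using g(2)[OF z, folded z'_def] y ck by (simp add: z_def B_def inv_chart coord_def)
    qed
  qed (use B BW in \<open>auto simp: W_def\<close>)
qed

text \<open>Near \<open>q\<close> the function is x a, and both terms of the product rule vanish:
  x(q) = 0 and d(x) = 0. Hence \<open>d\<close> depends only on restrictions to
  \<open>D\<close>.\<close>

lemma derivation_vanish_coord:
  assumes d: "derivation_at X q d" and q: "q \<in> U" "q \<in> D" and x: "d (coord k) = 0"
    and V: "openin (topo X) V" "q \<in> V" "f \<in> hol X V" "\<And>y. y \<in> V \<inter> D \<Longrightarrow> f y = 0"
  shows "d f = 0"
proof -
  obtain B a where B: "openin (topo X) B" "q \<in> B" "B \<subseteq> V" "B \<subseteq> U" "a \<in> hol X B"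
    "\<forall>y\<in>B. f y = coord k y * a y"
    by (rule divide_by_coord[OF q V])
  have "d f = d (\<lambda>y. coord k y * a y)"
    by (rule derivation_cong[OF d hol_nearI[OF V(1,2,3)] B(1,2) B(6)[rule_format]])
  also have "\<dots> = coord k q * d a + a q * d (coord k)"
    by (rule derivation_mult[OF d coord_near[OF q(1)] hol_nearI[OF B(1,2,5)]])
  also have "\<dots> = 0" using x on_D[OF q(1)] q(2) by simp
  finally show ?thesis .
qed

text \<open>A derivation of functions on \<open>D\<close> kills x, whose restriction is 0.
  Conversely, if d(x) = 0, two extensions of a function from \<open>D\<close> have the same image
  under \<open>d\<close>, since their difference vanishes on \<open>D\<close>; so \<open>d\<close>
  descends to functions on \<open>D\<close>.\<close>

lemma tangent_to_eq:
  assumes q: "q \<in> U" "q \<in> D"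
  shows "tangent_to X D q = {d. derivation_at X q d \<and> d (coord k) = 0}"
proof (intro equalityI subsetI CollectI)
  let ?Y = "subspace_of X D"
  have qt: "q \<in> topspace (topo X)" using U_topspace q by blast
  have near: "hol_near ?Y q f" if "hol_near X q f" for f
    using that hol_near_subspace[OF q(2)] unfolding hol_near_def by blast
  {
    fix e assume "e \<in> tangent_to X D q"
    then obtain d where d: "derivation_at ?Y q d" and e: "e = (\<lambda>f. if hol_near X q f then d f else 0)"
      unfolding tangent_to_def by (auto simp: tangent_space_def)
    note dD = d[unfolded derivation_at_def, THEN conjunct2, rule_format, OF conjI]
    have topoY: "topo ?Y = subtopology (topo X) D" by (simp add: subspace_of_def)
    have "derivation_at X q e"
      unfolding derivation_at_def
    proof (intro conjI allI impI; (elim conjE)?)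
      fix f g assume f: "hol_near X q f" and g: "hol_near X q g"
      note fg = dD[OF near[OF f] near[OF g]]
      show "e (\<lambda>q. c * f q) = c * e f" for c
        using fg f by (simp add: e hol_near_cmult)
      show "e (\<lambda>q. f q + g q) = e f + e g"
        using fg f g by (simp add: e hol_near_add)
      show "e (\<lambda>q. f q * g q) = f q * e g + g q * e f"
        using fg f g by (simp add: e hol_near_mult)
      assume "\<exists>U. openin (topo X) U \<and> q \<in> U \<and> (\<forall>q\<in>U. f q = g q)"
      then obtain W where W: "openin (topo X) W" "q \<in> W" "\<forall>q\<in>W. f q = g q" by blast
      have "openin (topo ?Y) (W \<inter> D) \<and> q \<in> W \<inter> D \<and> (\<forall>q\<in>W \<inter> D. f q = g q)"
        unfolding topoY using W q openin_subtopology by blast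
      then have "d f = d g" using fg by blast
      then show "e f = e g" using f g by (simp add: e)
    qed (simp add: e)
    moreover have "e (coord k) = 0"
    proof -
      have n0: "hol_near ?Y q (\<lambda>_. 0)" and nx: "hol_near ?Y q (coord k)"
        using near[OF hol_near_const[OF qt]] near[OF coord_near[OF q(1)]] by blast+
      have "openin (topo ?Y) (U \<inter> D) \<and> q \<in> U \<inter> D \<and> (\<forall>y\<in>U \<inter> D. coord k y = 0)"
        unfolding topoY using U_open q openin_subtopology on_D by blast
      then have "d (coord k) = d (\<lambda>_. 0)"
        using dD[OF nx n0, THEN conjunct1] by blast
      also have "d (\<lambda>_. 0) = 0"
        using dD[OF n0 n0, THEN conjunct2, THEN conjunct1, rule_format, of 0] by simp
      finally show ?thesis by (simp add: e)
    qed
    ultimately show "derivation_at X q e \<and> e (coord k) = 0" ..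
  }
  fix d assume "d \<in> {d. derivation_at X q d \<and> d (coord k) = 0}"
  then have d: "derivation_at X q d" and x: "d (coord k) = 0" by auto
  \<comment> \<open>\<open>g\<close> represents a holomorphic germ on \<open>X\<close> that
    restricts to \<open>f\<close> on \<open>D\<close>; the descended derivation evaluates
    \<open>d\<close> on such a \<open>g\<close>.\<close>
  define ext where "ext f g \<longleftrightarrow> hol_near X q g \<and> (\<exists>V. openin (topo X) V \<and> q \<in> V \<and> (\<forall>y\<in>V \<inter> D. f y = g y))"
    for f g
  have ext_unique: "d g = d g'" if "ext f g" "ext f g'" for f g g'
  proof -
    obtain V where V: "openin (topo X) V" "q \<in> V" "\<And>y. y \<in> V \<inter> D \<Longrightarrow> f y = g y"
      using \<open>ext f g\<close> unfolding ext_def by blast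
    obtain V' where V': "openin (topo X) V'" "q \<in> V'" "\<And>y. y \<in> V' \<inter> D \<Longrightarrow> f y = g' y"
      using \<open>ext f g'\<close> unfolding ext_def by blast
    have gg': "hol_near X q g" "hol_near X q g'" using that unfolding ext_def by auto
    obtain W where W: "openin (topo X) W" "q \<in> W" "W \<subseteq> V \<inter> V'" "(\<lambda>y. g y - g' y) \<in> hol X W"
      by (rule hol_nearE[OF hol_near_diff[OF gg'], of "V \<inter> V'"]) (use V V' in auto)
    have "d (\<lambda>y. g y - g' y) = 0"
    proof (rule derivation_vanish_coord[OF d q x W(1,2,4)])
      fix y assume "y \<in> W \<inter> D"
      then have "f y = g y" "f y = g' y" using V(3) V'(3) W(3) by blast+
      then show "g y - g' y = 0" by simp
    qed
    then show ?thesis using derivation_diff[OF d gg'] by simp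
  qed
  have ext_iff: "hol_near ?Y q f \<longleftrightarrow> (\<exists>g. ext f g)" for f
    unfolding hol_near_subspace[OF q(2)]
  proof
    assume "\<exists>U g. openin (topo X) U \<and> q \<in> U \<and> g \<in> hol X U \<and> (\<forall>q\<in>U \<inter> D. f q = g q)"
    then show "\<exists>g. ext f g" unfolding ext_def hol_near_def by blast
  next
    assume "\<exists>g. ext f g"
    then obtain g V where g: "hol_near X q g" "openin (topo X) V" "q \<in> V" "\<forall>y\<in>V \<inter> D. f y = g y"
      unfolding ext_def by blast
    obtain W where "openin (topo X) W" "q \<in> W" "W \<subseteq> V" "g \<in> hol X W"
      by (rule hol_nearE[OF g(1-3)])
    then show "\<exists>U g. openin (topo X) U \<and> q \<in> U \<and> g \<in> hol X U \<and> (\<forall>q\<in>U \<inter> D. f q = g q)"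
      using g(4) by blast
  qed
  have ext_self: "ext f f" if "hol_near X q f" for f
    using that qt unfolding ext_def by (intro conjI exI[of _ "topspace (topo X)"]) auto
  \<comment> \<open>The choice is harmless by \<open>ext_unique\<close>, and the value 0 elsewhere
    is the normalization of \<open>derivation_at\<close> on \<open>D\<close>.\<close>
  define d' where "d' f = (if hol_near ?Y q f then d (SOME g. ext f g) else 0)" for f
  have d'_eq: "d' f = d g" if "ext f g" for f g
  proof -
    have "ext f (SOME g. ext f g)" using someI[of "ext f", OF that] by simp
    then have "d (SOME g. ext f g) = d g" using that by (rule ext_unique)
    moreover have "hol_near ?Y q f" using that unfolding ext_iff by blast
    ultimately show ?thesis by (simp add: d'_def)
  qed
  have "derivation_at ?Y q d'"
    unfolding derivation_at_def
  proof (intro conjI allI impI; (elim conjE)?)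
    fix f g assume "hol_near ?Y q f" "hol_near ?Y q g"
    then obtain F G where F: "ext f F" and G: "ext g G" using ext_iff by blast
    obtain V where V: "openin (topo X) V" "q \<in> V" "\<forall>y\<in>V \<inter> D. f y = F y"
      using F unfolding ext_def by blast
    obtain V' where V': "openin (topo X) V'" "q \<in> V'" "\<forall>y\<in>V' \<inter> D. g y = G y"
      using G unfolding ext_def by blast
    have nF: "hol_near X q F" and nG: "hol_near X q G" using F G unfolding ext_def by auto
    have VV': "openin (topo X) (V \<inter> V')" "q \<in> V \<inter> V'" using V V' by auto
    have eFG: "ext (\<lambda>y. f y + g y) (\<lambda>y. F y + G y)" "ext (\<lambda>y. f y * g y) (\<lambda>y. F y * G y)"
      "ext (\<lambda>y. c * f y) (\<lambda>y. c * F y)" for c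
      unfolding ext_def using V V' VV' nF nG hol_near_add hol_near_mult hol_near_cmult
      by (intro conjI exI[of _ "V \<inter> V'"]; simp)+
    show "d' (\<lambda>q. c * f q) = c * d' f" for c
      using d'_eq[OF eFG(3)] d'_eq[OF F] derivation_cmult[OF d nF] by simp
    show "d' (\<lambda>q. f q + g q) = d' f + d' g"
      using d'_eq[OF eFG(1)] d'_eq[OF F] d'_eq[OF G] derivation_add[OF d nF nG] by simp
    show "d' (\<lambda>q. f q * g q) = f q * d' g + g q * d' f"
      using d'_eq[OF eFG(2)] d'_eq[OF F] d'_eq[OF G] derivation_mult[OF d nF nG] V V' q by simp
    assume "\<exists>U. openin (topo ?Y) U \<and> q \<in> U \<and> (\<forall>q\<in>U. f q = g q)"
    then obtain W where W: "openin (topo X) W" "q \<in> W" "\<forall>y\<in>W \<inter> D. f y = g y"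
      by (auto simp: subspace_of_def openin_subtopology)
    have "ext f G"
      unfolding ext_def using V' W nG by (intro conjI exI[of _ "V' \<inter> W"]) auto
    then show "d' f = d' g" using d'_eq[OF G] d'_eq by simp
  qed (simp add: d'_def)
  moreover have "d = (\<lambda>f. if hol_near X q f then d' f else 0)"
    using d'_eq[OF ext_self] derivation_zero_off[OF d] by auto
  ultimately show "d \<in> tangent_to X D q"
    unfolding tangent_to_def by (auto simp: tangent_space_def)
qed

text \<open>Two tangent vectors differ by one tangent to \<open>D\<close> exactly when they agree on
  x. Equations in the normal bundle thus become equations between values on
  \<open>coord k\<close>.\<close>

lemma normal_proj_eq:
  assumes q: "q \<in> U" "q \<in> D" and d: "derivation_at X q d"
  shows "normal_proj X D q d = {e. derivation_at X q e \<and> e (coord k) = d (coord k)}"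
proof (intro equalityI subsetI CollectI)
  fix e assume "e \<in> normal_proj X D q d"
  then obtain h where "derivation_at X q h" "h (coord k) = 0" "e = (\<lambda>f. h f + d f)"
    unfolding normal_proj_def tangent_to_eq[OF q] a_r_coset_def' tangent_add by auto
  then show "derivation_at X q e \<and> e (coord k) = d (coord k)"
    using derivation_at_add d by simp
next
  fix e assume "e \<in> {e. derivation_at X q e \<and> e (coord k) = d (coord k)}"
  then have e: "derivation_at X q e" "e (coord k) = d (coord k)" by auto
  define h where "h = (\<lambda>f. e f + - 1 * d f)"
  have "derivation_at X q h" "h (coord k) = 0" "e = (\<lambda>f. h f + d f)"
    unfolding h_def using derivation_at_add[OF e(1) derivation_at_smult[OF d, of "- 1"]] e by auto
  then show "e \<in> normal_proj X D q d"
    unfolding normal_proj_def tangent_to_eq[OF q] a_r_coset_def' tangent_add by auto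
qed

lemma normal_proj_cong:
  assumes q: "q \<in> U" "q \<in> D" and d: "derivation_at X q d" "derivation_at X q d'"
  shows "normal_proj X D q d = normal_proj X D q d' \<longleftrightarrow> d (coord k) = d' (coord k)"
proof -
  have "d \<in> {e. derivation_at X q e \<and> e (coord k) = d (coord k)}" using d by simp
  then show ?thesis unfolding normal_proj_eq[OF q d(1)] normal_proj_eq[OF q d(2)] by auto
qed

lemma normal_proj_add:
  assumes q: "q \<in> U" "q \<in> D" and d: "derivation_at X q d" "derivation_at X q d'"
  shows "normal_proj X D q d \<oplus>\<^bsub>fib (normal_bundle X D) q\<^esub> normal_proj X D q d' =
    normal_proj X D q (\<lambda>f. d f + d' f)"
proof -
  note dd' = derivation_at_add[OF d]
  have "e \<in> (\<Union>h\<in>normal_proj X D q d. \<Union>h'\<in>normal_proj X D q d'. {\<lambda>f. h f + h' f})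
      \<longleftrightarrow> e \<in> normal_proj X D q (\<lambda>f. d f + d' f)" for e
    unfolding normal_proj_eq[OF q d(1)] normal_proj_eq[OF q d(2)] normal_proj_eq[OF q dd']
  proof
    assume "e \<in> {e. derivation_at X q e \<and> e (coord k) = d (coord k) + d' (coord k)}"
    then have e: "derivation_at X q e" "e (coord k) = d (coord k) + d' (coord k)" by auto
    \<comment> \<open>Witness for the sum of cosets: \<open>e\<close> splits as
      \<open>e - d'\<close> plus \<open>d'\<close>.\<close>
    have "derivation_at X q (\<lambda>f. e f + - 1 * d' f)"
      by (rule derivation_at_add[OF e(1) derivation_at_smult[OF d(2)]])
    with e d(2) show "e \<in> (\<Union>h\<in>{e. derivation_at X q e \<and> e (coord k) = d (coord k)}.
        \<Union>h'\<in>{e. derivation_at X q e \<and> e (coord k) = d' (coord k)}. {\<lambda>f. h f + h' f})"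
      by (intro UN_I[of "\<lambda>f. e f + - 1 * d' f"] UN_I[of d']) auto
  qed (auto intro: derivation_at_add)
  then show ?thesis
    by (simp add: normal_bundle_def quotient_module_def set_add_def' tangent_add set_eq_iff)
qed

text \<open>The scalar multiple in \<open>quotient_module\<close> adds the subspace back to the
  scaled coset; this keeps the result a full coset also for the scalar 0.\<close>

lemma normal_proj_smult:
  assumes q: "q \<in> U" "q \<in> D" and d: "derivation_at X q d"
  shows "c \<odot>\<^bsub>fib (normal_bundle X D) q\<^esub> normal_proj X D q d = normal_proj X D q (\<lambda>f. c * d f)"
proof -
  note cd = derivation_at_smult[OF d, of c]
  have "e \<in> (\<Union>h\<in>tangent_to X D q. \<Union>h'\<in>(\<lambda>d f. c * d f) ` normal_proj X D q d. {\<lambda>f. h f + h' f})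
      \<longleftrightarrow> e \<in> normal_proj X D q (\<lambda>f. c * d f)" for e
    unfolding normal_proj_eq[OF q d] normal_proj_eq[OF q cd] tangent_to_eq[OF q]
  proof
    assume "e \<in> {e. derivation_at X q e \<and> e (coord k) = c * d (coord k)}"
    then have e: "derivation_at X q e" "e (coord k) = c * d (coord k)" by auto
    have "derivation_at X q (\<lambda>f. e f + - 1 * (c * d f))"
      by (rule derivation_at_add[OF e(1) derivation_at_smult[OF cd]])
    with e d show "e \<in> (\<Union>h\<in>{d. derivation_at X q d \<and> d (coord k) = 0}.
        \<Union>h'\<in>(\<lambda>d f. c * d f) ` {e. derivation_at X q e \<and> e (coord k) = d (coord k)}. {\<lambda>f. h f + h' f})"
      by (intro UN_I[of "\<lambda>f. e f + - 1 * (c * d f)"] UN_I[of "\<lambda>f. c * d f"]) auto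
  qed (auto intro: derivation_at_add derivation_at_smult)
  then show ?thesis
    by (simp add: normal_bundle_def quotient_module_def set_add_def' tangent_add tangent_smult set_eq_iff)
qed

end

section \<open>Logarithmic vector fields and forms\<close>

context divisor_chart
begin

section \<open>Logarithmic fields and their action on the normal bundle\<close>

lemma coord_in_ideal: "openin (topo X) V \<Longrightarrow> V \<subseteq> U \<Longrightarrow> coord k \<in> divisor_ideal X D V"
  unfolding divisor_ideal_def using coord_hol on_D by auto

lemma log_vector_field: "w \<in> log_vector_fields X D V \<Longrightarrow> w \<in> vector_fields X V"
  unfolding log_vector_fields_def by simp

lemma log_vector_field_vanish:
  assumes "w \<in> log_vector_fields X D V" "openin (topo X) W" "W \<subseteq> V" "f \<in> hol X W"
    "\<And>y. y \<in> W \<inter> D \<Longrightarrow> f y = 0" "q \<in> W" "q \<in> D"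
  shows "w q f = 0"
proof -
  have "f \<in> divisor_ideal X D W" using assms unfolding divisor_ideal_def by blast
  then have "(\<lambda>p. w p f) \<in> divisor_ideal X D W"
    using assms(1-3) unfolding log_vector_fields_def by blast
  then show ?thesis using assms(6,7) unfolding divisor_ideal_def by simp
qed

text \<open>As \<open>w\<close> preserves the ideal of \<open>D\<close>, the function w(x) vanishes
  on \<open>D\<close> and is divisible by x. The quotient \<open>a\<close> is the coefficient of
  \<open>w\<close> along x \<partial>.\<close>

lemma log_vector_field_coord:
  assumes w: "w \<in> log_vector_fields X D V" and V: "openin (topo X) V" "q \<in> V" and q: "q \<in> U" "q \<in> D"
  obtains B a where "openin (topo X) B" "q \<in> B" "B \<subseteq> V" "B \<subseteq> U" "a \<in> hol X B"
    "\<forall>y\<in>B. w y (coord k) = coord k y * a y"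
proof -
  define W where "W = V \<inter> U"
  have W: "openin (topo X) W" "q \<in> W" "W \<subseteq> V" "W \<subseteq> U" using V q U_open by (auto simp: W_def)
  have vanish: "w y (coord k) = 0" if "y \<in> W \<inter> D" for y
    by (rule log_vector_field_vanish[OF w W(1,3) coord_hol[OF W(1,4)]]) (use that on_D W in auto)
  obtain B a where B: "openin (topo X) B" "q \<in> B" "B \<subseteq> W" "B \<subseteq> U" "a \<in> hol X B"
    "\<forall>y\<in>B. w y (coord k) = coord k y * a y"
    by (rule divide_by_coord[OF q W(1,2) vector_field_hol[OF log_vector_field[OF w] W(1,3) coord_hol[OF W(1,4)]]])
      (rule vanish)
  show thesis by (rule that[OF B(1,2) order.trans[OF B(3) W(3)] B(4-6)])
qed

text \<open>In [w, v](x) = w(v(x)) - v(w(x)) the first term depends only on v(x) along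
  \<open>D\<close>, because \<open>w\<close> preserves the ideal. At \<open>q\<close> the second is
  v(x a) = a v(x), because x(q) = 0. So the class of the bracket depends only on the normal class of
  \<open>v\<close>.\<close>

lemma bracket_coord_cong:
  assumes w: "w \<in> log_vector_fields X D V" and V: "openin (topo X) V" "q \<in> V" and q: "q \<in> U" "q \<in> D"
    and v: "v \<in> vector_fields X O1" and O1: "openin (topo X) O1" "q \<in> O1"
    and v': "v' \<in> vector_fields X O2" and O2: "openin (topo X) O2" "q \<in> O2"
    and eq: "\<And>y. y \<in> O1 \<inter> O2 \<inter> U \<inter> D \<Longrightarrow> v y (coord k) = v' y (coord k)"
  shows "lie_bracket X w v q (coord k) = lie_bracket X w v' q (coord k)"
proof -
  define W where "W = V \<inter> O1 \<inter> O2 \<inter> U"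
  have W: "openin (topo X) W" "q \<in> W" "W \<subseteq> V" "W \<subseteq> O1" "W \<subseteq> O2" "W \<subseteq> U"
    using V O1 O2 U_open q by (auto simp: W_def)
  have vx: "(\<lambda>y. v y (coord k)) \<in> hol X W" "(\<lambda>y. v' y (coord k)) \<in> hol X W"
    using vector_field_hol[OF v W(1,4) coord_hol[OF W(1,6)]]
      vector_field_hol[OF v' W(1,5) coord_hol[OF W(1,6)]] by blast+
  have dw: "derivation_at X q (w q)"
    using vector_field_derivation[OF log_vector_field[OF w] V(2)] .
  have dv: "derivation_at X q (v q)" "derivation_at X q (v' q)"
    using vector_field_derivation v v' O1 O2 by blast+
  have "w q (\<lambda>y. v y (coord k) - v' y (coord k)) = 0"
    by (rule log_vector_field_vanish[OF w W(1,3) hol_diff[OF W(1) vx]]) (use eq W q in \<open>auto simp: W_def\<close>)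
  then have 1: "w q (\<lambda>y. v y (coord k)) = w q (\<lambda>y. v' y (coord k))"
    using derivation_diff[OF dw] hol_nearI[OF W(1,2)] vx by simp
  obtain B a where B: "openin (topo X) B" "q \<in> B" "B \<subseteq> V" "B \<subseteq> U" "a \<in> hol X B"
    "\<forall>y\<in>B. w y (coord k) = coord k y * a y"
    by (rule log_vector_field_coord[OF w V q])
  have 2: "u (\<lambda>y. w y (coord k)) = a q * u (coord k)" if "derivation_at X q u" for u
  proof -
    have "hol_near X q (\<lambda>y. coord k y * a y)"
      by (intro hol_near_mult coord_near q hol_nearI[OF B(1,2,5)])
    then have "u (\<lambda>y. w y (coord k)) = u (\<lambda>y. coord k y * a y)"
      using derivation_cong[OF that _ B(1,2), of "\<lambda>y. coord k y * a y" "\<lambda>y. w y (coord k)"] B(6) by simp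
    also have "\<dots> = coord k q * u a + a q * u (coord k)"
      by (rule derivation_mult[OF that coord_near[OF q(1)] hol_nearI[OF B(1,2,5)]])
    finally show ?thesis using on_D q by simp
  qed
  show ?thesis
    using 1 2[OF dv(1)] 2[OF dv(2)] eq[of q] q O1 O2 by (simp add: lie_bracket_eq coord_near)
qed

lemma atiyah_of_log_eq:
  assumes w: "w \<in> log_vector_fields X D V" and V: "openin (topo X) V" "q \<in> V" and q: "q \<in> U" "q \<in> D"
    and v: "v \<in> vector_fields X O1" and O1: "openin (topo X) O1" "q \<in> O1"
    and lift: "\<And>y. y \<in> O1 \<inter> D \<Longrightarrow> normal_proj X D y (v y) = \<gamma> y"
  shows "atiyah_of_log X D w \<gamma> q = normal_proj X D q (lie_bracket X w v q)"
  unfolding atiyah_of_log_def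
proof (rule the_equality)
  show "\<exists>U v'. openin (topo X) U \<and> q \<in> U \<and> v' \<in> vector_fields X U \<and>
      (\<forall>q\<in>U \<inter> D. normal_proj X D q (v' q) = \<gamma> q) \<and>
      normal_proj X D q (lie_bracket X w v q) = normal_proj X D q (lie_bracket X w v' q)"
    using v O1 lift by blast
next
  fix z assume "\<exists>U v. openin (topo X) U \<and> q \<in> U \<and> v \<in> vector_fields X U \<and>
        (\<forall>q\<in>U \<inter> D. normal_proj X D q (v q) = \<gamma> q) \<and> z = normal_proj X D q (lie_bracket X w v q)"
  then obtain O2 v' where O2: "openin (topo X) O2" "q \<in> O2" and v': "v' \<in> vector_fields X O2"
    and lift': "\<And>y. y \<in> O2 \<inter> D \<Longrightarrow> normal_proj X D y (v' y) = \<gamma> y"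
    and z: "z = normal_proj X D q (lie_bracket X w v' q)" by blast
  have "v y (coord k) = v' y (coord k)" if "y \<in> O1 \<inter> O2 \<inter> U \<inter> D" for y
    using lift[of y] lift'[of y] that normal_proj_cong[of y "v y" "v' y"]
      vector_field_derivation[OF v, of y] vector_field_derivation[OF v', of y] by simp
  then have "lie_bracket X w v q (coord k) = lie_bracket X w v' q (coord k)"
    by (rule bracket_coord_cong[OF w V q v O1 v' O2])
  moreover have "derivation_at X q (lie_bracket X w u q)" if "u \<in> vector_fields X O'" "openin (topo X) O'" "q \<in> O'" for u O'
    by (rule derivation_lie_bracket[of w "V \<inter> O'"])
      (use vector_fields_subset[OF log_vector_field[OF w]] vector_fields_subset[OF that(1)] that V in auto)
  ultimately show "z = normal_proj X D q (lie_bracket X w v q)"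
    unfolding z using normal_proj_cong[OF q, of "lie_bracket X w v' q" "lie_bracket X w v q"] v v' O1 O2
    by simp
qed

section \<open>Logarithmic forms and the Poincare residue\<close>

lemma two_form_hol:
  "\<gamma> \<in> two_forms X V \<Longrightarrow> openin (topo X) W \<Longrightarrow> W \<subseteq> V \<Longrightarrow> v \<in> vector_fields X W \<Longrightarrow>
    w \<in> vector_fields X W \<Longrightarrow> (\<lambda>p. \<gamma> p (v p) (w p)) \<in> hol X W"
  unfolding two_forms_def by blast

text \<open>Write \<open>x\<close> for the equation of \<open>D\<close>. If \<open>\<beta> = x \<alpha>\<close> and \<open>\<gamma> = x d\<alpha>\<close> are holomorphic, then
  \<open>d\<beta> = dx \<and> \<alpha> + \<gamma>\<close> expresses the coefficients of \<open>\<alpha>\<close> other than that of \<open>dx\<close> without poles.\<close>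

lemma log_form_decomposition:
  assumes \<alpha>: "\<alpha> \<in> log_forms X D V" and V: "openin (topo X) V" "V \<subseteq> U"
  obtains H G where "H \<in> one_forms X V" "G \<in> hol X V"
    "\<And>y d. y \<in> V - D \<Longrightarrow> derivation_at X y d \<Longrightarrow> \<alpha> y d = H y d + G y * (d (coord k) / coord k y)"
proof -
  have \<alpha>1: "\<alpha> \<in> one_forms X (V - D)" using \<alpha> unfolding log_forms_def by blast
  have *: "(\<exists>\<beta>\<in>one_forms X V. \<forall>p\<in>V - D. \<forall>d\<in>carrier (tangent_space X p). \<beta> p d = coord k p * \<alpha> p d) \<and>
        (\<exists>\<gamma>\<in>two_forms X V. \<forall>V' v w. openin (topo X) V' \<and> V' \<subseteq> V - D \<and>
            v \<in> vector_fields X V' \<and> w \<in> vector_fields X V' \<longrightarrow>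
            (\<forall>p\<in>V'. \<gamma> p (v p) (w p) = coord k p * ext_deriv X \<alpha> v w p))"
    using \<alpha> V coord_in_ideal[OF V] unfolding log_forms_def by blast
  obtain \<beta> where \<beta>: "\<beta> \<in> one_forms X V"
    "\<And>y d. y \<in> V - D \<Longrightarrow> derivation_at X y d \<Longrightarrow> \<beta> y d = coord k y * \<alpha> y d"
    using *[THEN conjunct1] unfolding tangent_carrier[symmetric] by blast
  obtain \<gamma> where \<gamma>: "\<gamma> \<in> two_forms X V"
    "\<forall>V' v w. openin (topo X) V' \<and> V' \<subseteq> V - D \<and> v \<in> vector_fields X V' \<and> w \<in> vector_fields X V' \<longrightarrow>
            (\<forall>p\<in>V'. \<gamma> p (v p) (w p) = coord k p * ext_deriv X \<alpha> v w p)"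
    using *[THEN conjunct2] by blast
  define W where "W = V - D"
  have W: "openin (topo X) W" "W \<subseteq> V" "W \<subseteq> U" "W \<subseteq> V - D"
    using open_minus_D[OF V(1)] V(2) by (auto simp: W_def)
  have ef: "coord_field j \<in> vector_fields X V" "coord_field j \<in> vector_fields X W" for j
    using vector_fields_subset[OF coord_field_vector_field] V W by blast+
  define b where "b j y = \<beta> y (coord_field j y)" for j y
  \<comment> \<open>The formula for d\<beta> evaluated on the fields of coordinates \<open>k\<close>
    and \<open>j\<close>: for \<open>j\<close> other than \<open>k\<close> it yields the coefficient
    of \<open>\<alpha>\<close> at \<open>j\<close> off \<open>D\<close>, in terms that are
    holomorphic across \<open>D\<close>.\<close>
  define a where "a j y = coord_field k y (b j) - coord_field j y (b k) - \<gamma> y (coord_field k y) (coord_field j y)" for j y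
  have b_hol: "b j \<in> hol X V" for j
    using one_form_hol[OF \<beta>(1) V(1) order.refl ef(1)] unfolding b_def by simp
  have a_hol: "a j \<in> hol X V" for j
  proof -
    have "(\<lambda>y. coord_field k y (b j) - coord_field j y (b k) - \<gamma> y (coord_field k y) (coord_field j y)) \<in> hol X V"
      by (intro hol_diff V(1) vector_field_hol[OF ef(1) V(1) order.refl b_hol]
          two_form_hol[OF \<gamma>(1) V(1) order.refl ef(1) ef(1)])
    then show ?thesis unfolding a_def by simp
  qed
  have der: "derivation_at X y (coord_field j y)" if "y \<in> W" for j y
    using coord_field_derivation that W by blast
  have b_eq: "b j y = coord k y * \<alpha> y (coord_field j y)" if "y \<in> W" for j y
    using \<beta>(2)[OF _ der[OF that]] that unfolding b_def W_def by blast
  have a_eq: "\<alpha> y (coord_field j y) = a j y" if y: "y \<in> W" and j: "j \<noteq> k" for j y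
  proof -
    define A where "A j y = \<alpha> y (coord_field j y)" for j y
    have yU: "y \<in> U" using y W by blast
    have A: "hol_near X y (A j)" for j
      using one_form_hol[OF \<alpha>1 W(1,4) ef(2), of j] hol_nearI[OF W(1) y] unfolding A_def by simp
    have prod: "e (b j) = coord k y * e (A j) + A j y * e (coord k)" if "derivation_at X y e" for e j
    proof -
      have "e (b j) = e (\<lambda>y. coord k y * A j y)"
        by (rule derivation_cong[OF that _ W(1) y]) (use hol_nearI[OF V(1) _ b_hol] y W b_eq in \<open>auto simp: A_def\<close>)
      also have "\<dots> = coord k y * e (A j) + A j y * e (coord k)"
        by (rule derivation_mult[OF that coord_near[OF yU] A])
      finally show ?thesis .
    qed
    have *: "coord_field i y (b j) = coord k y * coord_field i y (A j) + (if i = k then A j y else 0)" for i j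
      using coord_field_coord[OF yU, of i k] by (subst prod[OF der[OF y]]) simp
    have "\<gamma> y (coord_field k y) (coord_field j y) = coord k y * ext_deriv X \<alpha> (coord_field k) (coord_field j) y"
      using \<gamma>(2) W(1,4) ef(2) y by blast
    \<comment> \<open>Coordinate fields commute, so the bracket term of the exterior derivative
      drops out.\<close>
    also have "ext_deriv X \<alpha> (coord_field k) (coord_field j) y = coord_field k y (A j) - coord_field j y (A k)"
      unfolding ext_deriv_def A_def
      using coord_fields_commute[OF yU] one_form_zero[OF \<alpha>1] y W by (simp add: W_def)
    finally show ?thesis
      unfolding a_def * using j by (simp add: A_def algebra_simps)
  qed
  \<comment> \<open>The index \<open>k\<close> is left out: that coefficient is \<open>b k\<close>
    divided by x and forms the polar part.\<close>
  define H where "H y d = (\<Sum>j\<in>UNIV - {k}. a j y * d (coord j))" for y and d :: "'a tvec"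
  show thesis
  proof
    show "H \<in> one_forms X V"
      using one_forms_sum[of "UNIV - {k}" "\<lambda>j y d. a j y * d (coord j)" V]
        one_forms_scale[OF differential_one_form[OF coord_hol[OF V] V(1)] a_hol V(1)]
      unfolding H_def by simp
    show "b k \<in> hol X V" by (rule b_hol)
    fix y d assume "y \<in> V - D" and d: "derivation_at X y d"
    then have y: "y \<in> W" by (simp add: W_def)
    then have yU: "y \<in> U" and x: "coord k y \<noteq> 0" using W on_D[of y] by (auto simp: W_def)
    \<comment> \<open>Tangent vectors are functionals on all functions, so substituting the
      expansion into \<open>\<alpha>\<close> requires it also for functions that are not holomorphic
      near \<open>y\<close>.\<close>
    have "d f = (\<Sum>j\<in>UNIV. d (coord j) * coord_field j y f)" for f
    proof (cases "hol_near X y f")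
      case True
      then show ?thesis by (rule derivation_expansion[OF d yU])
    next
      case False
      then show ?thesis by (simp add: derivation_zero_off[OF d] coord_field_def)
    qed
    then have "\<alpha> y d = \<alpha> y (\<lambda>f. \<Sum>j\<in>UNIV. d (coord j) * coord_field j y f)"
      by (metis (no_types, lifting) ext)
    also have "\<dots> = (\<Sum>j\<in>UNIV. d (coord j) * \<alpha> y (coord_field j y))"
      by (rule one_form_sum[OF \<alpha>1]) (use y der W in auto)
    also have "\<dots> = d (coord k) * \<alpha> y (coord_field k y) + (\<Sum>j\<in>UNIV - {k}. d (coord j) * \<alpha> y (coord_field j y))"
      by (subst sum.remove[of UNIV k]) auto
    also have "(\<Sum>j\<in>UNIV - {k}. d (coord j) * \<alpha> y (coord_field j y)) = H y d"
      unfolding H_def by (rule sum.cong) (use a_eq[OF y] in auto)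
    finally show "\<alpha> y d = H y d + b k y * (d (coord k) / coord k y)"
      using b_eq[OF y, of k] x by simp
  qed
qed

text \<open>Two equations of \<open>D\<close> differ by a unit, x' = u x, so dx'/x' is dx/x plus the
  pole-free form du/u. Contracting both decompositions with the coordinate field of x and clearing
  denominators gives holomorphic functions that agree off \<open>D\<close>; their values at
  \<open>q\<close> give u G = u G'.\<close>

lemma poincare_residue_eq:
  assumes V: "openin (topo X) V" "V \<subseteq> U" and q: "q \<in> V" "q \<in> D"
    and H: "H \<in> one_forms X V" and G: "G \<in> hol X V"
    and \<alpha>: "\<And>y d. y \<in> V - D \<Longrightarrow> derivation_at X y d \<Longrightarrow> \<alpha> y d = H y d + G y * (d (coord k) / coord k y)"
  shows "poincare_residue n X D \<alpha> q = G q"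
  unfolding poincare_residue_def
proof (rule the_equality)
  have "(\<lambda>y. \<phi> y $ k) = coord k" by (simp add: coord_def fun_eq_iff)
  then have "\<forall>y\<in>V - D. \<forall>d\<in>carrier (tangent_space X y).
      \<alpha> y d = H y d + G y * (d (\<lambda>y. \<phi> y $ k) / \<phi> y $ k)"
    using \<alpha> by (simp add: carrier_tangent coord_def)
  then show "\<exists>U (\<phi> :: 'a \<Rightarrow> complex ^ 'n) k \<alpha>\<^sub>h \<alpha>\<^sub>0.
        q \<in> U \<and> adapted_chart X D U \<phi> k \<and> \<alpha>\<^sub>h \<in> one_forms X U \<and> \<alpha>\<^sub>0 \<in> hol X U \<and>
        (\<forall>q\<in>U - D. \<forall>d\<in>carrier (tangent_space X q).
           \<alpha> q d = \<alpha>\<^sub>h q d + \<alpha>\<^sub>0 q * (d (\<lambda>y. \<phi> y $ k) / \<phi> q $ k)) \<and> G q = \<alpha>\<^sub>0 q"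
    using q adapted_chart_subset[OF V] H G by blast
next
  fix c assume "\<exists>U (\<phi> :: 'a \<Rightarrow> complex ^ 'n) k \<alpha>\<^sub>h \<alpha>\<^sub>0.
        q \<in> U \<and> adapted_chart X D U \<phi> k \<and> \<alpha>\<^sub>h \<in> one_forms X U \<and> \<alpha>\<^sub>0 \<in> hol X U \<and>
        (\<forall>q\<in>U - D. \<forall>d\<in>carrier (tangent_space X q).
           \<alpha> q d = \<alpha>\<^sub>h q d + \<alpha>\<^sub>0 q * (d (\<lambda>y. \<phi> y $ k) / \<phi> q $ k)) \<and> c = \<alpha>\<^sub>0 q"
  then obtain U' and \<phi>' :: "'a \<Rightarrow> complex ^ 'n" and k' H' G' where
    q': "q \<in> U'" and ad: "adapted_chart X D U' \<phi>' k'" and H': "H' \<in> one_forms X U'" and G': "G' \<in> hol X U'"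
    and \<alpha>': "\<forall>q\<in>U' - D. \<forall>d\<in>carrier (tangent_space X q). \<alpha> q d = H' q d + G' q * (d (\<lambda>y. \<phi>' y $ k') / \<phi>' q $ k')"
    and c: "c = G' q" by blast
  interpret other: divisor_chart X n U' \<phi>' D k'
    by unfold_locales (use ad D_closed in \<open>auto simp: adapted_chart_def\<close>)
  have other_eq: "(\<lambda>y. \<phi>' y $ k') = other.coord k'" by (simp add: other.coord_def fun_eq_iff)
  have qU: "q \<in> U" using V q by blast
  \<comment> \<open>Division in both charts: x' = u x, and below x = u' x'.\<close>
  obtain B u where B: "openin (topo X) B" "q \<in> B" "B \<subseteq> U'" "B \<subseteq> U" "u \<in> hol X B"
    "\<forall>y\<in>B. other.coord k' y = coord k y * u y"
    by (rule divide_by_coord[OF qU q(2) other.U_open q' other.coord_hol[OF other.U_open order.refl, of k']])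
      (use other.on_D in auto)
  obtain B' u' where B': "openin (topo X) B'" "q \<in> B'" "B' \<subseteq> U" "B' \<subseteq> U'" "u' \<in> hol X B'"
    "\<forall>y\<in>B'. coord k y = other.coord k' y * u' y"
    by (rule other.divide_by_coord[OF q' q(2) U_open qU coord_hol[OF U_open order.refl, of k]])
      (use on_D in auto)
  define W where "W = V \<inter> B \<inter> B'"
  have W: "openin (topo X) W" "q \<in> W" "W \<subseteq> V" "W \<subseteq> B" "W \<subseteq> B'" "W \<subseteq> U" "W \<subseteq> U'"
    using V B B' q by (auto simp: W_def)
  have hols: "u \<in> hol X W" "u' \<in> hol X W" "G \<in> hol X W" "G' \<in> hol X W" "coord k \<in> hol X W"
    by (rule hol_subset[OF B(5,1) W(1,4)], rule hol_subset[OF B'(5,1) W(1,5)],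
        rule hol_subset[OF G V(1) W(1,3)], rule hol_subset[OF G' other.U_open W(1,7)],
        rule coord_hol[OF W(1,6)])
  have e: "coord_field k \<in> vector_fields X W"
    using vector_fields_subset[OF coord_field_vector_field W(6)] .
  have nz: "coord k y \<noteq> 0" "other.coord k' y \<noteq> 0" if "y \<in> W - D" for y
    using that on_D[of y] other.on_D[of y] W by auto
  \<comment> \<open>Off \<open>D\<close> one may cancel x in x = x u u'; the identity then extends
    to \<open>q\<close>, so \<open>u\<close> is a unit there.\<close>
  have "u q * u' q = 1"
  proof (rule hol_eq_at_D[OF W(1,2) qU hol_mult[OF W(1) hols(1,2)] hol_const[OF W(1)]])
    fix y assume y: "y \<in> W - D"
    have yB: "y \<in> B" "y \<in> B'" using y W by auto
    have "coord k y = coord k y * (u y * u' y)"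
      using B(6)[rule_format, OF yB(1)] B'(6)[rule_format, OF yB(2)] by (metis mult.assoc)
    then show "u y * u' y = 1" using nz(1)[OF y] by simp
  qed
  then have u0: "u q \<noteq> 0" by auto
  \<comment> \<open>Both expressions for \<open>\<alpha>\<close> on the coordinate field of x,
    multiplied by x u.\<close>
  have "(\<lambda>y. coord k y * u y * H y (coord_field k y) + u y * G y) q =
      (\<lambda>y. coord k y * u y * H' y (coord_field k y) + G' y * (u y + coord k y * coord_field k y u)) q"
  proof (rule hol_eq_at_D[OF W(1,2) qU])
    show "(\<lambda>y. coord k y * u y * H y (coord_field k y) + u y * G y) \<in> hol X W"
      by (intro hol_add hol_mult W(1) hols one_form_hol[OF H W(1,3) e])
    show "(\<lambda>y. coord k y * u y * H' y (coord_field k y) + G' y * (u y + coord k y * coord_field k y u)) \<in> hol X W"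
      by (intro hol_add hol_mult W(1) hols one_form_hol[OF H' W(1,7) e]
          vector_field_hol[OF e W(1) order.refl hols(1)])
    fix y assume y: "y \<in> W - D"
    have yW: "y \<in> W" and yU: "y \<in> U" and yV: "y \<in> V - D" and yU': "y \<in> U' - D" using y W by auto
    have d: "derivation_at X y (coord_field k y)" by (rule coord_field_derivation[OF yU])
    have "hol_near X y u" by (rule hol_nearI[OF W(1) yW hols(1)])
    then have "coord_field k y (\<lambda>y. coord k y * u y) = coord k y * coord_field k y u + u y"
      using derivation_mult[OF d coord_near[OF yU]] coord_field_coord[OF yU] by simp
    moreover have "coord_field k y (other.coord k') = coord_field k y (\<lambda>y. coord k y * u y)"
      by (rule derivation_cong[OF d other.coord_near W(1) yW]) (use B(6) W y in auto)
    ultimately have e_other: "coord_field k y (other.coord k') = coord k y * coord_field k y u + u y" by simp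
    have "H y (coord_field k y) + G y / coord k y = \<alpha> y (coord_field k y)"
      using \<alpha>[OF yV d] coord_field_coord[OF yU] by simp
    also have "\<dots> = H' y (coord_field k y) + G' y * (coord_field k y (other.coord k') / other.coord k' y)"
      using \<alpha>' yU' d unfolding other_eq carrier_tangent by (simp add: other.coord_def)
    also have "other.coord k' y = coord k y * u y" using B(6) W yW by auto
    finally have eq: "H y (coord_field k y) + G y / coord k y = H' y (coord_field k y) +
        G' y * ((coord k y * coord_field k y u + u y) / (coord k y * u y))"
      unfolding e_other .
    have "coord k y \<noteq> 0" "u y \<noteq> 0" using nz[OF y] B(6) W yW by auto
    with arg_cong[OF eq, of "\<lambda>t. coord k y * u y * t"]
    show "coord k y * u y * H y (coord_field k y) + u y * G y =
        coord k y * u y * H' y (coord_field k y) + G' y * (u y + coord k y * coord_field k y u)"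
      by (simp add: algebra_simps add_divide_distrib)
  qed
  moreover have "coord k q = 0" using on_D[OF qU] q by simp
  ultimately show "c = G q" using u0 c by simp
qed

end

section \<open>Logarithmic connections in a frame\<close>

context cmanifold
begin

lemma log_forms_subset: "\<alpha> \<in> log_forms X D U \<Longrightarrow> V \<subseteq> U \<Longrightarrow> \<alpha> \<in> log_forms X D V"
proof -
  assume \<alpha>: "\<alpha> \<in> log_forms X D U" and V: "V \<subseteq> U"
  have "\<alpha> \<in> one_forms X (V - D)"
    by (rule one_forms_subset[of _ "U - D"]) (use \<alpha> V in \<open>auto simp: log_forms_def\<close>)
  then show ?thesis
    using \<alpha> V order.trans[of _ V U] unfolding log_forms_def by simp
qed

end

locale connection_chart = divisor_chart X n U \<phi> D k
  for X :: "'a cspace" and n :: "'n::finite itself" and U :: "'a set" and \<phi> :: "'a \<Rightarrow> complex ^ 'n"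
    and D :: "'a set" and k :: 'n +
  fixes E :: "('a, 'v) vbundle" and nabla :: "('a \<Rightarrow> 'v) \<Rightarrow> 'a \<Rightarrow> 'a tvec \<Rightarrow> 'v"
    and r :: nat and e :: "nat \<Rightarrow> 'a \<Rightarrow> 'v"
  assumes is_bundle: "vector_bundle X E"
    and connection: "log_connection X D E nabla"
    and frame_bij: "q \<in> U \<Longrightarrow> bij_betw (\<lambda>c. \<Oplus>\<^bsub>fib E q\<^esub>i\<in>{..<r}. c i \<odot>\<^bsub>fib E q\<^esub> e i q)
                  ({..<r} \<rightarrow>\<^sub>E UNIV) (carrier (fib E q))"
    and frame_sec: "i < r \<Longrightarrow> e i \<in> sec E U"
    and frame_iff: "openin (topo X) V \<Longrightarrow> V \<subseteq> U \<Longrightarrow> s \<in> sec E V \<longleftrightarrow>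
              (\<exists>f. (\<forall>i<r. f i \<in> hol X V) \<and>
                   (\<forall>q\<in>V. s q = (\<Oplus>\<^bsub>fib E q\<^esub>i\<in>{..<r}. f i q \<odot>\<^bsub>fib E q\<^esub> e i q)))"
begin

section \<open>Linear algebra of the fibres in a frame\<close>

definition comb :: "'a \<Rightarrow> (nat \<Rightarrow> complex) \<Rightarrow> 'v" where
  "comb q c = (\<Oplus>\<^bsub>fib E q\<^esub>i\<in>{..<r}. c i \<odot>\<^bsub>fib E q\<^esub> e i q)"

lemma fib_module: "q \<in> U \<Longrightarrow> module complex_field (fib E q)"
  using is_bundle[unfolded vector_bundle_def, THEN conjunct1, rule_format, OF U_topspace] .

lemma complex_field_simps [simp]:
  "c \<in> carrier complex_field" "c \<oplus>\<^bsub>complex_field\<^esub> d = c + d" "c \<otimes>\<^bsub>complex_field\<^esub> d = c * d"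
  "\<zero>\<^bsub>complex_field\<^esub> = 0" "\<one>\<^bsub>complex_field\<^esub> = 1"
  by (simp_all add: complex_field_def)

lemma sec_sheaf: "function_sheaf (topo X) (sec E)"
  using is_bundle[unfolded vector_bundle_def, THEN conjunct2, THEN conjunct2, THEN conjunct1] .

lemma sec_subset: "s \<in> sec E V \<Longrightarrow> openin (topo X) V \<Longrightarrow> openin (topo X) W \<Longrightarrow> W \<subseteq> V \<Longrightarrow> s \<in> sec E W"
  using sec_sheaf[unfolded function_sheaf_def, THEN conjunct2, THEN conjunct1, rule_format, of V W s]
  by blast

lemma e_carrier: "q \<in> U \<Longrightarrow> i < r \<Longrightarrow> e i q \<in> carrier (fib E q)"
  using is_bundle[unfolded vector_bundle_def, THEN conjunct2, THEN conjunct1, rule_format, of U "e i" q]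
    frame_sec U_open by simp

lemma sec_iff:
  "openin (topo X) V \<Longrightarrow> V \<subseteq> U \<Longrightarrow> s \<in> sec E V \<longleftrightarrow>
    (\<exists>f. (\<forall>i<r. f i \<in> hol X V) \<and> (\<forall>q\<in>V. s q = comb q (\<lambda>i. f i q)))"
  unfolding comb_def by (rule frame_iff)

lemma comb_carrier: "q \<in> U \<Longrightarrow> comb q c \<in> carrier (fib E q)"
proof -
  assume q: "q \<in> U"
  interpret M: module complex_field "fib E q" by (rule fib_module[OF q])
  show ?thesis unfolding comb_def using e_carrier[OF q] by (intro M.finsum_closed) auto
qed

lemma comb_cong: "q \<in> U \<Longrightarrow> (\<And>i. i < r \<Longrightarrow> c i = c' i) \<Longrightarrow> comb q c = comb q c'"
proof -
  assume q: "q \<in> U" and c: "\<And>i. i < r \<Longrightarrow> c i = c' i"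
  interpret M: module complex_field "fib E q" by (rule fib_module[OF q])
  show ?thesis unfolding comb_def using e_carrier[OF q] c by (intro M.finsum_cong') auto
qed

lemma comb_bij: "q \<in> U \<Longrightarrow> bij_betw (comb q) ({..<r} \<rightarrow>\<^sub>E UNIV) (carrier (fib E q))"
  using frame_bij unfolding comb_def[abs_def] .

lemma comb_eq_iff:
  assumes q: "q \<in> U"
  shows "comb q c = comb q c' \<longleftrightarrow> (\<forall>i<r. c i = c' i)"
proof
  assume eq: "comb q c = comb q c'"
  \<comment> \<open>The frame is a bijection only on families extensional on \<open>{..<r}\<close>,
    so arbitrary coefficients are first restricted.\<close>
  have eq': "comb q (restrict c {..<r}) = comb q (restrict c' {..<r})"
    using eq comb_cong[OF q, of "restrict c {..<r}" c] comb_cong[OF q, of "restrict c' {..<r}" c'] by simp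
  have "restrict c {..<r} = restrict c' {..<r}"
    using inj_on_eq_iff[OF bij_betw_imp_inj_on[OF comb_bij[OF q]],
        of "restrict c {..<r}" "restrict c' {..<r}"] eq' by simp
  then show "\<forall>i<r. c i = c' i" by (metis lessThan_iff restrict_apply')
qed (use comb_cong[OF q] in blast)

lemma comb_add:
  assumes q: "q \<in> U"
  shows "comb q c \<oplus>\<^bsub>fib E q\<^esub> comb q c' = comb q (\<lambda>i. c i + c' i)"
proof -
  interpret M: module complex_field "fib E q" by (rule fib_module[OF q])
  have "comb q (\<lambda>i. c i + c' i) =
      (\<Oplus>\<^bsub>fib E q\<^esub>i\<in>{..<r}. c i \<odot>\<^bsub>fib E q\<^esub> e i q \<oplus>\<^bsub>fib E q\<^esub> c' i \<odot>\<^bsub>fib E q\<^esub> e i q)"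
    unfolding comb_def using e_carrier[OF q] M.smult_l_distr by (intro M.finsum_cong') auto
  also have "\<dots> = comb q c \<oplus>\<^bsub>fib E q\<^esub> comb q c'"
    unfolding comb_def using e_carrier[OF q] by (intro M.finsum_addf) auto
  finally show ?thesis by simp
qed

lemma comb_smult:
  assumes q: "q \<in> U"
  shows "a \<odot>\<^bsub>fib E q\<^esub> comb q c = comb q (\<lambda>i. a * c i)"
proof -
  interpret M: module complex_field "fib E q" by (rule fib_module[OF q])
  have "a \<odot>\<^bsub>fib E q\<^esub> comb q c = (\<Oplus>\<^bsub>fib E q\<^esub>i\<in>{..<r}. a \<odot>\<^bsub>fib E q\<^esub> (c i \<odot>\<^bsub>fib E q\<^esub> e i q))"
    unfolding comb_def using e_carrier[OF q] by (intro M.finsum_smult_ldistr) auto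
  also have "\<dots> = comb q (\<lambda>i. a * c i)"
    unfolding comb_def using e_carrier[OF q] M.smult_assoc1[symmetric] by (intro M.finsum_cong') auto
  finally show ?thesis .
qed

lemma comb_zero: "q \<in> U \<Longrightarrow> comb q (\<lambda>_. 0) = \<zero>\<^bsub>fib E q\<^esub>"
proof -
  assume q: "q \<in> U"
  interpret M: module complex_field "fib E q" by (rule fib_module[OF q])
  have "0 \<odot>\<^bsub>fib E q\<^esub> comb q (\<lambda>_. 0) = \<zero>\<^bsub>fib E q\<^esub>"
    using M.smult_l_null[OF comb_carrier[OF q]] by simp
  then show ?thesis by (simp add: comb_smult[OF q])
qed

lemma comb_minus: "q \<in> U \<Longrightarrow> \<ominus>\<^bsub>fib E q\<^esub> comb q c = comb q (\<lambda>i. - c i)"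
proof -
  assume q: "q \<in> U"
  interpret M: module complex_field "fib E q" by (rule fib_module[OF q])
  show ?thesis
    by (rule M.minus_equality) (simp_all add: comb_carrier[OF q] comb_add[OF q] comb_zero[OF q])
qed

lemma comb_sum:
  assumes q: "q \<in> U"
  shows "(\<Oplus>\<^bsub>fib E q\<^esub>j\<in>{..<m::nat}. a j \<odot>\<^bsub>fib E q\<^esub> comb q (c j)) = comb q (\<lambda>i. \<Sum>j<m. a j * c j i)"
proof (induction m)
  interpret M: module complex_field "fib E q" by (rule fib_module[OF q])
  case 0
  show ?case by (simp add: comb_zero[OF q])
next
  interpret M: module complex_field "fib E q" by (rule fib_module[OF q])
  case (Suc m)
  have "(\<Oplus>\<^bsub>fib E q\<^esub>j\<in>{..<Suc m}. a j \<odot>\<^bsub>fib E q\<^esub> comb q (c j)) =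
      a m \<odot>\<^bsub>fib E q\<^esub> comb q (c m) \<oplus>\<^bsub>fib E q\<^esub> (\<Oplus>\<^bsub>fib E q\<^esub>j\<in>{..<m}. a j \<odot>\<^bsub>fib E q\<^esub> comb q (c j))"
    unfolding lessThan_Suc using comb_carrier[OF q]
    by (intro M.finsum_insert) auto
  then show ?case
    unfolding Suc.IH by (simp add: comb_smult[OF q] comb_add[OF q] add.commute)
qed

lemma comb_frame: "q \<in> U \<Longrightarrow> i < r \<Longrightarrow> comb q (\<lambda>l. if l = i then 1 else 0) = e i q"
proof -
  assume q: "q \<in> U" and i: "i < r"
  interpret M: module complex_field "fib E q" by (rule fib_module[OF q])
  have "comb q (\<lambda>l. if l = i then 1 else 0) =
      (\<Oplus>\<^bsub>fib E q\<^esub>l\<in>{..<r}. if i = l then e l q else \<zero>\<^bsub>fib E q\<^esub>)"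
    unfolding comb_def
    using e_carrier[OF q] M.smult_l_null M.smult_one by (intro M.finsum_cong') auto
  also have "\<dots> = e i q"
    using i e_carrier[OF q] by (intro M.add.finprod_singleton) auto
  finally show ?thesis .
qed

text \<open>The coefficients of a bundle-valued form in the frame are \<open>H\<^sub>i + G\<^sub>i dx / x\<close>, with \<open>x\<close> the
  equation of \<open>D\<close>.\<close>

definition polar_decomp ::
    "'a set \<Rightarrow> ('a \<Rightarrow> 'a tvec \<Rightarrow> 'v) \<Rightarrow> (nat \<Rightarrow> 'a \<Rightarrow> 'a tvec \<Rightarrow> complex) \<Rightarrow> (nat \<Rightarrow> 'a \<Rightarrow> complex) \<Rightarrow> bool" where
  "polar_decomp V \<omega> H G \<longleftrightarrow> openin (topo X) V \<and> V \<subseteq> U \<and>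
     (\<forall>i<r. H i \<in> one_forms X V \<and> G i \<in> hol X V) \<and>
     (\<forall>y\<in>V - D. \<forall>d. derivation_at X y d \<longrightarrow>
        \<omega> y d = comb y (\<lambda>i. H i y d + G i y * (d (coord k) / coord k y)))"

lemma polar_decompD:
  assumes "polar_decomp V \<omega> H G"
  shows "openin (topo X) V" "V \<subseteq> U" "\<And>i. i < r \<Longrightarrow> H i \<in> one_forms X V" "\<And>i. i < r \<Longrightarrow> G i \<in> hol X V"
    "\<And>y d. y \<in> V - D \<Longrightarrow> derivation_at X y d \<Longrightarrow>
      \<omega> y d = comb y (\<lambda>i. H i y d + G i y * (d (coord k) / coord k y))"
  using assms unfolding polar_decomp_def by auto

lemma polar_decomp_subset:
  assumes "polar_decomp V \<omega> H G" "openin (topo X) W" "W \<subseteq> V"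
  shows "polar_decomp W \<omega> H G"
  unfolding polar_decomp_def
proof (intro conjI allI impI ballI)
  note V = polar_decompD[OF assms(1)]
  show "W \<subseteq> U" using V(2) assms(3) by blast
  fix i assume "i < r"
  then show "H i \<in> one_forms X W" "G i \<in> hol X W"
    using one_forms_subset[OF V(3) assms(3)] hol_subset[OF V(4) V(1) assms(2,3)] by blast+
next
  fix y d assume "y \<in> W - D" "derivation_at X y d"
  then show "\<omega> y d = comb y (\<lambda>i. H i y d + G i y * (d (coord k) / coord k y))"
    using polar_decompD(5)[OF assms(1)] assms(3) by blast
qed (rule assms(2))

text \<open>Evaluated on the coordinate field of x and multiplied by x, both decompositions give x H
  + G, which is holomorphic and reduces to G on \<open>D\<close>.\<close>

lemma polar_decomp_unique:
  assumes P: "polar_decomp V \<omega> H G" and P': "polar_decomp V' \<omega> H' G'"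
    and q: "q \<in> V" "q \<in> V'" and i: "i < r"
    and qD: "q \<in> D"
  shows "G i q = G' i q"
proof -
  define W where "W = V \<inter> V'"
  note V = polar_decompD[OF P] and V' = polar_decompD[OF P']
  have W: "openin (topo X) W" "q \<in> W" "W \<subseteq> V" "W \<subseteq> V'" "W \<subseteq> U"
    using V(1,2) V'(1,2) q by (auto simp: W_def)
  have qU: "q \<in> U" using W by blast
  have ek: "coord_field k \<in> vector_fields X W"
    by (rule vector_fields_subset[OF coord_field_vector_field W(5)])
  note x = coord_hol[OF W(1,5), of k]
  have "(\<lambda>y. coord k y * H i y (coord_field k y) + G i y) q =
      (\<lambda>y. coord k y * H' i y (coord_field k y) + G' i y) q"
  proof (rule hol_eq_at_D[OF W(1,2) qU])
    show "(\<lambda>y. coord k y * H i y (coord_field k y) + G i y) \<in> hol X W"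
      by (intro hol_add hol_mult W(1) x one_form_hol[OF V(3)[OF i] W(1,3) ek] hol_subset[OF V(4)[OF i] V(1) W(1,3)])
    show "(\<lambda>y. coord k y * H' i y (coord_field k y) + G' i y) \<in> hol X W"
      by (intro hol_add hol_mult W(1) x one_form_hol[OF V'(3)[OF i] W(1,4) ek] hol_subset[OF V'(4)[OF i] V'(1) W(1,4)])
    fix y assume y: "y \<in> W - D"
    then have yU: "y \<in> U" and y1: "y \<in> V - D" and y2: "y \<in> V' - D" using W by auto
    have d: "derivation_at X y (coord_field k y)" by (rule coord_field_derivation[OF yU])
    have x0: "coord k y \<noteq> 0" using on_D[OF yU] y by auto
    have "H i y (coord_field k y) + G i y * (1 / coord k y) = H' i y (coord_field k y) + G' i y * (1 / coord k y)"
      using V(5)[OF y1 d] V'(5)[OF y2 d] comb_eq_iff[OF yU] i coord_field_coord[OF yU] by simp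
    then show "coord k y * H i y (coord_field k y) + G i y = coord k y * H' i y (coord_field k y) + G' i y"
      using x0 by (simp add: field_simps)
  qed
  then show ?thesis using on_D[OF qU] qD by simp
qed

lemma tensor_sum_subset:
  "is_tensor_sum X D E V \<omega> m s \<alpha> \<Longrightarrow> openin (topo X) V \<Longrightarrow> openin (topo X) W \<Longrightarrow> W \<subseteq> V \<Longrightarrow>
    is_tensor_sum X D E W \<omega> m s \<alpha>"
  unfolding is_tensor_sum_def using sec_subset log_forms_subset by blast

text \<open>Each logarithmic form splits into a holomorphic and a polar part, each section expands
  in the frame, and the products are collected. The second claim identifies the tensor formula for
  the residue with the polar coefficients.\<close>

lemma tensor_sum_polar_decomp:
  assumes T: "is_tensor_sum X D E V \<omega> m s \<alpha>" and V: "openin (topo X) V" "V \<subseteq> U"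
  obtains H G where "polar_decomp V \<omega> H G"
    "\<forall>y\<in>V \<inter> D. (\<Oplus>\<^bsub>fib E y\<^esub>j\<in>{..<m}. poincare_residue n X D (\<alpha> j) y \<odot>\<^bsub>fib E y\<^esub> s j y) = comb y (\<lambda>i. G i y)"
proof -
  have "\<exists>f. (\<forall>i<r. f i \<in> hol X V) \<and> (\<forall>q\<in>V. s j q = comb q (\<lambda>i. f i q))" if "j < m" for j
    using T that sec_iff[OF V] unfolding is_tensor_sum_def by blast
  then obtain f where f: "\<And>j i. j < m \<Longrightarrow> i < r \<Longrightarrow> f j i \<in> hol X V"
    "\<And>j q. j < m \<Longrightarrow> q \<in> V \<Longrightarrow> s j q = comb q (\<lambda>i. f j i q)" by metis
  have "\<exists>H G. H \<in> one_forms X V \<and> G \<in> hol X V \<and> (\<forall>y\<in>V - D. \<forall>d. derivation_at X y d \<longrightarrow>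
      \<alpha> j y d = H y d + G y * (d (coord k) / coord k y))" if "j < m" for j
  proof -
    have \<alpha>: "\<alpha> j \<in> log_forms X D V" using T that unfolding is_tensor_sum_def by blast
    show ?thesis by (rule log_form_decomposition[OF \<alpha> V]) blast
  qed
  then obtain H G where H: "\<And>j. j < m \<Longrightarrow> H j \<in> one_forms X V" and G: "\<And>j. j < m \<Longrightarrow> G j \<in> hol X V"
    and \<alpha>: "\<And>j y d. j < m \<Longrightarrow> y \<in> V - D \<Longrightarrow> derivation_at X y d \<Longrightarrow>
      \<alpha> j y d = H j y d + G j y * (d (coord k) / coord k y)" by metis
  define H' where "H' i y d = (\<Sum>j<m. f j i y * H j y d)" for i y d
  define G' where "G' i y = (\<Sum>j<m. f j i y * G j y)" for i y
  show thesis
  proof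
    show "polar_decomp V \<omega> H' G'"
      unfolding polar_decomp_def
    proof (intro conjI allI impI ballI V)
      fix i assume i: "i < r"
      show "H' i \<in> one_forms X V"
        using one_forms_sum[of "{..<m}" "\<lambda>j y d. f j i y * H j y d"] one_forms_scale[OF H f(1)[OF _ i] V(1)]
        unfolding H'_def by simp
      show "G' i \<in> hol X V"
        using hol_sum[OF V(1), of "{..<m}" "\<lambda>j y. f j i y * G j y"] hol_mult[OF V(1) f(1)[OF _ i] G]
        unfolding G'_def by simp
    next
      fix y d assume y: "y \<in> V - D" and d: "derivation_at X y d"
      have yU: "y \<in> U" using y V by blast
      interpret M: module complex_field "fib E y" by (rule fib_module[OF yU])
      have "\<omega> y d = (\<Oplus>\<^bsub>fib E y\<^esub>j\<in>{..<m}. \<alpha> j y d \<odot>\<^bsub>fib E y\<^esub> s j y)"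
        using T y d unfolding is_tensor_sum_def carrier_tangent by blast
      also have "\<dots> = (\<Oplus>\<^bsub>fib E y\<^esub>j\<in>{..<m}. \<alpha> j y d \<odot>\<^bsub>fib E y\<^esub> comb y (\<lambda>i. f j i y))"
        using comb_carrier[OF yU] f(2) y by (intro M.finsum_cong') auto
      also have "\<dots> = comb y (\<lambda>i. \<Sum>j<m. \<alpha> j y d * f j i y)"
        by (rule comb_sum[OF yU])
      also have "(\<lambda>i. \<Sum>j<m. \<alpha> j y d * f j i y) = (\<lambda>i. H' i y d + G' i y * (d (coord k) / coord k y))"
      proof
        fix i
        have "(\<Sum>j<m. \<alpha> j y d * f j i y) =
            (\<Sum>j<m. f j i y * H j y d + f j i y * G j y * (d (coord k) / coord k y))"
          by (rule sum.cong) (simp_all add: \<alpha>[OF _ y d] algebra_simps)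
        then show "(\<Sum>j<m. \<alpha> j y d * f j i y) = H' i y d + G' i y * (d (coord k) / coord k y)"
          unfolding H'_def G'_def by (simp only: sum.distrib sum_distrib_right)
      qed
      finally show "\<omega> y d = comb y (\<lambda>i. H' i y d + G' i y * (d (coord k) / coord k y))" .
    qed
    show "\<forall>y\<in>V \<inter> D. (\<Oplus>\<^bsub>fib E y\<^esub>j\<in>{..<m}. poincare_residue n X D (\<alpha> j) y \<odot>\<^bsub>fib E y\<^esub> s j y) = comb y (\<lambda>i. G' i y)"
    proof
      fix y assume y: "y \<in> V \<inter> D"
      have yU: "y \<in> U" using y V by blast
      interpret M: module complex_field "fib E y" by (rule fib_module[OF yU])
      have "poincare_residue n X D (\<alpha> j) y = G j y" if "j < m" for j
        by (rule poincare_residue_eq[OF V _ _ H[OF that] G[OF that] \<alpha>[OF that]]) (use y in auto)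
      then have "(\<Oplus>\<^bsub>fib E y\<^esub>j\<in>{..<m}. poincare_residue n X D (\<alpha> j) y \<odot>\<^bsub>fib E y\<^esub> s j y) =
          (\<Oplus>\<^bsub>fib E y\<^esub>j\<in>{..<m}. G j y \<odot>\<^bsub>fib E y\<^esub> comb y (\<lambda>i. f j i y))"
        using comb_carrier[OF yU] f(2) y by (intro M.finsum_cong') auto
      also have "\<dots> = comb y (\<lambda>i. \<Sum>j<m. G j y * f j i y)"
        by (rule comb_sum[OF yU])
      finally show "(\<Oplus>\<^bsub>fib E y\<^esub>j\<in>{..<m}. poincare_residue n X D (\<alpha> j) y \<odot>\<^bsub>fib E y\<^esub> s j y) = comb y (\<lambda>i. G' i y)"
        by (simp add: G'_def mult.commute)
    qed
  qed
qed

text \<open>Any two tensor representations give polar decompositions of the same form, and these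
  have the same polar coefficients at \<open>q\<close>; membership in
  \<open>bundle_log_forms\<close> provides one representation.\<close>

lemma bundle_residue_eq:
  assumes P: "polar_decomp V \<omega> H G" and q: "q \<in> V" "q \<in> D"
    and \<omega>: "\<omega> \<in> bundle_log_forms X D E W" "q \<in> W"
  shows "bundle_residue n X D E \<omega> q = comb q (\<lambda>i. G i q)"
  unfolding bundle_residue_def
proof (rule the_equality)
  have qU: "q \<in> U" using polar_decompD(2)[OF P] q by blast
  have key: "(\<Oplus>\<^bsub>fib E q\<^esub>j\<in>{..<m}. poincare_residue n X D (\<alpha> j) q \<odot>\<^bsub>fib E q\<^esub> s j q) = comb q (\<lambda>i. G i q)"
    if V': "openin (topo X) V'" "q \<in> V'" and T: "is_tensor_sum X D E V' \<omega> m s \<alpha>" for V' m s \<alpha>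
  proof -
    have V'': "openin (topo X) (V' \<inter> U)" "V' \<inter> U \<subseteq> U" using V' U_open by auto
    obtain H' G' where *: "polar_decomp (V' \<inter> U) \<omega> H' G'"
      "\<forall>y\<in>V' \<inter> U \<inter> D. (\<Oplus>\<^bsub>fib E y\<^esub>j\<in>{..<m}. poincare_residue n X D (\<alpha> j) y \<odot>\<^bsub>fib E y\<^esub> s j y) = comb y (\<lambda>i. G' i y)"
      by (rule tensor_sum_polar_decomp[OF tensor_sum_subset[OF T V'(1) V''(1) Int_lower1] V''])
    have "comb q (\<lambda>i. G' i q) = comb q (\<lambda>i. G i q)"
      by (rule comb_cong[OF qU]) (rule polar_decomp_unique[OF *(1) P], use V' qU q in auto)
    then show ?thesis using *(2) V' qU q by simp
  qed
  show "\<exists>U m s \<alpha>. openin (topo X) U \<and> q \<in> U \<and> is_tensor_sum X D E U \<omega> m s \<alpha> \<and>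
      comb q (\<lambda>i. G i q) = (\<Oplus>\<^bsub>fib E q\<^esub>j\<in>{..<m}. poincare_residue n X D (\<alpha> j) q \<odot>\<^bsub>fib E q\<^esub> s j q)"
    using \<omega> key unfolding bundle_log_forms_def by (smt (verit, best) mem_Collect_eq)
  show "z = comb q (\<lambda>i. G i q)" if "\<exists>U m s \<alpha>. openin (topo X) U \<and> q \<in> U \<and> is_tensor_sum X D E U \<omega> m s \<alpha> \<and>
      z = (\<Oplus>\<^bsub>fib E q\<^esub>j\<in>{..<m}. poincare_residue n X D (\<alpha> j) q \<odot>\<^bsub>fib E q\<^esub> s j q)" for z
    using that key by (elim exE conjE) simp
qed

section \<open>Contractions and residues of the connection\<close>

lemma nabla_log_form: "openin (topo X) V \<Longrightarrow> s \<in> sec E V \<Longrightarrow> nabla s \<in> bundle_log_forms X D E V"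
  using connection[unfolded log_connection_def, THEN conjunct1, rule_format, OF conjI] .

lemma nabla_rules:
  assumes "openin (topo X) V" "s \<in> sec E V" "t \<in> sec E V" "f \<in> hol X V"
    and "y \<in> V - D" "derivation_at X y d"
  shows "(\<forall>z\<in>V. s z = t z) \<Longrightarrow> nabla s y d = nabla t y d"
    and "nabla (\<lambda>z. s z \<oplus>\<^bsub>fib E z\<^esub> t z) y d = nabla s y d \<oplus>\<^bsub>fib E y\<^esub> nabla t y d"
    and "nabla (\<lambda>z. f z \<odot>\<^bsub>fib E z\<^esub> s z) y d =
      f y \<odot>\<^bsub>fib E y\<^esub> nabla s y d \<oplus>\<^bsub>fib E y\<^esub> d f \<odot>\<^bsub>fib E y\<^esub> s y"
  using connection[unfolded log_connection_def carrier_tangent, THEN conjunct2, rule_format,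
      of V s t f y d] assms by simp_all

lemma nabla_polar_decomp:
  assumes V: "openin (topo X) V" "q \<in> V" "q \<in> U" and s: "s \<in> sec E V"
  obtains W H G where "q \<in> W" "W \<subseteq> V" "polar_decomp W (nabla s) H G"
proof -
  obtain V' m t \<alpha> where V': "openin (topo X) V'" "q \<in> V'" "V' \<subseteq> V" "is_tensor_sum X D E V' (nabla s) m t \<alpha>"
    using nabla_log_form[OF V(1) s] V(2) unfolding bundle_log_forms_def by blast
  have W: "openin (topo X) (V' \<inter> U)" "V' \<inter> U \<subseteq> U" using V' U_open by auto
  obtain H G where "polar_decomp (V' \<inter> U) (nabla s) H G"
    by (rule tensor_sum_polar_decomp[OF tensor_sum_subset[OF V'(4,1) W(1) Int_lower1] W])
  then show thesis using that[of "V' \<inter> U"] V' V by blast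
qed

text \<open>Contraction with \<open>w\<close> replaces dx/x by w(x)/x = a, so the pole cancels and
  the resulting coefficients extend across \<open>D\<close>.\<close>

lemma covariant_deriv_eq:
  assumes P: "polar_decomp V (nabla s) H G" and q: "q \<in> V" "q \<in> D"
    and B: "openin (topo X) B" "q \<in> B" and w: "w \<in> vector_fields X B"
    and a: "a \<in> hol X B" "\<forall>y\<in>B. w y (coord k) = coord k y * a y"
  shows "covariant_deriv X D E nabla w s q = comb q (\<lambda>i. H i q (w q) + G i q * a q)"
  unfolding covariant_deriv_def
proof (rule the_equality)
  note V = polar_decompD[OF P]
  define W where "W = V \<inter> B"
  have W: "openin (topo X) W" "q \<in> W" "W \<subseteq> V" "W \<subseteq> B" "W \<subseteq> U"
    using V(1,2) B q by (auto simp: W_def)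
  have qU: "q \<in> U" using W by blast
  define g where "g i y = H i y (w y) + G i y * a y" for i y
  have g: "g i \<in> hol X W" if i: "i < r" for i
  proof -
    have "(\<lambda>y. H i y (w y) + G i y * a y) \<in> hol X W"
      by (intro hol_add hol_mult W(1) one_form_hol[OF V(3)[OF i] W(1,3) vector_fields_subset[OF w W(4)]]
          hol_subset[OF V(4)[OF i] V(1) W(1,3)] hol_subset[OF a(1) B(1) W(1,4)])
    then show ?thesis unfolding g_def by simp
  qed
  have nab: "nabla s y (w y) = comb y (\<lambda>i. g i y)" if y: "y \<in> W - D" for y
  proof -
    have yU: "y \<in> U" using y W by blast
    have "coord k y \<noteq> 0" using on_D[OF yU] y by auto
    then have "w y (coord k) / coord k y = a y" using a(2) y W by auto
    then show ?thesis
      using V(5)[of y "w y"] vector_field_derivation[OF w] y W unfolding g_def by auto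
  qed
  have "(\<lambda>y. comb y (\<lambda>i. g i y)) \<in> sec E W"
    using g sec_iff[OF W(1,5)] by blast
  then show "\<exists>U t. openin (topo X) U \<and> q \<in> U \<and> t \<in> sec E U \<and> (\<forall>y\<in>U - D. t y = nabla s y (w y)) \<and>
      comb q (\<lambda>i. H i q (w q) + G i q * a q) = t q"
    using W(1,2) nab unfolding g_def by (intro exI[of _ W] exI[of _ "\<lambda>y. comb y (\<lambda>i. g i y)"]) (simp add: g_def)
  fix z assume "\<exists>U t. openin (topo X) U \<and> q \<in> U \<and> t \<in> sec E U \<and> (\<forall>y\<in>U - D. t y = nabla s y (w y)) \<and> z = t q"
  then obtain V' t where V': "openin (topo X) V'" "q \<in> V'" and t: "t \<in> sec E V'"
    "\<And>y. y \<in> V' - D \<Longrightarrow> t y = nabla s y (w y)" and z: "z = t q" by blast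
  define W' where "W' = W \<inter> V'"
  have W': "openin (topo X) W'" "q \<in> W'" "W' \<subseteq> W" "W' \<subseteq> V'" "W' \<subseteq> U"
    using V' W by (auto simp: W'_def)
  obtain f where f: "\<forall>i<r. f i \<in> hol X W'" "\<forall>y\<in>W'. t y = comb y (\<lambda>i. f i y)"
    using sec_iff[OF W'(1,5)] sec_subset[OF t(1) V'(1) W'(1,4)] by blast
  \<comment> \<open>Any other extension has the same frame coefficients off \<open>D\<close>, hence
    also at \<open>q\<close>.\<close>
  have "f i q = g i q" if i: "i < r" for i
  proof (rule hol_eq_at_D[OF W'(1,2) qU])
    show "f i \<in> hol X W'" using f i by blast
    show "g i \<in> hol X W'" by (rule hol_subset[OF g[OF i] W(1) W'(1,3)])
    fix y assume y: "y \<in> W' - D"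
    then have yU: "y \<in> U" using W' by blast
    have "comb y (\<lambda>i. f i y) = comb y (\<lambda>i. g i y)"
      using nab[of y] t(2)[of y] f(2)[rule_format, of y] y subsetD[OF W'(3)] subsetD[OF W'(4)] by auto
    then show "f i y = g i y" using comb_eq_iff[OF yU, of "\<lambda>i. f i y" "\<lambda>i. g i y"] i by simp
  qed
  then show "z = comb q (\<lambda>i. H i q (w q) + G i q * a q)"
    using z f(2) W'(2) comb_cong[OF qU, of "\<lambda>i. f i q" "\<lambda>i. g i q"] unfolding g_def by simp
qed

text \<open>\<open>nabla\<close> acts on total functions and its values are controlled only off
  \<open>D\<close>; there the two forms coincide, so they share a polar decomposition, which
  determines the residue.\<close>

lemma bundle_residue_cong:
  assumes V: "openin (topo X) V" "V \<subseteq> U" "q \<in> V" "q \<in> D" and st: "s \<in> sec E V" "t \<in> sec E V"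
    and eq: "\<forall>y\<in>V. s y = t y"
  shows "bundle_residue n X D E (nabla s) q = bundle_residue n X D E (nabla t) q"
proof -
  have qU: "q \<in> U" using V by blast
  obtain W H G where W: "q \<in> W" "W \<subseteq> V" "polar_decomp W (nabla s) H G"
    by (rule nabla_polar_decomp[OF V(1,3) qU st(1)])
  have "nabla s y d = nabla t y d" if "y \<in> W - D" "derivation_at X y d" for y d
    by (rule nabla_rules(1)[OF V(1) st hol_const[OF V(1)] _ that(2) eq]) (use that W in auto)
  then have "polar_decomp W (nabla t) H G" using W(3) unfolding polar_decomp_def by simp
  then show ?thesis
    using bundle_residue_eq[OF _ W(1) V(4) nabla_log_form V(3)] W(3) V(1) st by metis
qed

text \<open>By the Leibniz rule the added term contributes f \<nabla>e_i + df e_i. The polar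
  coefficients of the first part carry the factor f, which vanishes at \<open>q\<close>, and df has
  no pole.\<close>

lemma bundle_residue_step:
  assumes V: "openin (topo X) V" "V \<subseteq> U" "q \<in> V" "q \<in> D" and s: "s \<in> sec E V" and i: "i < r"
    and f: "f \<in> hol X V" "f q = 0"
    and t: "(\<lambda>y. s y \<oplus>\<^bsub>fib E y\<^esub> f y \<odot>\<^bsub>fib E y\<^esub> e i y) \<in> sec E V"
  shows "bundle_residue n X D E (nabla (\<lambda>y. s y \<oplus>\<^bsub>fib E y\<^esub> f y \<odot>\<^bsub>fib E y\<^esub> e i y)) q =
    bundle_residue n X D E (nabla s) q"
proof -
  have qU: "q \<in> U" using V by blast
  have eV: "e i \<in> sec E V" by (rule sec_subset[OF frame_sec[OF i] U_open V(1,2)])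
  have feV: "(\<lambda>y. f y \<odot>\<^bsub>fib E y\<^esub> e i y) \<in> sec E V"
  proof -
    have "f y \<odot>\<^bsub>fib E y\<^esub> e i y = comb y (\<lambda>l. f y * (if l = i then 1 else 0))" if "y \<in> V" for y
      using comb_frame[of y i] comb_smult[of y "f y"] that V i by (metis subsetD)
    moreover have "(\<lambda>y. f y * (if l = i then 1 else 0)) \<in> hol X V" for l
      by (intro hol_mult V(1) f(1) hol_const)
    ultimately show ?thesis
      unfolding sec_iff[OF V(1,2)] by (intro exI[of _ "\<lambda>l y. f y * (if l = i then 1 else 0)"]) simp
  qed
  obtain V1 H G where V1: "q \<in> V1" "V1 \<subseteq> V" "polar_decomp V1 (nabla s) H G"
    by (rule nabla_polar_decomp[OF V(1,3) qU s])
  obtain V2 H' G' where V2: "q \<in> V2" "V2 \<subseteq> V" "polar_decomp V2 (nabla (e i)) H' G'"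
    by (rule nabla_polar_decomp[OF V(1,3) qU eV])
  define W where "W = V1 \<inter> V2"
  have W: "openin (topo X) W" "q \<in> W" "W \<subseteq> V1" "W \<subseteq> V2" "W \<subseteq> V" "W \<subseteq> U"
    using polar_decompD(1)[OF V1(3)] polar_decompD(1)[OF V2(3)] V1 V2 V(2) by (auto simp: W_def)
  note P1 = polar_decompD[OF polar_decomp_subset[OF V1(3) W(1,3)]]
  note P2 = polar_decompD[OF polar_decomp_subset[OF V2(3) W(1,4)]]
  note fW = hol_subset[OF f(1) V(1) W(1,5)]
  \<comment> \<open>\<open>K\<close> and \<open>F\<close> are the holomorphic and polar coefficients
    of the new form; df enters only the former, at index \<open>i\<close>.\<close>
  define K where "K l y d = H l y d + (f y * H' l y d + (if l = i then 1 else 0) * d f)" for l y and d :: "'a tvec"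
  define F where "F l y = G l y + f y * G' l y" for l y
  have "polar_decomp W (nabla (\<lambda>y. s y \<oplus>\<^bsub>fib E y\<^esub> f y \<odot>\<^bsub>fib E y\<^esub> e i y)) K F"
    unfolding polar_decomp_def
  proof (intro conjI allI impI ballI W(1,6))
    fix l assume l: "l < r"
    have "(\<lambda>y d. H l y d + (f y * H' l y d + (if l = i then 1 else 0) * d f)) \<in> one_forms X W"
      by (intro one_forms_add one_forms_scale P1(3)[OF l] P2(3)[OF l] W(1) fW
          differential_one_form hol_const)
    then show "K l \<in> one_forms X W" unfolding K_def by simp
    have "(\<lambda>y. G l y + f y * G' l y) \<in> hol X W"
      by (intro hol_add hol_mult P1(4)[OF l] P2(4)[OF l] W(1) fW)
    then show "F l \<in> hol X W" unfolding F_def by simp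
  next
    fix y d assume y: "y \<in> W - D" and d: "derivation_at X y d"
    have yU: "y \<in> U" and yV: "y \<in> V - D" using y W by auto
    have "nabla (\<lambda>y. s y \<oplus>\<^bsub>fib E y\<^esub> f y \<odot>\<^bsub>fib E y\<^esub> e i y) y d =
        nabla s y d \<oplus>\<^bsub>fib E y\<^esub> nabla (\<lambda>y. f y \<odot>\<^bsub>fib E y\<^esub> e i y) y d"
      by (rule nabla_rules(2)[OF V(1) s feV f(1) yV d])
    also have "nabla (\<lambda>y. f y \<odot>\<^bsub>fib E y\<^esub> e i y) y d =
        f y \<odot>\<^bsub>fib E y\<^esub> nabla (e i) y d \<oplus>\<^bsub>fib E y\<^esub> d f \<odot>\<^bsub>fib E y\<^esub> e i y"
      by (rule nabla_rules(3)[OF V(1) eV eV f(1) yV d])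
    also have "e i y = comb y (\<lambda>l. if l = i then 1 else 0)"
      using comb_frame[OF yU i] by simp
    finally show "nabla (\<lambda>y. s y \<oplus>\<^bsub>fib E y\<^esub> f y \<odot>\<^bsub>fib E y\<^esub> e i y) y d =
        comb y (\<lambda>l. K l y d + F l y * (d (coord k) / coord k y))"
      unfolding P1(5)[OF y d] P2(5)[OF y d] comb_smult[OF yU] comb_add[OF yU] K_def F_def
      by (simp add: algebra_simps add_divide_distrib)
  qed
  from bundle_residue_eq[OF this W(2) V(4) nabla_log_form[OF V(1) t] V(3)]
    bundle_residue_eq[OF V1(3,1) V(4) nabla_log_form[OF V(1) s] V(3)]
  show ?thesis by (simp add: F_def f(2))
qed

text \<open>Passing from \<open>s\<close> to \<open>t\<close> one frame coefficient at a time: each step adds \<open>f e\<^sub>i\<close> with \<open>f\<close> vanishing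
  on \<open>D\<close>.\<close>

lemma bundle_residue_restriction:
  assumes V: "openin (topo X) V" "V \<subseteq> U" "q \<in> V" "q \<in> D" and st: "s \<in> sec E V" "t \<in> sec E V"
    and eq: "s q = t q"
  shows "bundle_residue n X D E (nabla s) q = bundle_residue n X D E (nabla t) q"
proof -
  have qU: "q \<in> U" using V by blast
  obtain c where c: "\<forall>i<r. c i \<in> hol X V" "\<forall>y\<in>V. s y = comb y (\<lambda>i. c i y)"
    using sec_iff[OF V(1,2)] st(1) by blast
  obtain c' where c': "\<forall>i<r. c' i \<in> hol X V" "\<forall>y\<in>V. t y = comb y (\<lambda>i. c' i y)"
    using sec_iff[OF V(1,2)] st(2) by blast
  have cq: "c i q = c' i q" if "i < r" for i
    using eq c(2) c'(2) V(3) comb_eq_iff[OF qU, of "\<lambda>i. c i q" "\<lambda>i. c' i q"] that by simp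
  \<comment> \<open>The first \<open>m\<close> coefficients come from \<open>t\<close> and the
    others from \<open>s\<close>; on \<open>V\<close> this interpolates from \<open>s\<close> at 0
    to \<open>t\<close> at \<open>r\<close>.\<close>
  define T where "T m y = comb y (\<lambda>i. if i < m then c' i y else c i y)" for m y
  have T_sec: "T m \<in> sec E V" for m
  proof -
    have "(\<lambda>y. if i < m then c' i y else c i y) \<in> hol X V" if "i < r" for i
      using c(1) c'(1) that by (cases "i < m") auto
    then show ?thesis
      unfolding sec_iff[OF V(1,2)] T_def
      by (intro exI[of _ "\<lambda>i y. if i < m then c' i y else c i y"]) simp
  qed
  have "bundle_residue n X D E (nabla (T m)) q = bundle_residue n X D E (nabla (T 0)) q" if "m \<le> r" for m
    using that
  proof (induction m)
    case (Suc m)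
    define f where "f y = c' m y - c m y" for y
    have m: "m < r" using Suc by simp
    have f: "f \<in> hol X V" "f q = 0"
      using hol_diff[OF V(1)] c(1) c'(1) m cq[OF m] unfolding f_def by auto
    have TS: "T (Suc m) y = T m y \<oplus>\<^bsub>fib E y\<^esub> f y \<odot>\<^bsub>fib E y\<^esub> e m y" if "y \<in> V" for y
    proof -
      have yU: "y \<in> U" using that V by blast
      have "T m y \<oplus>\<^bsub>fib E y\<^esub> f y \<odot>\<^bsub>fib E y\<^esub> e m y =
          comb y (\<lambda>i. (if i < m then c' i y else c i y) + f y * (if i = m then 1 else 0))"
        unfolding T_def comb_frame[OF yU m, symmetric] comb_smult[OF yU] comb_add[OF yU] ..
      also have "\<dots> = T (Suc m) y"
        unfolding T_def by (rule comb_cong[OF yU]) (auto simp: f_def less_Suc_eq)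
      finally show ?thesis by simp
    qed
    have sec': "(\<lambda>y. T m y \<oplus>\<^bsub>fib E y\<^esub> f y \<odot>\<^bsub>fib E y\<^esub> e m y) \<in> sec E V"
      using sec_sheaf[unfolded function_sheaf_def, THEN conjunct1, rule_format,
          of V "T (Suc m)" "\<lambda>y. T m y \<oplus>\<^bsub>fib E y\<^esub> f y \<odot>\<^bsub>fib E y\<^esub> e m y"] T_sec V(1) TS by blast
    have "bundle_residue n X D E (nabla (T (Suc m))) q =
        bundle_residue n X D E (nabla (\<lambda>y. T m y \<oplus>\<^bsub>fib E y\<^esub> f y \<odot>\<^bsub>fib E y\<^esub> e m y)) q"
      by (rule bundle_residue_cong[OF V T_sec sec']) (use TS in blast)
    also have "\<dots> = bundle_residue n X D E (nabla (T m)) q"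
      by (rule bundle_residue_step[OF V T_sec m f sec'])
    finally show ?case using Suc by simp
  qed simp
  from this[of r] have "bundle_residue n X D E (nabla (T r)) q = bundle_residue n X D E (nabla (T 0)) q"
    by simp
  moreover have "bundle_residue n X D E (nabla (T r)) q = bundle_residue n X D E (nabla t) q"
    by (rule bundle_residue_cong[OF V T_sec st(2)])
      (use c'(2) V(2) in \<open>auto simp: T_def intro!: comb_cong\<close>)
  moreover have "bundle_residue n X D E (nabla (T 0)) q = bundle_residue n X D E (nabla s) q"
    by (rule bundle_residue_cong[OF V T_sec st(1)])
      (use c(2) V(2) in \<open>auto simp: T_def intro!: comb_cong\<close>)
  ultimately show ?thesis by simp
qed

end

section \<open>The isotropy endomorphism\<close>

context divisor_chart
begin

section \<open>The identity operator of the normal bundle\<close>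

lemma normal_section_lift:
  assumes \<gamma>: "\<gamma> \<in> sec (normal_bundle X D) V" and V: "openin (topo (subspace_of X D)) V" and y: "y \<in> V"
  obtains O1 v where "openin (topo X) O1" "y \<in> O1" "v \<in> vector_fields X O1" "O1 \<inter> D \<subseteq> V"
    "\<forall>z\<in>O1 \<inter> D. normal_proj X D z (v z) = \<gamma> z"
proof -
  have "openin (subtopology (topo X) D) V" using V by (simp add: subspace_of_def)
  then obtain O2 where O2: "openin (topo X) O2" "V = O2 \<inter> D"
    using openin_subtopology by metis
  obtain O3 v where O3: "openin (topo X) O3" "y \<in> O3" "v \<in> vector_fields X O3"
    "\<forall>z\<in>O3 \<inter> V. \<gamma> z = normal_proj X D z (v z)"
    using \<gamma> y unfolding normal_bundle_def restrict_sheaf_def by auto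
  show thesis
    by (rule that[of "O2 \<inter> O3" v])
      (use O2 O3 y in \<open>auto intro: vector_fields_subset[OF O3(3)]\<close>)
qed

lemma normal_sectionI:
  assumes "openin (topo X) O1" "v \<in> vector_fields X O1"
  shows "(\<lambda>y. normal_proj X D y (v y)) \<in> sec (normal_bundle X D) (O1 \<inter> D)"
  using assms unfolding normal_bundle_def restrict_sheaf_def by auto

lemma normal_section_point:
  assumes "\<gamma> \<in> sec (normal_bundle X D) V" "openin (topo (subspace_of X D)) V" "y \<in> V"
  obtains d where "derivation_at X y d" "\<gamma> y = normal_proj X D y d"
proof -
  have yD: "y \<in> D" using assms(2,3) openin_subset by (fastforce simp: subspace_of_def)
  obtain O1 v where "openin (topo X) O1" "y \<in> O1" "v \<in> vector_fields X O1" "O1 \<inter> D \<subseteq> V"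
    "\<forall>z\<in>O1 \<inter> D. normal_proj X D z (v z) = \<gamma> z"
    by (rule normal_section_lift[OF assms])
  then show thesis using that[of "v y"] vector_field_derivation yD by auto
qed

text \<open>Multiplication by 1 in \<open>quotient_module\<close> is a coset sum; it fixes normal
  classes, not arbitrary sets of tangent vectors, so the values of \<open>\<gamma>\<close> must
  first be exhibited as classes.\<close>

lemma atiyah_R_one:
  assumes "\<gamma> \<in> sec (normal_bundle X D) V" "openin (topo (subspace_of X D)) V" "y \<in> V" "V \<subseteq> U \<inter> D"
  shows "atiyah_R (normal_bundle X D) (\<lambda>_. 1) \<gamma> y = \<gamma> y"
proof -
  obtain d where d: "derivation_at X y d" "\<gamma> y = normal_proj X D y d"
    by (rule normal_section_point[OF assms(1-3)])
  show ?thesis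
    unfolding atiyah_R_def d(2) using normal_proj_smult[of y d 1] d assms(3,4) by auto
qed

text \<open>The operator is linear over functions, so its anchor is the zero field. Membership is
  one of the conditions in \<open>restricted_connection\<close>.\<close>

lemma atiyah_R_one_in_atiyah:
  assumes "W \<subseteq> U \<inter> D"
  shows "atiyah_R (normal_bundle X D) (\<lambda>_. 1) \<in> atiyah (subspace_of X D) (normal_bundle X D) W"
proof -
  let ?N = "normal_bundle X D" and ?Y = "subspace_of X D"
  let ?\<Delta> = "atiyah_R ?N (\<lambda>_. 1)"
  have sec: "?\<Delta> \<gamma> \<in> sec ?N V" if V: "openin (topo ?Y) V" "V \<subseteq> W" and \<gamma>: "\<gamma> \<in> sec ?N V" for V \<gamma>
  proof -
    have "?\<Delta> \<gamma> y = \<gamma> y" if "y \<in> V" for y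
      by (rule atiyah_R_one[OF \<gamma> V(1) that]) (use V assms in blast)
    then show ?thesis using \<gamma> unfolding normal_bundle_def restrict_sheaf_def by simp
  qed
  have zero: "(\<lambda>p f. 0) \<in> vector_fields ?Y W"
  proof -
    have "(\<lambda>p. 0) \<in> hol ?Y V" if "openin (topo ?Y) V" for V
    proof -
      have "V \<subseteq> topspace (topo X)" using openin_subset[OF that] by (auto simp: subspace_of_def)
      then show ?thesis
        unfolding subspace_of_def restrict_sheaf_def
        using hol_const[OF openin_topspace, of 0] openin_topspace by auto
    qed
    then show ?thesis
      unfolding vector_fields_def by (simp add: tangent_space_def derivation_at_def)
  qed
  have rules: "?\<Delta> (\<lambda>q. \<gamma> q \<oplus>\<^bsub>fib ?N q\<^esub> \<eta> q) p = ?\<Delta> \<gamma> p \<oplus>\<^bsub>fib ?N p\<^esub> ?\<Delta> \<eta> p"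
      "?\<Delta> (\<lambda>q. c \<odot>\<^bsub>fib ?N q\<^esub> \<gamma> q) p = c \<odot>\<^bsub>fib ?N p\<^esub> ?\<Delta> \<gamma> p"
      "?\<Delta> (\<lambda>q. f q \<odot>\<^bsub>fib ?N q\<^esub> \<gamma> q) p =
        f p \<odot>\<^bsub>fib ?N p\<^esub> ?\<Delta> \<gamma> p \<oplus>\<^bsub>fib ?N p\<^esub> 0 \<odot>\<^bsub>fib ?N p\<^esub> \<gamma> p"
    if V: "openin (topo ?Y) V" "V \<subseteq> W" and \<gamma>: "\<gamma> \<in> sec ?N V" and \<eta>: "\<eta> \<in> sec ?N V" and p: "p \<in> V"
    for V \<gamma> \<eta> f c p
  proof -
    have pU: "p \<in> U" "p \<in> D" using V assms p by auto
    obtain d where d: "derivation_at X p d" "\<gamma> p = normal_proj X D p d"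
      by (rule normal_section_point[OF \<gamma> V(1) p])
    obtain d' where d': "derivation_at X p d'" "\<eta> p = normal_proj X D p d'"
      by (rule normal_section_point[OF \<eta> V(1) p])
    note simps = normal_proj_add[OF pU] normal_proj_smult[OF pU] d(1) d'(1)
      derivation_at_add derivation_at_smult derivation_at_zero
    show "?\<Delta> (\<lambda>q. \<gamma> q \<oplus>\<^bsub>fib ?N q\<^esub> \<eta> q) p = ?\<Delta> \<gamma> p \<oplus>\<^bsub>fib ?N p\<^esub> ?\<Delta> \<eta> p"
      "?\<Delta> (\<lambda>q. c \<odot>\<^bsub>fib ?N q\<^esub> \<gamma> q) p = c \<odot>\<^bsub>fib ?N p\<^esub> ?\<Delta> \<gamma> p"
      "?\<Delta> (\<lambda>q. f q \<odot>\<^bsub>fib ?N q\<^esub> \<gamma> q) p =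
        f p \<odot>\<^bsub>fib ?N p\<^esub> ?\<Delta> \<gamma> p \<oplus>\<^bsub>fib ?N p\<^esub> 0 \<odot>\<^bsub>fib ?N p\<^esub> \<gamma> p"
      unfolding atiyah_R_def d(2) d'(2) by (simp_all add: simps)
  qed
  show ?thesis
    unfolding atiyah_def
  proof (intro CollectI conjI allI impI bexI[OF _ zero] ballI; elim conjE)
    fix V \<gamma> assume "openin (topo ?Y) V" "V \<subseteq> W" "\<gamma> \<in> sec ?N V"
    then show "?\<Delta> \<gamma> \<in> sec ?N V" by (rule sec)
  next
    fix V \<gamma> \<eta> f c p
    assume *: "openin (topo ?Y) V" "V \<subseteq> W" "\<gamma> \<in> sec ?N V" "\<eta> \<in> sec ?N V" "p \<in> V"
    note r = rules[OF *]
    show "?\<Delta> (\<lambda>q. \<gamma> q \<oplus>\<^bsub>fib ?N q\<^esub> \<eta> q) p = ?\<Delta> \<gamma> p \<oplus>\<^bsub>fib ?N p\<^esub> ?\<Delta> \<eta> p" by (rule r(1))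
    show "?\<Delta> (\<lambda>q. c \<odot>\<^bsub>fib ?N q\<^esub> \<gamma> q) p = c \<odot>\<^bsub>fib ?N p\<^esub> ?\<Delta> \<gamma> p" by (rule r(2))
    show "?\<Delta> (\<lambda>q. f q \<odot>\<^bsub>fib ?N q\<^esub> \<gamma> q) p =
        f p \<odot>\<^bsub>fib ?N p\<^esub> ?\<Delta> \<gamma> p \<oplus>\<^bsub>fib ?N p\<^esub> 0 \<odot>\<^bsub>fib ?N p\<^esub> \<gamma> p" by (rule r(3))
  qed (simp add: atiyah_R_def)
qed

text \<open>The explicit logarithmic field - x \<partial> that induces the identity of the normal
  bundle; it shows that the description in \<open>restricted_connection\<close> has a
  candidate.\<close>

definition neg_euler_field :: "'a \<Rightarrow> 'a tvec" where
  "neg_euler_field y f = - coord k y * coord_field k y f"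

lemma neg_euler_field_log: "neg_euler_field \<in> log_vector_fields X D U"
proof -
  have "(\<lambda>y. - 1 * coord k y) \<in> hol X U"
    by (rule hol_cmult[OF U_open coord_hol[OF U_open order.refl]])
  then have "(\<lambda>y f. (- 1 * coord k y) * coord_field k y f) \<in> vector_fields X U"
    by (rule vector_field_smult[OF coord_field_vector_field U_open])
  then have w: "neg_euler_field \<in> vector_fields X U"
    by (simp add: neg_euler_field_def[abs_def])
  have "(\<lambda>p. neg_euler_field p f) \<in> divisor_ideal X D V"
    if "openin (topo X) V" "V \<subseteq> U" "f \<in> divisor_ideal X D V" for V f
    using vector_field_hol[OF w that(1,2)] that on_D unfolding divisor_ideal_def
    by (auto simp: neg_euler_field_def)
  with w show ?thesis unfolding log_vector_fields_def by blast
qed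

lemma neg_euler_field_coord: "y \<in> U \<Longrightarrow> neg_euler_field y (coord k) = coord k y * - 1"
  by (simp add: neg_euler_field_def coord_field_coord)

text \<open>On \<open>D = {x = 0}\<close> one has \<open>[- x \<partial>, v] \<equiv> v\<close> modulo the vectors tangent to \<open>D\<close>.\<close>

lemma atiyah_of_neg_euler_field:
  "atiyah_eq (subspace_of X D) (normal_bundle X D) (U \<inter> D)
    (atiyah_R (normal_bundle X D) (\<lambda>_. 1)) (atiyah_of_log X D neg_euler_field)"
  unfolding atiyah_eq_def
proof (intro allI impI ballI; elim conjE)
  fix V \<gamma> y
  assume V: "openin (topo (subspace_of X D)) V" "V \<subseteq> U \<inter> D" and \<gamma>: "\<gamma> \<in> sec (normal_bundle X D) V"
    and y: "y \<in> V"
  have yU: "y \<in> U" "y \<in> D" using V y by auto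
  obtain O1 v where O1: "openin (topo X) O1" "y \<in> O1" and v: "v \<in> vector_fields X O1" and "O1 \<inter> D \<subseteq> V"
    and lift: "\<forall>z\<in>O1 \<inter> D. normal_proj X D z (v z) = \<gamma> z"
    by (rule normal_section_lift[OF \<gamma> V(1) y])
  have w: "neg_euler_field \<in> vector_fields X U" by (rule log_vector_field[OF neg_euler_field_log])
  have W: "openin (topo X) (U \<inter> O1)" "y \<in> U \<inter> O1" using O1 yU U_open by auto
  have dv: "derivation_at X y (v y)" by (rule vector_field_derivation[OF v O1(2)])
  have x0: "coord k y = 0" using on_D yU by simp
  have "v y (\<lambda>q. neg_euler_field q (coord k)) = v y (\<lambda>q. - 1 * coord k q)"
    by (rule derivation_cong[OF dv _ U_open yU(1), symmetric])
      (simp_all only: neg_euler_field_coord mult.commute hol_near_cmult[OF coord_near[OF yU(1)]])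
  also have "\<dots> = - 1 * v y (coord k)"
    by (rule derivation_cmult[OF dv coord_near[OF yU(1)]])
  \<comment> \<open>The other term of the bracket carries the factor x(y) = 0; what remains is minus
    \<open>v\<close> applied to -x.\<close>
  finally have "lie_bracket X neg_euler_field v y (coord k) = v y (coord k)"
    by (simp add: lie_bracket_eq coord_near yU neg_euler_field_def x0)
  moreover have "derivation_at X y (lie_bracket X neg_euler_field v y)"
    by (rule derivation_lie_bracket[OF vector_fields_subset[OF w] vector_fields_subset[OF v] W]) auto
  ultimately have "normal_proj X D y (lie_bracket X neg_euler_field v y) = normal_proj X D y (v y)"
    using normal_proj_cong[OF yU _ dv] by simp
  then show "atiyah_R (normal_bundle X D) (\<lambda>_. 1) \<gamma> y = atiyah_of_log X D neg_euler_field \<gamma> y"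
    using atiyah_R_one[OF \<gamma> V(1) y V(2)] lift O1 yU
      atiyah_of_log_eq[OF neg_euler_field_log U_open yU(1) yU v O1, of \<gamma>] by simp
qed

text \<open>A logarithmic field inducing the identity is not unique near \<open>q\<close>, but its
  value and its factor \<open>a\<close> at \<open>q\<close> are forced, and the contracted
  connection at \<open>q\<close> depends on nothing else of the field.\<close>

lemma log_field_of_identity:
  assumes w: "w \<in> log_vector_fields X D V" and V: "openin (topo X) V" "q \<in> V" and q: "q \<in> U" "q \<in> D"
    and id: "atiyah_eq (subspace_of X D) (normal_bundle X D) (V \<inter> D)
      (atiyah_R (normal_bundle X D) (\<lambda>_. 1)) (atiyah_of_log X D w)"
    and B: "openin (topo X) B" "q \<in> B" and a: "a \<in> hol X B" "\<forall>y\<in>B. w y (coord k) = coord k y * a y"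
  shows "w q = (\<lambda>_. 0)" and "a q = - 1"
proof -
  have qt: "q \<in> topspace (topo X)" by (rule U_topspace[OF q(1)])
  define W where "W = V \<inter> U"
  have W: "openin (topo X) W" "q \<in> W" "W \<subseteq> V" "W \<subseteq> U"
    using V q U_open by (auto simp: W_def)
  have wV: "w \<in> vector_fields X V" by (rule log_vector_field[OF w])
  have dw: "derivation_at X q (w q)" by (rule vector_field_derivation[OF wV V(2)])
  have x0: "coord k q = 0" using on_D q by simp
  have WD: "openin (topo (subspace_of X D)) (W \<inter> D)"
    using W(1) by (auto simp: subspace_of_def openin_subtopology)
  have bracket: "lie_bracket X w v q (coord k) = v q (coord k)" if v: "v \<in> vector_fields X W" for v
  proof -
    define \<gamma> where "\<gamma> = (\<lambda>y. normal_proj X D y (v y))"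
    have \<gamma>: "\<gamma> \<in> sec (normal_bundle X D) (W \<inter> D)"
      unfolding \<gamma>_def by (rule normal_sectionI[OF W(1) v])
    have "\<gamma> q = atiyah_R (normal_bundle X D) (\<lambda>_. 1) \<gamma> q"
      by (rule atiyah_R_one[OF \<gamma> WD, symmetric]) (use W q in auto)
    also have "\<dots> = atiyah_of_log X D w \<gamma> q"
      using id WD \<gamma> W(2,3) q(2) unfolding atiyah_eq_def by blast
    also have "\<dots> = normal_proj X D q (lie_bracket X w v q)"
      by (rule atiyah_of_log_eq[OF w V q v W(1,2)]) (simp add: \<gamma>_def)
    finally show ?thesis
      using normal_proj_cong[OF q vector_field_derivation[OF v W(2)]
          derivation_lie_bracket[OF vector_fields_subset[OF wV W(3)] v W(1,2)]]
      unfolding \<gamma>_def by simp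
  qed
  have wx: "d (\<lambda>y. w y (coord k)) = a q * d (coord k)" if "derivation_at X q d" for d
  proof -
    note aq = hol_nearI[OF B a(1)]
    have "d (\<lambda>y. w y (coord k)) = d (\<lambda>y. coord k y * a y)"
      by (rule derivation_cong[OF that hol_near_mult[OF coord_near[OF q(1)] aq] B, symmetric])
        (use a(2) in simp)
    also have "\<dots> = coord k q * d a + a q * d (coord k)"
      by (rule derivation_mult[OF that coord_near[OF q(1)] aq])
    finally show ?thesis using x0 by simp
  qed
  have ek: "coord_field k \<in> vector_fields X W"
    by (rule vector_fields_subset[OF coord_field_vector_field W(4)])
  have dk: "derivation_at X q (coord_field k q)" by (rule coord_field_derivation[OF q(1)])
  \<comment> \<open>For v = \<partial> the function v(x) is constant near \<open>q\<close>, so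
    [w, v](x) = v(x) reduces to -a(q) = 1.\<close>
  have "w q (\<lambda>y. coord_field k y (coord k)) = w q (\<lambda>_. 1)"
    by (rule derivation_cong[OF dw hol_near_const[OF qt] U_open q(1), symmetric])
      (simp add: coord_field_coord)
  then have "w q (\<lambda>y. coord_field k y (coord k)) = 0"
    using derivation_const[OF dw qt] by simp
  then show a1: "a q = - 1"
    using bracket[OF ek] wx[OF dk] coord_field_coord[OF q(1), of k k]
    by (simp add: lie_bracket_eq coord_near q minus_equation_iff)
  show "w q = (\<lambda>_. 0)"
  proof (rule derivation_eqI[OF dw derivation_at_zero q(1)])
    fix j
    \<comment> \<open>Here v(x) = x_j near \<open>q\<close>, so the bracket on x is w(x_j) - a(q)
      v(x) = w(x_j) + v(x); comparison with v(x) leaves w(x_j) = 0, also for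
      \<open>j = k\<close>.\<close>
    define v where "v = (\<lambda>y f. coord j y * coord_field k y f)"
    have v: "v \<in> vector_fields X W"
      unfolding v_def by (rule vector_field_smult[OF ek W(1) coord_hol[OF W(1,4)]])
    have "w q (\<lambda>y. v y (coord k)) = w q (coord j)"
      by (rule derivation_cong[OF dw coord_near[OF q(1)] U_open q(1), symmetric])
        (simp add: v_def coord_field_coord)
    moreover have "v q (\<lambda>y. w y (coord k)) = - v q (coord k)"
      using wx[OF vector_field_derivation[OF v W(2)]] a1 by simp
    ultimately show "w q (coord j) = 0"
      using bracket[OF v] by (simp add: lie_bracket_eq coord_near q)
  qed
qed

end

context connection_chart
begin

section \<open>Comparison of residue and isotropy\<close>

lemma residue_endo_eq:
  assumes V: "openin (topo X) V" "V \<subseteq> U" and q: "q \<in> V" "q \<in> D"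
    and g: "g \<in> sec E V" "\<forall>y\<in>V \<inter> D. s y = g y"
  shows "residue_endo n X D E nabla s q = bundle_residue n X D E (nabla g) q"
  unfolding residue_endo_def
proof (rule the_equality)
  show "\<exists>U e. openin (topo X) U \<and> q \<in> U \<and> e \<in> sec E U \<and> (\<forall>q\<in>U \<inter> D. s q = e q) \<and>
      bundle_residue n X D E (nabla g) q = bundle_residue n X D E (nabla e) q"
    using V q g by blast
  fix z assume "\<exists>U e. openin (topo X) U \<and> q \<in> U \<and> e \<in> sec E U \<and> (\<forall>q\<in>U \<inter> D. s q = e q) \<and>
      z = bundle_residue n X D E (nabla e) q"
  then obtain V' g' where V': "openin (topo X) V'" "q \<in> V'" and g': "g' \<in> sec E V'" "\<forall>y\<in>V' \<inter> D. s y = g' y"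
    and z: "z = bundle_residue n X D E (nabla g') q" by blast
  have W: "openin (topo X) (V \<inter> V')" "V \<inter> V' \<subseteq> U" using V V' by auto
  show "z = bundle_residue n X D E (nabla g) q"
    unfolding z
    by (rule bundle_residue_restriction[OF W _ q(2) sec_subset[OF g'(1) V'(1) W(1) Int_lower2]
          sec_subset[OF g(1) V(1) W(1) Int_lower1]])
      (use q V' g(2)[rule_format, of q] g'(2)[rule_format, of q] in simp_all)
qed

lemma covariant_deriv_identity:
  assumes q: "q \<in> U" "q \<in> D" and V: "openin (topo X) V" "q \<in> V" and g: "g \<in> sec E V"
    and w: "w \<in> log_vector_fields X D V"
    and id: "atiyah_eq (subspace_of X D) (normal_bundle X D) (V \<inter> D)
      (atiyah_R (normal_bundle X D) (\<lambda>_. 1)) (atiyah_of_log X D w)"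
  shows "covariant_deriv X D E nabla w g q = \<ominus>\<^bsub>fib E q\<^esub> bundle_residue n X D E (nabla g) q"
proof -
  obtain B a where B: "openin (topo X) B" "q \<in> B" "B \<subseteq> V" "B \<subseteq> U" "a \<in> hol X B"
    "\<forall>y\<in>B. w y (coord k) = coord k y * a y"
    by (rule log_vector_field_coord[OF w V q])
  note wa = log_field_of_identity[OF w V q id B(1,2,5,6)]
  obtain W H G where W: "q \<in> W" "W \<subseteq> V" and P: "polar_decomp W (nabla g) H G"
    by (rule nabla_polar_decomp[OF V q(1) g])
  have "covariant_deriv X D E nabla w g q = comb q (\<lambda>i. H i q (w q) + G i q * a q)"
    by (rule covariant_deriv_eq[OF P W(1) q(2) B(1,2) vector_fields_subset[OF log_vector_field[OF w] B(3)] B(5,6)])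
  also have "\<dots> = comb q (\<lambda>i. - G i q)"
    \<comment> \<open>Since \<open>w q\<close> is zero the holomorphic parts disappear, and a(q) =
      -1 turns the polar coefficients into their negatives.\<close>
    by (rule comb_cong[OF q(1)]) (simp add: wa one_form_zero[OF polar_decompD(3)[OF P] W(1)])
  also have "\<dots> = \<ominus>\<^bsub>fib E q\<^esub> bundle_residue n X D E (nabla g) q"
    using bundle_residue_eq[OF P W(1) q(2) nabla_log_form[OF V(1) g] V(2)] comb_minus[OF q(1)] by simp
  finally show ?thesis .
qed

text \<open>\<open>neg_euler_field\<close> provides a candidate for the description of the
  restricted connection at the identity, and \<open>covariant_deriv_identity\<close> gives every
  candidate the same value, minus the residue of its extension of \<open>s\<close>.\<close>

lemma residue_endo_isotropy:
  assumes V: "openin (topo X) V" "V \<subseteq> U" and q: "q \<in> V" "q \<in> D"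
    and g: "g \<in> sec E V" "\<forall>y\<in>V \<inter> D. s y = g y"
  shows "residue_endo n X D E nabla s q =
    \<ominus>\<^bsub>fib E q\<^esub> isotropy (normal_bundle X D) (restricted_connection X D E nabla) s q"
proof -
  let ?\<rho> = "residue_endo n X D E nabla s q"
  have qU: "q \<in> U" using V q by blast
  interpret M: module complex_field "fib E q" by (rule fib_module[OF qU])
  have "restricted_connection X D E nabla (atiyah_R (normal_bundle X D) (\<lambda>_. 1)) s q = \<ominus>\<^bsub>fib E q\<^esub> ?\<rho>"
    unfolding restricted_connection_def
  proof (rule the_equality)
    have V_sub: "V \<inter> D \<subseteq> U \<inter> D" using V by blast
    have w: "neg_euler_field \<in> log_vector_fields X D V"
      using neg_euler_field_log vector_fields_subset[OF _ V(2)] V(2) unfolding log_vector_fields_def by blast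
    have id: "atiyah_eq (subspace_of X D) (normal_bundle X D) (V \<inter> D)
        (atiyah_R (normal_bundle X D) (\<lambda>_. 1)) (atiyah_of_log X D neg_euler_field)"
      using atiyah_of_neg_euler_field V_sub unfolding atiyah_eq_def by blast
    show "\<exists>U w e. openin (topo X) U \<and> q \<in> U \<and> w \<in> log_vector_fields X D U \<and> e \<in> sec E U \<and>
        atiyah_R (normal_bundle X D) (\<lambda>_. 1) \<in> atiyah (subspace_of X D) (normal_bundle X D) (U \<inter> D) \<and>
        atiyah_eq (subspace_of X D) (normal_bundle X D) (U \<inter> D)
          (atiyah_R (normal_bundle X D) (\<lambda>_. 1)) (atiyah_of_log X D w) \<and>
        (\<forall>q\<in>U \<inter> D. s q = e q) \<and> \<ominus>\<^bsub>fib E q\<^esub> ?\<rho> = covariant_deriv X D E nabla w e q"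
      using V q w g atiyah_R_one_in_atiyah[OF V_sub] id
        covariant_deriv_identity[OF qU q(2) V(1) q(1) g(1) w id] residue_endo_eq[OF V q g]
      by (intro exI[of _ V] exI[of _ neg_euler_field] exI[of _ g]) simp
    fix z assume "\<exists>U w e. openin (topo X) U \<and> q \<in> U \<and> w \<in> log_vector_fields X D U \<and> e \<in> sec E U \<and>
        atiyah_R (normal_bundle X D) (\<lambda>_. 1) \<in> atiyah (subspace_of X D) (normal_bundle X D) (U \<inter> D) \<and>
        atiyah_eq (subspace_of X D) (normal_bundle X D) (U \<inter> D)
          (atiyah_R (normal_bundle X D) (\<lambda>_. 1)) (atiyah_of_log X D w) \<and>
        (\<forall>q\<in>U \<inter> D. s q = e q) \<and> z = covariant_deriv X D E nabla w e q"
    then obtain V' w' g' where V': "openin (topo X) V'" "q \<in> V'" and w': "w' \<in> log_vector_fields X D V'"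
      and g': "g' \<in> sec E V'" "\<forall>q\<in>V' \<inter> D. s q = g' q"
      and id': "atiyah_eq (subspace_of X D) (normal_bundle X D) (V' \<inter> D)
          (atiyah_R (normal_bundle X D) (\<lambda>_. 1)) (atiyah_of_log X D w')"
      and z: "z = covariant_deriv X D E nabla w' g' q" by blast
    have W: "openin (topo X) (V' \<inter> U)" "V' \<inter> U \<subseteq> U" "q \<in> V' \<inter> U" using V' U_open qU by auto
    have "?\<rho> = bundle_residue n X D E (nabla g') q"
      by (rule residue_endo_eq[OF W q(2) sec_subset[OF g'(1) V'(1) W(1) Int_lower1]]) (use g'(2) in auto)
    then show "z = \<ominus>\<^bsub>fib E q\<^esub> ?\<rho>"
      unfolding z using covariant_deriv_identity[OF qU q(2) V' g'(1) w' id'] by simp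
  qed
  \<comment> \<open>The computation gives the isotropy as minus the residue; solving for the residue
    is a double negation, valid for elements of the fibre.\<close>
  moreover have "?\<rho> \<in> carrier (fib E q)"
  proof -
    obtain W H G where W: "q \<in> W" "W \<subseteq> V" and P: "polar_decomp W (nabla g) H G"
      by (rule nabla_polar_decomp[OF V(1) q(1) qU g(1)])
    show ?thesis
      unfolding residue_endo_eq[OF V q g]
        bundle_residue_eq[OF P W(1) q(2) nabla_log_form[OF V(1) g(1)] q(1)]
      by (rule comb_carrier[OF qU])
  qed
  ultimately show ?thesis
    unfolding isotropy_def by simp
qed

end

theorem proposition3p8:
  fixes X :: "'a cspace" and D :: "'a set" and E :: "('a, 'v) vbundle"
    and nabla :: "('a \<Rightarrow> 'v) \<Rightarrow> 'a \<Rightarrow> 'a tvec \<Rightarrow> 'v"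
    and W :: "'a set" and s :: "'a \<Rightarrow> 'v" and p :: 'a
  assumes "complex_manifold TYPE('n::finite) X"
    and "smooth_divisor TYPE('n) X D"
    and "vector_bundle X E"
    and "log_connection X D E nabla"
    and "openin (topo (subspace_of X D)) W"
    and "s \<in> sec (restrict_bundle X E) W"
    and "p \<in> W"
  shows "residue_endo TYPE('n) X D E nabla s p =
    \<ominus>\<^bsub>fib E p\<^esub> isotropy (normal_bundle X D) (restricted_connection X D E nabla) s p"
proof -
  have "openin (subtopology (topo X) D) W" using assms(5) by (simp add: subspace_of_def)
  then obtain O1 where O1: "openin (topo X) O1" "W = O1 \<inter> D"
    using openin_subtopology by metis
  have p: "p \<in> O1" "p \<in> D" using assms(7) O1 by auto
  obtain U1 and \<phi> :: "'a \<Rightarrow> complex ^ 'n" and k where U1: "p \<in> U1" "adapted_chart X D U1 \<phi> k"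
    using assms(2) p unfolding smooth_divisor_def by blast
  obtain U2 g where U2: "openin (topo X) U2" "p \<in> U2" "g \<in> sec E U2" "\<forall>y\<in>U2 \<inter> W. s y = g y"
    using assms(6,7) unfolding restrict_bundle_def restrict_sheaf_def by auto
  have U1_open: "openin (topo X) U1" using U1(2) unfolding adapted_chart_def chart_def by blast
  have pt: "p \<in> topspace (topo X)" using openin_subset[OF U1_open] U1(1) by blast
  obtain U3 r e where U3: "openin (topo X) U3" "p \<in> U3" "\<forall>i<r. e i \<in> sec E U3"
    "\<forall>q\<in>U3. bij_betw (\<lambda>c. \<Oplus>\<^bsub>fib E q\<^esub>i\<in>{..<r::nat}. c i \<odot>\<^bsub>fib E q\<^esub> e i q)
                  ({..<r} \<rightarrow>\<^sub>E UNIV) (carrier (fib E q))"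
    "\<forall>V s. openin (topo X) V \<and> V \<subseteq> U3 \<longrightarrow>
           (s \<in> sec E V \<longleftrightarrow>
              (\<exists>f. (\<forall>i<r. f i \<in> hol X V) \<and>
                   (\<forall>q\<in>V. s q = (\<Oplus>\<^bsub>fib E q\<^esub>i\<in>{..<r}. f i q \<odot>\<^bsub>fib E q\<^esub> e i q))))"
    using assms(3)[unfolded vector_bundle_def, THEN conjunct2, THEN conjunct2, THEN conjunct2, rule_format, OF pt]
    by (elim exE conjE)
  \<comment> \<open>\<open>connection_chart\<close> asks for an adapted chart and a frame over one
    open set.\<close>
  define U where "U = U1 \<inter> U3"
  have U: "openin (topo X) U" "p \<in> U" "U \<subseteq> U1" "U \<subseteq> U3"
    using U1_open U1 U3 by (auto simp: U_def)
  have sheaf: "t \<in> sec E V'" if "t \<in> sec E V" "openin (topo X) V" "openin (topo X) V'" "V' \<subseteq> V" for t V V'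
    using assms(3)[unfolded vector_bundle_def, THEN conjunct2, THEN conjunct2, THEN conjunct1,
        unfolded function_sheaf_def, THEN conjunct2, THEN conjunct1, rule_format, of V V' t] that by blast
  interpret C: mchart X "TYPE('n)" U1 \<phi>
    by unfold_locales (use assms(1) U1(2) in \<open>auto simp: adapted_chart_def\<close>)
  interpret connection_chart X "TYPE('n)" U \<phi> D k E nabla r e
  proof unfold_locales
    show "chart X U \<phi>" by (rule C.restrict_chart[OF U(1,3)])
    show "D \<inter> U = {q \<in> U. \<phi> q $ k = 0}" using U1(2) U(3) unfolding adapted_chart_def by blast
    show "closedin (topo X) D" using assms(2) unfolding smooth_divisor_def by blast
    show "bij_betw (\<lambda>c. \<Oplus>\<^bsub>fib E q\<^esub>i\<in>{..<r}. c i \<odot>\<^bsub>fib E q\<^esub> e i q)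
        ({..<r} \<rightarrow>\<^sub>E UNIV) (carrier (fib E q))" if "q \<in> U" for q
      using U3(4) U(4) that by blast
    show "e i \<in> sec E U" if "i < r" for i
      using sheaf[OF _ U3(1) U(1,4)] U3(3) that by blast
    show "t \<in> sec E V \<longleftrightarrow> (\<exists>f. (\<forall>i<r. f i \<in> hol X V) \<and>
        (\<forall>q\<in>V. t q = (\<Oplus>\<^bsub>fib E q\<^esub>i\<in>{..<r}. f i q \<odot>\<^bsub>fib E q\<^esub> e i q)))"
      if "openin (topo X) V" "V \<subseteq> U" for V t
      using U3(5)[rule_format, of V t] that U(4) by blast
  qed (use assms in auto)
  \<comment> \<open>\<open>g\<close> agrees with \<open>s\<close> on \<open>U2 \<inter> W\<close>
    only; intersecting with \<open>O1\<close> puts the points of \<open>D\<close> into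
    \<open>W\<close>.\<close>
  have V: "openin (topo X) (U \<inter> U2 \<inter> O1)" "U \<inter> U2 \<inter> O1 \<subseteq> U" "p \<in> U \<inter> U2 \<inter> O1" "U \<inter> U2 \<inter> O1 \<subseteq> U2"
    using U U2 O1 p by auto
  show ?thesis
    by (rule residue_endo_isotropy[OF V(1-3) p(2) sheaf[OF U2(3,1) V(1,4)]]) (use U2(4) O1 in auto)
qed

end
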